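(* Let $s\ge 1$ and suppose $\nu<\frac16$. Then the initial value problem $$u_t+u_x+\tfrac32\,u u_x+\nu\, u_{xxx}-\left(\tfrac16-\nu\right)u_{xxt}=0,\qquad u(x,0)=u_0(x),\qquad x\in\mathbb{R},$$ is globally well-posed in $H^s(\mathbb{R})$.
   Context: Functions are real-valued and $H^s(\mathbb{R})$ is the usual $L^2$-based Sobolev space. Globally well-posed in $H^s(\mathbb{R})$ means: for every $u_0\in H^s(\mathbb{R})$ and every $T>0$ there is a unique solution $u\in C([0,T];H^s(\mathbb{R}))$ with $u(\cdot,0)=u_0$, and it depends continuously on $u_0$ in $H^s(\mathbb{R})$. A solution is understood in the integral (Duhamel) form $$u(x,t)=S(t)u_0-i\int_0^tS(t-\tau)\psi(\partial_x)u^2(x,\tau)\,d\tau,\qquad \widehat{S(t)u_0}=e^{-i\phi(\xi)t}\widehat{u_0},$$ where the Fourier transform is $\widehat f(\xi)=\frac1{\sqrt{2\pi}}\int_{\mathbb{R}}f(x)e^{-i\xi x}\,dx$ and $\psi(\partial_x)$ is the Fourier multiplier $\widehat{\psi(\partial_x)f}(\xi)=\psi(\xi)\widehat f(\xi)$, with $$\phi(\xi)=\frac{\xi(1-\nu\xi^2)}{(\frac16-\nu)\xi^2+1},\qquad \psi(\xi)=\frac{3\xi}{4\left[(\frac16-\nu)\xi^2+1\right]}.$$ *)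

theory Defs
  imports "HOL-Analysis.Analysis"
begin

text \<open>Elements of the function spaces below are Borel representatives, and equality of such
  elements is equality almost everywhere.\<close>

definition L2 :: "(real \<Rightarrow> complex) set" where
  "L2 = {f \<in> borel_measurable lborel. integrable lborel (\<lambda>x. (cmod (f x))\<^sup>2)}"

text \<open>The Fourier transform on \<open>L2\<close> is the limit in the mean of the transforms of the
  truncations of \<open>f\<close>. By Plancherel's theorem it exists for every \<open>f \<in> L2\<close>, and it is unique
  up to null sets. The integral \<open>\<integral>\<^sup>+\<close> is extended-valued, so no integrability is presupposed.\<close>

definition is_fourier :: "(real \<Rightarrow> complex) \<Rightarrow> (real \<Rightarrow> complex) \<Rightarrow> bool" where
  "is_fourier f g \<longleftrightarrow> f \<in> L2 \<and> g \<in> L2 \<and>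
     (\<lambda>n::nat. \<integral>\<^sup>+\<xi>. ennreal ((cmod (g \<xi> - complex_of_real (1 / sqrt (2 * pi)) *
        (LBINT x:{- real n..real n}. f x * exp (- (\<i> * complex_of_real (\<xi> * x))))))\<^sup>2) \<partial>lborel)
     \<longlonglongrightarrow> 0"

definition fourier :: "(real \<Rightarrow> complex) \<Rightarrow> real \<Rightarrow> complex" where
  "fourier f = (SOME g. is_fourier f g)"

text \<open>\<open>sobolev s\<close> is the Sobolev space of order \<open>s\<close> for \<open>s \<ge> 0\<close> only: negative orders would
  need distributions outside \<open>L2\<close>.\<close>

definition sobolev :: "real \<Rightarrow> (real \<Rightarrow> complex) set" where
  "sobolev s = {f \<in> L2. integrable lborel (\<lambda>\<xi>. (1 + \<xi>\<^sup>2) powr s * (cmod (fourier f \<xi>))\<^sup>2)}"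

definition sobolev_norm :: "real \<Rightarrow> (real \<Rightarrow> complex) \<Rightarrow> real" where
  "sobolev_norm s f = sqrt (LBINT \<xi>. (1 + \<xi>\<^sup>2) powr s * (cmod (fourier f \<xi>))\<^sup>2)"

definition real_sobolev :: "real \<Rightarrow> (real \<Rightarrow> real) set" where
  "real_sobolev s = {f. (\<lambda>x. complex_of_real (f x)) \<in> sobolev s}"

definition real_sobolev_dist :: "real \<Rightarrow> (real \<Rightarrow> real) \<Rightarrow> (real \<Rightarrow> real) \<Rightarrow> real" where
  "real_sobolev_dist s f g = sobolev_norm s (\<lambda>x. complex_of_real (f x - g x))"

text \<open>A representative of the function with Fourier transform \<open>m \<cdot> fourier f\<close>; it exists
  whenever that product lies in \<open>L2\<close>, in particular for bounded measurable \<open>m\<close>.\<close>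

definition fourier_multiplier ::
    "(real \<Rightarrow> complex) \<Rightarrow> (real \<Rightarrow> complex) \<Rightarrow> real \<Rightarrow> complex" where
  "fourier_multiplier m f =
     (SOME g. g \<in> L2 \<and> (AE \<xi> in lborel. fourier g \<xi> = m \<xi> * fourier f \<xi>))"

text \<open>\<open>G\<close> is the integral over \<open>[a, b]\<close> of the Sobolev-space-valued function \<open>F\<close>, as a limit of
  Riemann sums in the Sobolev norm; for continuous \<open>F\<close> this is also the Bochner integral.\<close>

definition has_sobolev_integral ::
    "real \<Rightarrow> (real \<Rightarrow> real \<Rightarrow> complex) \<Rightarrow> (real \<Rightarrow> complex) \<Rightarrow> real \<Rightarrow> real \<Rightarrow> bool" where
  "has_sobolev_integral s F G a b \<longleftrightarrow>
     (\<forall>\<tau>\<in>{a..b}. F \<tau> \<in> sobolev s) \<and> G \<in> sobolev s \<and>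
     (\<forall>\<epsilon>>0. \<exists>\<delta>>0. \<forall>p. p tagged_division_of {a..b} \<and> (\<lambda>\<tau>. ball \<tau> \<delta>) fine p \<longrightarrow>
        sobolev_norm s (\<lambda>x. (\<Sum>(\<tau>, K)\<in>p. measure lborel K *\<^sub>R F \<tau> x) - G x) < \<epsilon>)"

definition sobolev_continuous :: "real \<Rightarrow> real \<Rightarrow> (real \<Rightarrow> real \<Rightarrow> real) \<Rightarrow> bool" where
  "sobolev_continuous s T u \<longleftrightarrow> (\<forall>t\<in>{0..T}. u t \<in> real_sobolev s \<and>
     ((\<lambda>r. real_sobolev_dist s (u r) (u t)) \<longlongrightarrow> 0) (at t within {0..T}))"

text \<open>The equation is
  \<open>u_t + u_x + (3/2) u u_x + \<nu> u_xxx - (1/6 - \<nu>) u_xxt = 0\<close>. With \<open>u u_x = (u^2)_x / 2\<close>, its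
  Fourier transform in \<open>x\<close> is \<open>v_t = - \<i> \<phi> v - \<i> \<psi> w\<close>, where \<open>v\<close> and \<open>w\<close> are the transforms
  of \<open>u\<close> and \<open>u^2\<close> and the symbols \<open>\<phi>\<close> and \<open>\<psi>\<close> are as follows.\<close>

definition kdv_bbm_phi :: "real \<Rightarrow> real \<Rightarrow> real" where
  "kdv_bbm_phi \<nu> \<xi> = \<xi> * (1 - \<nu> * \<xi>\<^sup>2) / ((1/6 - \<nu>) * \<xi>\<^sup>2 + 1)"

definition kdv_bbm_psi :: "real \<Rightarrow> real \<Rightarrow> real" where
  "kdv_bbm_psi \<nu> \<xi> = 3 * \<xi> / (4 * ((1/6 - \<nu>) * \<xi>\<^sup>2 + 1))"

definition kdv_bbm_group :: "real \<Rightarrow> real \<Rightarrow> (real \<Rightarrow> complex) \<Rightarrow> real \<Rightarrow> complex" where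
  "kdv_bbm_group \<nu> t =
     fourier_multiplier (\<lambda>\<xi>. exp (- (\<i> * complex_of_real (kdv_bbm_phi \<nu> \<xi> * t))))"

definition kdv_bbm_psi_op :: "real \<Rightarrow> (real \<Rightarrow> complex) \<Rightarrow> real \<Rightarrow> complex" where
  "kdv_bbm_psi_op \<nu> = fourier_multiplier (\<lambda>\<xi>. complex_of_real (kdv_bbm_psi \<nu> \<xi>))"

text \<open>Here \<open>u t x\<close> is the value at time \<open>t\<close> and position \<open>x\<close>.\<close>

definition kdv_bbm_solution ::
    "real \<Rightarrow> real \<Rightarrow> real \<Rightarrow> (real \<Rightarrow> real) \<Rightarrow> (real \<Rightarrow> real \<Rightarrow> real) \<Rightarrow> bool" where
  "kdv_bbm_solution \<nu> s T u\<^sub>0 u \<longleftrightarrow>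
     sobolev_continuous s T u \<and>
     (AE x in lborel. u 0 x = u\<^sub>0 x) \<and>
     (\<forall>t\<in>{0..T}. \<exists>G.
        has_sobolev_integral s
          (\<lambda>\<tau>. kdv_bbm_group \<nu> (t - \<tau>) (kdv_bbm_psi_op \<nu> (\<lambda>x. complex_of_real ((u \<tau> x)\<^sup>2))))
          G 0 t \<and>
        (AE x in lborel. complex_of_real (u t x) =
           kdv_bbm_group \<nu> t (\<lambda>x. complex_of_real (u\<^sub>0 x)) x - \<i> * G x))"

text \<open>\<open>sol T u\<^sub>0 u\<close> means that \<open>u\<close> is a solution on \<open>[0, T]\<close> with initial value \<open>u\<^sub>0\<close>, and is
  expected to imply \<open>sobolev_continuous s T u\<close>. The last clause is continuity of the solution
  map from the Sobolev space into the curves on \<open>[0, T]\<close> with the supremum norm.\<close>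

definition globally_well_posed ::
    "real \<Rightarrow> (real \<Rightarrow> (real \<Rightarrow> real) \<Rightarrow> (real \<Rightarrow> real \<Rightarrow> real) \<Rightarrow> bool) \<Rightarrow> bool" where
  "globally_well_posed s sol \<longleftrightarrow>
     (\<forall>u\<^sub>0\<in>real_sobolev s. \<forall>T>0.
        (\<exists>u. sol T u\<^sub>0 u) \<and>
        (\<forall>u v. sol T u\<^sub>0 u \<and> sol T u\<^sub>0 v \<longrightarrow>
           (\<forall>t\<in>{0..T}. AE x in lborel. u t x = v t x)) \<and>
        (\<forall>\<epsilon>>0. \<exists>\<delta>>0. \<forall>v\<^sub>0\<in>real_sobolev s. real_sobolev_dist s v\<^sub>0 u\<^sub>0 < \<delta> \<longrightarrow>
           (\<forall>u v. sol T u\<^sub>0 u \<and> sol T v\<^sub>0 v \<longrightarrow>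
              (\<forall>t\<in>{0..T}. real_sobolev_dist s (v t) (u t) < \<epsilon>))))"

end

theory Submission imports Defs "HOL-Probability.Levy" begin

text \<open>
  The equation is an evolution equation whose linear part generates a group of isometries and whose
  nonlinear part is harmless: the multiplier \<open>\<psi>\<close> is bounded and the Sobolev spaces of order \<open>s \<ge> 1\<close>
  are closed under products, so \<open>u \<mapsto> \<psi>(\<partial>\<^sub>x) u\<^sup>2\<close> is a bounded quadratic map on each of them. A bounded
  quadratic map gives local solutions; global ones need a bound that does not depend on the existence
  time. It comes from two facts.

  First, the energy \<open>\<integral> u\<^sup>2 + (1/6 - \<nu>) u\<^sub>x\<^sup>2\<close> is conserved (\<open>energy_nonlinearity\<close>). Its weight cancels the
  denominator of \<open>\<psi>\<close>, and what remains is \<open>\<integral> u\<^sup>2 u\<^sub>x = 0\<close>, which on the Fourier side is the symmetry of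
  an integral over three frequencies with sum zero (\<open>trilinear_cancellation\<close>). Since \<open>\<nu> < 1/6\<close>, the
  energy is equivalent to the square of the norm of order one. Secondly, the nonlinear term obeys a tame
  estimate (\<open>norm_nonlinearity_le\<close>): its norm of order \<open>s\<close> is at most a constant times the norm of
  order one times the norm of order \<open>s\<close>. With the norm of order one under control, the norm of order
  \<open>s\<close> grows at most exponentially by Gronwall's lemma, whatever \<open>s \<ge> 1\<close> is.

  The argument is carried out for an abstract quadratic evolution equation in a Banach space, in the
  locale \<open>quadratic_evolution\<close>. Instead of continuing local solutions, the nonlinear term is truncated
  radially at a radius above the a priori bound. The truncated equation is globally Lipschitz and is
  solved on the whole interval by one contraction argument; as the truncation multiplies the quadratic
  term by a scalar in \<open>[0, 1]\<close>, it preserves the conservation law and the tame estimate, so the solution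
  never leaves the ball in which nothing was truncated (\<open>mild_exists\<close>). Gronwall's lemma also gives
  uniqueness and continuous dependence.

  The application takes place on the Fourier side, in the Hilbert space of square-integrable functions
  modulo null sets, where a function \<open>u\<close> is represented by its transform times \<open>(1 + \<xi>\<^sup>2)\<close> to the power
  \<open>s / 2\<close>. The Plancherel theory needed for this is developed from the Gaussian: the transform is a
  contraction by Gaussian regularisation (\<open>fourier_integral_L2\<close>), and it is inverted by its adjoint
  because that holds for modulated Gaussians, which are total by Levy's uniqueness theorem
  (\<open>inv_fourier_fourier_l2\<close>). Products become convolutions (\<open>fourier_l2_product\<close>), and the solutions of
  the initial value problem correspond exactly to the mild solutions of the abstract equation
  (\<open>solution_iff_mild\<close>).
\<close>


section \<open>The Hilbert space of square-integrable functions\<close>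

lemma L2_measurable [measurable_dest]: "f \<in> L2 \<Longrightarrow> f \<in> borel_measurable borel"
  by (simp add: L2_def)

lemma L2_integrable_square: "f \<in> L2 \<Longrightarrow> integrable lborel (\<lambda>x. (cmod (f x))\<^sup>2)"
  by (simp add: L2_def)

lemma L2_I:
  "f \<in> borel_measurable borel \<Longrightarrow> integrable lborel (\<lambda>x. (cmod (f x))\<^sup>2) \<Longrightarrow> f \<in> L2"
  by (simp add: L2_def)

lemma borel_measurable_cnj [measurable (raw)]:
  "f \<in> borel_measurable M \<Longrightarrow> (\<lambda>x. cnj (f x)) \<in> borel_measurable M"
  by (rule borel_measurable_continuous_on[of cnj]) (auto intro: continuous_intros)

lemma L2_cong_AE:
  assumes "f \<in> L2" "g \<in> borel_measurable borel" "AE x in lborel. f x = g x"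
  shows "g \<in> L2"
proof (rule L2_I)
  have [measurable]: "f \<in> borel_measurable borel" using assms(1) by (rule L2_measurable)
  show "integrable lborel (\<lambda>x. (cmod (g x))\<^sup>2)"
  proof (rule integrable_cong_AE_imp[OF L2_integrable_square[OF assms(1)]])
    note [measurable] = assms(2)
    show "(\<lambda>x. (cmod (g x))\<^sup>2) \<in> borel_measurable lborel" by measurable
    show "AE x in lborel. (cmod (f x))\<^sup>2 = (cmod (g x))\<^sup>2"
      using assms(3) by eventually_elim simp
  qed
qed fact

lemma L2_dominated:
  assumes "g \<in> L2" "f \<in> borel_measurable borel" "\<And>x. cmod (f x) \<le> cmod (g x)"
  shows "f \<in> L2"
proof (rule L2_I[OF assms(2)], rule Bochner_Integration.integrable_bound
      [OF L2_integrable_square[OF assms(1)]])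
  note [measurable] = assms(2)
  show "(\<lambda>x. (cmod (f x))\<^sup>2) \<in> borel_measurable lborel" by measurable
  show "AE x in lborel. norm ((cmod (f x))\<^sup>2) \<le> norm ((cmod (g x))\<^sup>2)"
    using assms(3) by (simp add: power_mono)
qed

lemma L2_mult_const:
  assumes "f \<in> L2" shows "(\<lambda>x. c * f x) \<in> L2"
proof (rule L2_I)
  note [measurable] = L2_measurable[OF assms]
  show "(\<lambda>x. c * f x) \<in> borel_measurable borel" by measurable
  show "integrable lborel (\<lambda>x. (cmod (c * f x))\<^sup>2)"
    using integrable_mult_right[OF L2_integrable_square[OF assms], of "(cmod c)\<^sup>2"]
    by (simp add: norm_mult power_mult_distrib)
qed

lemma L2_zero: "(\<lambda>_. 0) \<in> L2"
  by (rule L2_I) auto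

lemma L2_add:
  assumes "f \<in> L2" "g \<in> L2"
  shows "(\<lambda>x. f x + g x) \<in> L2"
proof (rule L2_I)
  note [measurable] = assms[THEN L2_measurable]
  show "(\<lambda>x. f x + g x) \<in> borel_measurable borel" by measurable
  have "(cmod (f x + g x))\<^sup>2 \<le> 2 * (cmod (f x))\<^sup>2 + 2 * (cmod (g x))\<^sup>2" for x
  proof -
    have "(cmod (f x + g x))\<^sup>2 \<le> (cmod (f x) + cmod (g x))\<^sup>2"
      by (intro power_mono norm_triangle_ineq) auto
    also have "\<dots> \<le> 2 * (cmod (f x))\<^sup>2 + 2 * (cmod (g x))\<^sup>2"
      using sum_squares_bound[of "cmod (f x)" "cmod (g x)"] by (simp add: power2_sum)
    finally show ?thesis .
  qed
  note bound = this
  show "integrable lborel (\<lambda>x. (cmod (f x + g x))\<^sup>2)"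
  proof (rule Bochner_Integration.integrable_bound)
    show "integrable lborel (\<lambda>x. 2 * (cmod (f x))\<^sup>2 + 2 * (cmod (g x))\<^sup>2)"
      using assms by (simp add: L2_integrable_square)
    show "(\<lambda>x. (cmod (f x + g x))\<^sup>2) \<in> borel_measurable lborel" by measurable
    show "AE x in lborel. norm ((cmod (f x + g x))\<^sup>2)
        \<le> norm (2 * (cmod (f x))\<^sup>2 + 2 * (cmod (g x))\<^sup>2)"
      using bound by simp
  qed
qed

lemma L2_uminus: "f \<in> L2 \<Longrightarrow> (\<lambda>x. - f x) \<in> L2"
  using L2_mult_const[of f "-1"] by simp

lemma L2_diff: "f \<in> L2 \<Longrightarrow> g \<in> L2 \<Longrightarrow> (\<lambda>x. f x - g x) \<in> L2"
  using L2_add[OF _ L2_uminus, of f g] by simp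

lemma L2_scaleR: "f \<in> L2 \<Longrightarrow> (\<lambda>x. c *\<^sub>R f x) \<in> L2"
  using L2_mult_const[of f "complex_of_real c"] by (simp add: scaleR_conv_of_real)

lemma L2_cnj: "f \<in> L2 \<Longrightarrow> (\<lambda>x. cnj (f x)) \<in> L2"
  by (rule L2_dominated[of f]) (simp_all add: L2_measurable borel_measurable_cnj)

lemma L2_mult_integrable:
  assumes "f \<in> L2" "g \<in> L2"
  shows "integrable lborel (\<lambda>x. f x * g x)"
proof (rule Bochner_Integration.integrable_bound)
  note [measurable] = assms[THEN L2_measurable]
  show "integrable lborel (\<lambda>x. (cmod (f x))\<^sup>2 + (cmod (g x))\<^sup>2)"
    by (intro Bochner_Integration.integrable_add L2_integrable_square assms)
  show "AE x in lborel. cmod (f x * g x) \<le> norm ((cmod (f x))\<^sup>2 + (cmod (g x))\<^sup>2)"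
  proof (rule AE_I2)
    fix x
    have "2 * cmod (f x) * cmod (g x) \<le> (cmod (f x))\<^sup>2 + (cmod (g x))\<^sup>2"
      by (rule sum_squares_bound)
    moreover have "cmod (f x) * cmod (g x) \<ge> 0" by simp
    ultimately have "cmod (f x) * cmod (g x) \<le> (cmod (f x))\<^sup>2 + (cmod (g x))\<^sup>2"
      by linarith
    then show "cmod (f x * g x) \<le> norm ((cmod (f x))\<^sup>2 + (cmod (g x))\<^sup>2)"
      by (simp add: norm_mult)
  qed
  show "(\<lambda>x. f x * g x) \<in> borel_measurable lborel" by measurable
qed

text \<open>Functions that agree almost everywhere are identified, so that square-integrable functions form
  a type of class \<^class>\<open>real_inner\<close> and \<^class>\<open>banach\<close>. Continuity, derivatives and integrals of curves
  of functions are then the ones of the library. One type serves all Sobolev orders, because the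
  Fourier transform maps every Sobolev space onto a weighted copy of it.\<close>

quotient_type l2 = "real \<Rightarrow> complex" /
  partial: "\<lambda>f g. f \<in> L2 \<and> g \<in> L2 \<and> (AE x in lborel. f x = g x)"
proof (rule part_equivpI)
  show "\<exists>f. f \<in> L2 \<and> f \<in> L2 \<and> (AE x in lborel. f x = f x)"
    using L2_zero by auto
  show "symp (\<lambda>f g. f \<in> L2 \<and> g \<in> L2 \<and> (AE x in lborel. f x = g x))"
  proof (rule sympI, elim conjE, intro conjI)
    fix f g :: "real \<Rightarrow> complex"
    assume "AE x in lborel. f x = g x"
    then show "AE x in lborel. g x = f x"
      by eventually_elim simp
  qed
  show "transp (\<lambda>f g. f \<in> L2 \<and> g \<in> L2 \<and> (AE x in lborel. f x = g x))"
  proof (rule transpI, elim conjE, intro conjI)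
    fix f g h :: "real \<Rightarrow> complex"
    assume "AE x in lborel. f x = g x" "AE x in lborel. g x = h x"
    then show "AE x in lborel. f x = h x"
      by eventually_elim simp
  qed
qed

instantiation l2 :: real_vector
begin

lift_definition zero_l2 :: l2 is "\<lambda>_. 0" by (simp add: L2_zero)

lift_definition plus_l2 :: "l2 \<Rightarrow> l2 \<Rightarrow> l2" is "\<lambda>f g x. f x + g x"
  by (elim conjE, intro conjI L2_add, assumption+, erule (1) eventually_elim2, simp)

lift_definition minus_l2 :: "l2 \<Rightarrow> l2 \<Rightarrow> l2" is "\<lambda>f g x. f x - g x"
  by (elim conjE, intro conjI L2_diff, assumption+, erule (1) eventually_elim2, simp)

lift_definition uminus_l2 :: "l2 \<Rightarrow> l2" is "\<lambda>f x. - f x"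
  by (elim conjE, intro conjI L2_uminus, assumption+, erule eventually_mono, simp)

lift_definition scaleR_l2 :: "real \<Rightarrow> l2 \<Rightarrow> l2" is "\<lambda>c f x. c *\<^sub>R f x"
  by (elim conjE, intro conjI L2_scaleR, assumption+, erule eventually_mono, simp)

instance
proof
  fix u v w :: l2 and a b :: real
  show "u + v + w = u + (v + w)" by transfer (simp add: L2_add add.assoc)
  show "u + v = v + u" by transfer (simp add: L2_add add.commute)
  show "0 + u = u" by transfer simp
  show "- u + u = 0" by transfer (simp add: L2_zero)
  show "u - v = u + - v" by transfer (simp add: L2_diff)
  show "a *\<^sub>R (u + v) = a *\<^sub>R u + a *\<^sub>R v"
    by transfer (simp add: L2_add L2_scaleR scaleR_add_right)
  show "(a + b) *\<^sub>R u = a *\<^sub>R u + b *\<^sub>R u"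
    by transfer (simp add: L2_add L2_scaleR scaleR_add_left)
  show "a *\<^sub>R b *\<^sub>R u = (a * b) *\<^sub>R u" by transfer (simp add: L2_scaleR)
  show "1 *\<^sub>R u = u" by transfer simp
qed

end

instantiation l2 :: real_inner
begin

lift_definition inner_l2 :: "l2 \<Rightarrow> l2 \<Rightarrow> real" is "\<lambda>f g. Re (LINT x|lborel. f x * cnj (g x))"
proof -
  fix f f' g g' :: "real \<Rightarrow> complex"
  assume f: "f \<in> L2 \<and> f' \<in> L2 \<and> (AE x in lborel. f x = f' x)"
    and g: "g \<in> L2 \<and> g' \<in> L2 \<and> (AE x in lborel. g x = g' x)"
  then have [measurable]: "f \<in> borel_measurable borel" "f' \<in> borel_measurable borel"
    "g \<in> borel_measurable borel" "g' \<in> borel_measurable borel"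
    by (auto intro: L2_measurable)
  have "(LINT x|lborel. f x * cnj (g x)) = (LINT x|lborel. f' x * cnj (g' x))"
  proof (intro integral_cong_AE)
    from f g have "AE x in lborel. f x = f' x" "AE x in lborel. g x = g' x" by auto
    then show "AE x in lborel. f x * cnj (g x) = f' x * cnj (g' x)"
      by eventually_elim simp
  qed measurable
  then show "Re (LINT x|lborel. f x * cnj (g x)) = Re (LINT x|lborel. f' x * cnj (g' x))"
    by simp
qed

definition norm_l2 :: "l2 \<Rightarrow> real" where "norm_l2 u = sqrt (inner u u)"

definition sgn_l2 :: "l2 \<Rightarrow> l2" where "sgn_l2 u = u /\<^sub>R norm u"

definition dist_l2 :: "l2 \<Rightarrow> l2 \<Rightarrow> real" where "dist_l2 u v = norm (u - v)"

definition uniformity_l2 :: "(l2 \<times> l2) filter" where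
  "uniformity_l2 = (INF e\<in>{0<..}. principal {(x, y). dist x y < e})"

definition open_l2 :: "l2 set \<Rightarrow> bool" where
  "open_l2 S = (\<forall>x\<in>S. \<forall>\<^sub>F (x', y) in uniformity. x' = x \<longrightarrow> y \<in> S)"

instance
proof
  fix u v w :: l2 and a :: real
  show "inner u v = inner v u"
  proof transfer
    fix f g :: "real \<Rightarrow> complex"
    have "(LINT x|lborel. f x * cnj (g x)) = (LINT x|lborel. cnj (g x * cnj (f x)))"
      by (intro Bochner_Integration.integral_cong) (auto simp: mult.commute)
    also have "\<dots> = cnj (LINT x|lborel. g x * cnj (f x))"
      by (rule Bochner_Integration.integral_cnj)
    finally show "Re (LINT x|lborel. f x * cnj (g x)) = Re (LINT x|lborel. g x * cnj (f x))"
      by simp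
  qed
  show "inner (u + v) w = inner u w + inner v w"
    by transfer (simp add: distrib_right L2_mult_integrable L2_cnj)
  show "inner (a *\<^sub>R u) v = a * inner u v"
    by transfer auto
  have square: "(LINT x|lborel. f x * cnj (f x)) =
      complex_of_real (LINT x|lborel. (cmod (f x))\<^sup>2)" for f :: "real \<Rightarrow> complex"
    by (simp only: complex_norm_square[symmetric] integral_complex_of_real)
  show "0 \<le> inner u u"
    by transfer (simp add: square)
  show "inner u u = 0 \<longleftrightarrow> u = 0"
    by transfer (simp add: square L2_zero integral_nonneg_eq_0_iff_AE L2_integrable_square)
qed (simp_all add: norm_l2_def dist_l2_def sgn_l2_def uniformity_l2_def open_l2_def)

end

lemma rep_l2_L2 [simp]: "rep_l2 U \<in> L2"
  using Quotient_rep_reflp[OF Quotient_l2, of U] by simp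

lemma rep_l2_measurable [measurable]: "rep_l2 U \<in> borel_measurable borel"
  by (simp add: L2_measurable)

lemma abs_rep_l2 [simp]: "abs_l2 (rep_l2 U) = U"
  by (rule Quotient_abs_rep[OF Quotient_l2])

lemma abs_l2_eq_iff:
  "f \<in> L2 \<Longrightarrow> g \<in> L2 \<Longrightarrow> abs_l2 f = abs_l2 g \<longleftrightarrow> (AE x in lborel. f x = g x)"
  using Quotient_rel[OF Quotient_l2, of f g] by auto

lemma rep_abs_l2: "f \<in> L2 \<Longrightarrow> AE x in lborel. rep_l2 (abs_l2 f) x = f x"
  by (subst abs_l2_eq_iff[symmetric]) auto

lemma abs_l2_zero: "abs_l2 (\<lambda>_. 0) = 0"
  by (simp add: zero_l2_def)

lemma abs_l2_add: "f \<in> L2 \<Longrightarrow> g \<in> L2 \<Longrightarrow> abs_l2 (\<lambda>x. f x + g x) = abs_l2 f + abs_l2 g"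
  by (rule plus_l2.abs_eq[symmetric]) auto

lemma abs_l2_diff: "f \<in> L2 \<Longrightarrow> g \<in> L2 \<Longrightarrow> abs_l2 (\<lambda>x. f x - g x) = abs_l2 f - abs_l2 g"
  by (rule minus_l2.abs_eq[symmetric]) auto

lemma abs_l2_scaleR: "f \<in> L2 \<Longrightarrow> abs_l2 (\<lambda>x. c *\<^sub>R f x) = c *\<^sub>R abs_l2 f"
  by (rule scaleR_l2.abs_eq[symmetric]) auto

lemma inner_abs_l2:
  "f \<in> L2 \<Longrightarrow> g \<in> L2 \<Longrightarrow> inner (abs_l2 f) (abs_l2 g) = Re (LINT x|lborel. f x * cnj (g x))"
  by (rule inner_l2.abs_eq) auto

lemma norm_abs_l2_square: 
  assumes "f \<in> L2" shows "(norm (abs_l2 f))\<^sup>2 = (LINT x|lborel. (cmod (f x))\<^sup>2)"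
proof -
  have "(LINT x|lborel. f x * cnj (f x)) = complex_of_real (LINT x|lborel. (cmod (f x))\<^sup>2)"
    by (simp only: complex_norm_square[symmetric] integral_complex_of_real)
  then show ?thesis
    by (simp add: power2_norm_eq_inner inner_abs_l2 assms)
qed

lemma norm_abs_l2: "f \<in> L2 \<Longrightarrow> norm (abs_l2 f) = sqrt (LINT x|lborel. (cmod (f x))\<^sup>2)"
  by (metis norm_abs_l2_square norm_ge_zero real_sqrt_unique)

lemma nn_integral_abs_l2:
  assumes "f \<in> L2"
  shows "(\<integral>\<^sup>+x. ennreal ((cmod (f x))\<^sup>2) \<partial>lborel) = ennreal ((norm (abs_l2 f))\<^sup>2)"
  using assms by (simp add: norm_abs_l2_square nn_integral_eq_integral L2_integrable_square)

lemma L2_I_nn_integral: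
  assumes "f \<in> borel_measurable borel"
    and "(\<integral>\<^sup>+x. ennreal ((cmod (f x))\<^sup>2) \<partial>lborel) \<le> ennreal (C\<^sup>2)" "C \<ge> 0"
  shows "f \<in> L2" "norm (abs_l2 f) \<le> C"
proof -
  show f: "f \<in> L2"
    using assms by (intro L2_I) (auto simp: integrable_iff_bounded intro: le_less_trans)
  have "ennreal ((norm (abs_l2 f))\<^sup>2) \<le> ennreal (C\<^sup>2)"
    using assms(2) nn_integral_abs_l2[OF f] by simp
  then show "norm (abs_l2 f) \<le> C"
    using assms(3) by (simp add: power2_le_iff_abs_le abs_le_square_iff[symmetric])
qed

lemma nn_integral_abs_l2_diff:
  assumes "f \<in> L2" "g \<in> L2"
  shows "(\<integral>\<^sup>+x. ennreal ((cmod (f x - g x))\<^sup>2) \<partial>lborel) = ennreal ((norm (abs_l2 f - abs_l2 g))\<^sup>2)"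
  using nn_integral_abs_l2[OF L2_diff[OF assms]] by (simp add: abs_l2_diff assms)

lemma convergent_of_fast_Cauchy:
  fixes f :: "nat \<Rightarrow> 'a::banach"
  assumes "eventually (\<lambda>n. norm (f (Suc n) - f n) \<le> (1/2)^n) sequentially"
  shows "convergent f"
proof -
  have "summable (\<lambda>n. f (Suc n) - f n)"
    by (rule summable_comparison_test_ev[OF assms]) (simp add: summable_geometric)
  then have "convergent (\<lambda>m. \<Sum>n<m. f (Suc n) - f n)"
    by (simp add: summable_iff_convergent)
  then have "convergent (\<lambda>m. f m - f 0)"
    by (simp add: sum_lessThan_telescope)
  then have "convergent (\<lambda>m. (f m - f 0) + f 0)"
    by (rule convergent_add) (rule convergent_const)
  then show ?thesis by simp
qed

text \<open>Riesz--Fischer. A subsequence whose consecutive differences decrease geometrically converges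
  almost everywhere, and Fatou's lemma turns the pointwise limit into a limit in norm.\<close>

instance l2 :: banach
proof
  fix X :: "nat \<Rightarrow> l2"
  assume "Cauchy X"
  have "\<exists>M. \<forall>m\<ge>M. \<forall>n\<ge>M. norm (X m - X n) < (1/4)^k" for k :: nat
    using \<open>Cauchy X\<close> by (simp add: Cauchy_iff)
  then obtain M where M: "\<And>k m n. m \<ge> M k \<Longrightarrow> n \<ge> M k \<Longrightarrow> norm (X m - X n) < (1/4)^k"
    by metis
  \<comment> \<open>The sum is a monotone majorant of \<open>M\<close>.\<close>
  define r where "r n = (\<Sum>k\<le>n. M k)" for n
  have r: "r n \<ge> M k" if "k \<le> n" for k n
    unfolding r_def by (rule member_le_sum) (use that in auto)
  define f where "f n = rep_l2 (X (r n))" for n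
  have f_L2: "f n \<in> L2" for n by (simp add: f_def)
  have [measurable]: "f n \<in> borel_measurable borel" for n by (simp add: f_def)
  have abs_f: "abs_l2 (f n) = X (r n)" for n by (simp add: f_def)
  \<comment> \<open>The norms of the differences are below \<open>(1/4)^n\<close>, so the factor \<open>4^n\<close> still leaves a
    convergent series of integrals; finiteness of the sum at a point then forces geometric decay.\<close>
  define d where "d n x = 4^n * (cmod (f (Suc n) x - f n x))\<^sup>2" for n x
  have [measurable]: "d n \<in> borel_measurable borel" for n unfolding d_def by measurable
  have d_bound: "(\<integral>\<^sup>+x. ennreal (d n x) \<partial>lborel) \<le> ennreal ((1/4)^n)" for n
  proof -
    have "(\<integral>\<^sup>+x. ennreal (d n x) \<partial>lborel)
        = (\<integral>\<^sup>+x. ennreal (4^n) * ennreal ((cmod (f (Suc n) x - f n x))\<^sup>2) \<partial>lborel)"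
      by (simp add: d_def ennreal_mult)
    also have "\<dots> = ennreal (4^n) * ennreal ((norm (X (r (Suc n)) - X (r n)))\<^sup>2)"
      by (subst nn_integral_cmult) (simp_all add: nn_integral_abs_l2_diff f_L2 abs_f)
    also have "\<dots> = ennreal (4^n * (norm (X (r (Suc n)) - X (r n)))\<^sup>2)"
      by (simp add: ennreal_mult)
    also have "\<dots> \<le> ennreal (4^n * ((1/4)^n)\<^sup>2)"
      using M[OF r[of n "Suc n"] r[of n n]]
      by (intro ennreal_leI mult_left_mono power_mono) simp_all
    also have "4^n * ((1/4)^n)\<^sup>2 = (1/4::real)^n"
      by (simp add: power2_eq_square power_divide)
    finally show ?thesis .
  qed
  have "(\<integral>\<^sup>+x. (\<Sum>n. ennreal (d n x)) \<partial>lborel) = (\<Sum>n. \<integral>\<^sup>+x. ennreal (d n x) \<partial>lborel)"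
    by (rule nn_integral_suminf) measurable
  also have "\<dots> \<le> (\<Sum>n. ennreal ((1/4)^n))"
    by (intro suminf_le d_bound) auto
  also have "\<dots> = ennreal (\<Sum>n. (1/4)^n)"
    by (rule suminf_ennreal2) (auto simp: summable_geometric)
  finally have "(\<integral>\<^sup>+x. (\<Sum>n. ennreal (d n x)) \<partial>lborel) \<noteq> \<infinity>"
    by (auto simp: top_unique)
  then have "AE x in lborel. (\<Sum>n. ennreal (d n x)) \<noteq> \<infinity>"
    by (intro nn_integral_PInf_AE) measurable
  then have conv: "AE x in lborel. convergent (\<lambda>n. f n x)"
  proof eventually_elim
    case (elim x)
    have "summable (\<lambda>n. d n x)"
      by (rule summable_suminf_not_top) (use elim in \<open>auto simp: d_def\<close>)
    then have "(\<lambda>n. d n x) \<longlonglongrightarrow> 0" by (rule summable_LIMSEQ_zero)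
    then have "eventually (\<lambda>n. d n x < 1) sequentially"
      by (rule order_tendstoD) simp
    then have "eventually (\<lambda>n. cmod (f (Suc n) x - f n x) \<le> (1/2)^n) sequentially"
    proof eventually_elim
      case (elim n)
      have "(2^n * cmod (f (Suc n) x - f n x))\<^sup>2 = d n x"
        by (simp add: d_def power_mult_distrib power2_eq_square flip: power_mult_distrib)
      with elim have "(2^n * cmod (f (Suc n) x - f n x))\<^sup>2 \<le> 1\<^sup>2" by simp
      then have "2^n * cmod (f (Suc n) x - f n x) \<le> 1"
        by (rule power2_le_imp_le) simp
      then show ?case by (simp add: field_simps)
    qed
    then show ?case by (rule convergent_of_fast_Cauchy)
  qed
  define g where "g x = lim (\<lambda>n. f n x)" for x
  have [measurable]: "g \<in> borel_measurable borel"
    unfolding g_def by (rule borel_measurable_lim_metric) measurable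
  have lim: "AE x in lborel. (\<lambda>n. f n x) \<longlonglongrightarrow> g x"
    using conv by eventually_elim (simp add: g_def convergent_LIMSEQ_iff)
  have close: "(\<lambda>x. rep_l2 (X m) x - g x) \<in> L2
      \<and> norm (abs_l2 (\<lambda>x. rep_l2 (X m) x - g x)) \<le> (1/4)^k" if "m \<ge> M k" for m k
  proof -
    have "(\<integral>\<^sup>+x. ennreal ((cmod (rep_l2 (X m) x - g x))\<^sup>2) \<partial>lborel)
        = (\<integral>\<^sup>+x. liminf (\<lambda>n. ennreal ((cmod (rep_l2 (X m) x - f n x))\<^sup>2)) \<partial>lborel)"
    proof (rule nn_integral_cong_AE, use lim in eventually_elim)
      case (elim x)
      then have "(\<lambda>n. ennreal ((cmod (rep_l2 (X m) x - f n x))\<^sup>2))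
          \<longlonglongrightarrow> ennreal ((cmod (rep_l2 (X m) x - g x))\<^sup>2)"
        by (intro tendsto_intros) auto
      then show ?case by (rule lim_imp_Liminf[symmetric, rotated]) simp
    qed
    also have "\<dots> \<le> liminf (\<lambda>n. \<integral>\<^sup>+x. ennreal ((cmod (rep_l2 (X m) x - f n x))\<^sup>2) \<partial>lborel)"
      by (rule nn_integral_liminf) measurable
    also have "\<dots> \<le> ennreal (((1/4)^k)\<^sup>2)"
    proof -
      have "eventually (\<lambda>n. (\<integral>\<^sup>+x. ennreal ((cmod (rep_l2 (X m) x - f n x))\<^sup>2) \<partial>lborel)
          \<le> ennreal (((1/4)^k)\<^sup>2)) sequentially"
        using eventually_ge_at_top[of k]
      proof eventually_elim
        case (elim n)
        then have "norm (X m - X (r n)) < (1/4)^k"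
          using M[of k m "r n"] r that by simp
        then have "ennreal ((norm (X m - X (r n)))\<^sup>2) \<le> ennreal (((1/4)^k)\<^sup>2)"
          by (intro ennreal_leI power_mono) auto
        then show ?case
          by (simp add: nn_integral_abs_l2_diff f_L2 abs_f)
      qed
      then have "liminf (\<lambda>n. \<integral>\<^sup>+x. ennreal ((cmod (rep_l2 (X m) x - f n x))\<^sup>2) \<partial>lborel)
          \<le> liminf (\<lambda>n. ennreal (((1/4)^k)\<^sup>2))"
        by (rule Liminf_mono)
      then show ?thesis by (simp add: Liminf_const)
    qed
    finally have "(\<integral>\<^sup>+x. ennreal ((cmod (rep_l2 (X m) x - g x))\<^sup>2) \<partial>lborel) \<le> ennreal (((1/4)^k)\<^sup>2)" .
    then show ?thesis
      by (intro conjI L2_I_nn_integral[where C="(1/4)^k"]) simp_all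
  qed
  have g: "g \<in> L2"
    using L2_diff[OF rep_l2_L2[of "X (M 0)"] conjunct1[OF close[of 0 "M 0"]]] by simp
  have "X \<longlonglongrightarrow> abs_l2 g"
  proof (rule metric_LIMSEQ_I)
    fix e :: real assume "e > 0"
    then obtain k where k: "(1/4)^k < e"
      using real_arch_pow_inv[of e "1/4"] by auto
    have "dist (X m) (abs_l2 g) < e" if "m \<ge> M k" for m
      using close[OF that] k g by (simp add: dist_norm abs_l2_diff)
    then show "\<exists>N. \<forall>m\<ge>N. dist (X m) (abs_l2 g) < e" by blast
  qed
  then show "convergent X" by (rule convergentI)
qed

text \<open>The symbols of the bounded Fourier multipliers that occur: truncations, weights, the linear group
  and the density of the energy.\<close>

definition bounded_symbol :: "(real \<Rightarrow> complex) \<Rightarrow> bool" where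
  "bounded_symbol m \<longleftrightarrow> m \<in> borel_measurable borel \<and> (\<exists>C. \<forall>x. cmod (m x) \<le> C)"

lemma bounded_symbolI:
  "m \<in> borel_measurable borel \<Longrightarrow> (\<And>x. cmod (m x) \<le> C) \<Longrightarrow> bounded_symbol m"
  by (auto simp: bounded_symbol_def)

lemma bounded_symbol_measurable [measurable_dest]:
  "bounded_symbol m \<Longrightarrow> m \<in> borel_measurable borel"
  by (simp add: bounded_symbol_def)

lemma bounded_symbol_L2:
  assumes "bounded_symbol m" "f \<in> L2"
  shows "(\<lambda>x. m x * f x) \<in> L2"
proof -
  obtain C where C: "\<And>x. cmod (m x) \<le> C" using assms(1) by (auto simp: bounded_symbol_def)
  note [measurable] = bounded_symbol_measurable[OF assms(1)] L2_measurable[OF assms(2)]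
  show ?thesis
  proof (rule L2_dominated)
    show "(\<lambda>x. complex_of_real C * f x) \<in> L2" by (rule L2_mult_const) fact
    show "cmod (m x * f x) \<le> cmod (complex_of_real C * f x)" for x
      using C[of x] by (auto simp: norm_mult intro!: mult_right_mono)
    show "(\<lambda>x. m x * f x) \<in> borel_measurable borel" by measurable
  qed
qed

definition mult_l2 :: "(real \<Rightarrow> complex) \<Rightarrow> l2 \<Rightarrow> l2" where
  "mult_l2 m U = abs_l2 (\<lambda>x. m x * rep_l2 U x)"

lemma mult_abs_l2:
  assumes "bounded_symbol m" "f \<in> L2"
  shows "mult_l2 m (abs_l2 f) = abs_l2 (\<lambda>x. m x * f x)"
proof -
  have "AE x in lborel. m x * rep_l2 (abs_l2 f) x = m x * f x"
    using rep_abs_l2[OF assms(2)] by eventually_elim simp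
  then show ?thesis
    by (simp add: mult_l2_def abs_l2_eq_iff bounded_symbol_L2 assms)
qed

lemma abs_l2_exists: obtains f where "f \<in> L2" "U = abs_l2 f"
  using that[of "rep_l2 U"] by simp

lemma mult_l2_add: "bounded_symbol m \<Longrightarrow> mult_l2 m (U + V) = mult_l2 m U + mult_l2 m V"
  by (rule abs_l2_exists[of U], rule abs_l2_exists[of V])
    (simp add: mult_abs_l2 bounded_symbol_L2 L2_add distrib_left flip: abs_l2_add)

lemma mult_l2_scaleR: "bounded_symbol m \<Longrightarrow> mult_l2 m (c *\<^sub>R U) = c *\<^sub>R mult_l2 m U"
  by (rule abs_l2_exists[of U])
    (simp add: mult_abs_l2 bounded_symbol_L2 L2_scaleR flip: abs_l2_scaleR)

lemma norm_mult_l2_le: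
  assumes "m \<in> borel_measurable borel" and C: "\<And>x. cmod (m x) \<le> C"
  shows "norm (mult_l2 m U) \<le> C * norm U"
proof -
  obtain f where f: "f \<in> L2" "U = abs_l2 f" by (rule abs_l2_exists)
  have m: "bounded_symbol m" using assms by (rule bounded_symbolI)
  have C0: "0 \<le> C" using C[of 0] norm_ge_zero order_trans by blast
  have "(norm (mult_l2 m U))\<^sup>2 = (LINT x|lborel. (cmod (m x * f x))\<^sup>2)"
    by (simp add: f mult_abs_l2 m bounded_symbol_L2 norm_abs_l2_square)
  also have "\<dots> \<le> (LINT x|lborel. C\<^sup>2 * (cmod (f x))\<^sup>2)"
  proof (rule integral_mono)
    show "(cmod (m x * f x))\<^sup>2 \<le> C\<^sup>2 * (cmod (f x))\<^sup>2" for x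
      using C[of x] by (simp add: norm_mult power_mult_distrib mult_right_mono power_mono)
  qed (simp_all add: L2_integrable_square bounded_symbol_L2 m f)
  also have "\<dots> = (C * norm U)\<^sup>2"
    by (simp add: f norm_abs_l2_square power_mult_distrib)
  finally show ?thesis
    by (rule power2_le_imp_le) (simp add: C0)
qed

lemma bounded_linear_mult_l2:
  assumes "bounded_symbol m" shows "bounded_linear (mult_l2 m)"
proof -
  obtain C where C: "\<And>x. cmod (m x) \<le> C" using assms by (auto simp: bounded_symbol_def)
  show ?thesis
    using norm_mult_l2_le[OF bounded_symbol_measurable[OF assms] C]
    by (intro bounded_linear_intro[where K=C] mult_l2_add mult_l2_scaleR assms)
      (simp_all add: mult.commute)
qed

lemma bounded_symbol_mult:
  assumes "bounded_symbol m" "bounded_symbol n" shows "bounded_symbol (\<lambda>x. m x * n x)"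
proof -
  note [measurable] = assms[THEN bounded_symbol_measurable]
  obtain C D where C: "\<And>x. cmod (m x) \<le> C" and D: "\<And>x. cmod (n x) \<le> D"
    using assms by (auto simp: bounded_symbol_def)
  have "cmod (m x * n x) \<le> C * D" for x
    using mult_mono[OF C[of x] D[of x]] order_trans[OF norm_ge_zero C[of x]] by (simp add: norm_mult)
  then show ?thesis by (intro bounded_symbolI[where C="C * D"]) simp_all
qed

lemma mult_mult_l2:
  "bounded_symbol m \<Longrightarrow> bounded_symbol n \<Longrightarrow> mult_l2 m (mult_l2 n U) = mult_l2 (\<lambda>x. m x * n x) U"
  by (rule abs_l2_exists[of U])
    (simp add: mult_abs_l2 bounded_symbol_L2 bounded_symbol_mult mult.assoc)

lemma mult_one_l2: "mult_l2 (\<lambda>_. 1) U = U"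
  by (simp add: mult_l2_def)

lemma inner_mult_l2:
  assumes "bounded_symbol m"
  shows "inner (mult_l2 m U) V = inner U (mult_l2 (\<lambda>x. cnj (m x)) V)"
proof -
  have "bounded_symbol (\<lambda>x. cnj (m x))"
    using assms by (auto simp: bounded_symbol_def)
  moreover obtain f g where "f \<in> L2" "g \<in> L2" "U = abs_l2 f" "V = abs_l2 g"
    by (metis abs_l2_exists)
  ultimately show ?thesis
    by (simp add: mult_abs_l2 bounded_symbol_L2 assms inner_abs_l2) (simp add: mult_ac)
qed

lemma norm_mult_l2_unimodular:
  assumes "m \<in> borel_measurable borel" "\<And>x. cmod (m x) = 1"
  shows "norm (mult_l2 m U) = norm U"
proof -
  have "bounded_symbol m" using assms by (intro bounded_symbolI[where C=1]) auto
  then show ?thesis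
    by (rule_tac abs_l2_exists[of U])
      (simp add: mult_abs_l2 bounded_symbol_L2 norm_abs_l2 norm_mult assms(2))
qed

text \<open>Dominated convergence. It is used for two things: truncated functions are dense, and the linear
  group is strongly continuous.\<close>

lemma mult_l2_tendsto:
  assumes "\<And>n. m n \<in> borel_measurable borel" "\<And>n x. cmod (m n x) \<le> C"
    and "l \<in> borel_measurable borel" "\<And>x. (\<lambda>n. m n x) \<longlonglongrightarrow> l x"
  shows "(\<lambda>n. mult_l2 (m n) U) \<longlonglongrightarrow> mult_l2 l U"
proof -
  note [measurable] = assms(1,3)
  obtain f where f: "f \<in> L2" "U = abs_l2 f" by (rule abs_l2_exists)
  note [measurable] = L2_measurable[OF f(1)]
  have l_le: "cmod (l x) \<le> C" for x
    by (rule tendsto_upperbound[OF tendsto_norm[OF assms(4)]]) (auto simp: assms(2))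
  have m: "bounded_symbol (m n)" "bounded_symbol l" for n
    using assms l_le by (auto intro!: bounded_symbolI)
  have C0: "C \<ge> 0" using l_le[of 0] norm_ge_zero order_trans by blast
  have "(\<lambda>n. LINT x|lborel. (cmod (m n x * f x - l x * f x))\<^sup>2) \<longlonglongrightarrow> (LINT x|(lborel::real measure). 0)"
  proof (rule integral_dominated_convergence[where w="\<lambda>x. (2 * C)\<^sup>2 * (cmod (f x))\<^sup>2"])
    show "AE x in lborel. (\<lambda>n. (cmod (m n x * f x - l x * f x))\<^sup>2) \<longlonglongrightarrow> 0"
    proof (rule AE_I2)
      fix x
      have "(\<lambda>n. (cmod (m n x * f x - l x * f x))\<^sup>2) \<longlonglongrightarrow> (cmod (l x * f x - l x * f x))\<^sup>2"
        by (intro tendsto_intros assms)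
      then show "(\<lambda>n. (cmod (m n x * f x - l x * f x))\<^sup>2) \<longlonglongrightarrow> 0" by simp
    qed
    show "AE x in lborel. norm ((cmod (m n x * f x - l x * f x))\<^sup>2) \<le> (2 * C)\<^sup>2 * (cmod (f x))\<^sup>2" for n
    proof (rule AE_I2)
      fix x
      have "cmod (m n x - l x) \<le> 2 * C"
        using norm_triangle_ineq4[of "m n x" "l x"] assms(2)[of n x] l_le[of x] by linarith
      then have "(cmod (m n x - l x) * cmod (f x))\<^sup>2 \<le> (2 * C * cmod (f x))\<^sup>2"
        using C0 by (intro power_mono mult_right_mono) auto
      then show "norm ((cmod (m n x * f x - l x * f x))\<^sup>2) \<le> (2 * C)\<^sup>2 * (cmod (f x))\<^sup>2"
        by (simp add: norm_mult power_mult_distrib flip: left_diff_distrib)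
    qed
    show "integrable lborel (\<lambda>x. (2 * C)\<^sup>2 * (cmod (f x))\<^sup>2)"
      by (simp add: L2_integrable_square f)
  qed measurable
  then have "(\<lambda>n. (norm (mult_l2 (m n) U - mult_l2 l U))\<^sup>2) \<longlonglongrightarrow> 0"
    by (simp add: f mult_abs_l2 m bounded_symbol_L2 norm_abs_l2_square L2_diff flip: abs_l2_diff)
  then have "(\<lambda>n. sqrt ((norm (mult_l2 (m n) U - mult_l2 l U))\<^sup>2)) \<longlonglongrightarrow> sqrt 0"
    by (rule tendsto_real_sqrt)
  then show ?thesis
    by (simp add: tendsto_norm_zero_iff LIM_zero_iff)
qed

definition cnj_l2 :: "l2 \<Rightarrow> l2" where
  "cnj_l2 U = abs_l2 (\<lambda>x. cnj (rep_l2 U x))"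

lemma cnj_abs_l2:
  assumes "f \<in> L2" shows "cnj_l2 (abs_l2 f) = abs_l2 (\<lambda>x. cnj (f x))"
proof -
  have "AE x in lborel. cnj (rep_l2 (abs_l2 f) x) = cnj (f x)"
    using rep_abs_l2[OF assms] by eventually_elim simp
  then show ?thesis by (simp add: cnj_l2_def abs_l2_eq_iff L2_cnj assms)
qed

lemma cnj_cnj_l2 [simp]: "cnj_l2 (cnj_l2 U) = U"
  by (rule abs_l2_exists[of U]) (simp add: cnj_abs_l2 L2_cnj)

lemma cnj_l2_add: "cnj_l2 (U + V) = cnj_l2 U + cnj_l2 V"
  by (rule abs_l2_exists[of U], rule abs_l2_exists[of V])
    (simp add: cnj_abs_l2 L2_cnj L2_add flip: abs_l2_add)

lemma cnj_l2_scaleR: "cnj_l2 (c *\<^sub>R U) = c *\<^sub>R cnj_l2 U"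
  by (rule abs_l2_exists[of U]) (simp add: cnj_abs_l2 L2_cnj L2_scaleR flip: abs_l2_scaleR)

lemma norm_cnj_l2 [simp]: "norm (cnj_l2 U) = norm U"
  by (rule abs_l2_exists[of U]) (simp add: cnj_abs_l2 L2_cnj norm_abs_l2)

lemma bounded_linear_cnj_l2: "bounded_linear cnj_l2"
  by (intro bounded_linear_intro[where K=1] cnj_l2_add cnj_l2_scaleR) simp


section \<open>The Fourier integral\<close>

text \<open>The character of the real line that is the kernel of the transform. The arguments below use its
  modulus, its conjugate and its multiplicativity.\<close>

definition wave :: "real \<Rightarrow> complex" where
  "wave t = exp (- (\<i> * complex_of_real t))"

lemma norm_wave [simp]: "cmod (wave t) = 1"
  using norm_exp_i_times[of "- t"] by (simp add: wave_def)

lemma cnj_wave [simp]: "cnj (wave t) = wave (- t)"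
  by (simp add: wave_def exp_cnj)

lemma wave_0 [simp]: "wave 0 = 1"
  by (simp add: wave_def)

lemma wave_add: "wave (s + t) = wave s * wave t"
  by (simp add: wave_def distrib_left exp_add exp_diff exp_minus divide_inverse mult.commute)

lemma borel_measurable_wave [measurable]: "wave \<in> borel_measurable borel"
  unfolding wave_def by measurable

definition fourier_integral :: "(real \<Rightarrow> complex) \<Rightarrow> real \<Rightarrow> complex" where
  "fourier_integral f \<xi> = complex_of_real (1 / sqrt (2 * pi)) *
     (LINT x|lborel. f x * wave (\<xi> * x))"

lemma integrable_mult_kernel:
  assumes "integrable lborel f" "u \<in> borel_measurable borel" "\<And>x. cmod (u x) \<le> C"
  shows "integrable lborel (\<lambda>x. f x * u x :: complex)"
proof (rule Bochner_Integration.integrable_bound)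
  note [measurable] = borel_measurable_integrable[OF assms(1)] assms(2)
  show "integrable lborel (\<lambda>x. C * cmod (f x))" using assms(1) by simp
  show "(\<lambda>x. f x * u x) \<in> borel_measurable lborel" by measurable
  show "AE x in lborel. norm (f x * u x) \<le> norm (C * cmod (f x))"
  proof (rule AE_I2)
    fix x
    have "cmod (f x) * cmod (u x) \<le> cmod (f x) * C" by (intro mult_left_mono assms) auto
    moreover have "0 \<le> C" using assms(3)[of x] norm_ge_zero order_trans by blast
    ultimately show "norm (f x * u x) \<le> norm (C * cmod (f x))"
      by (simp add: norm_mult mult.commute abs_mult)
  qed
qed

lemma integrable_mult_exp:
  "integrable lborel f \<Longrightarrow> integrable lborel (\<lambda>x. f x * wave (\<xi> * x))"
  by (rule integrable_mult_kernel[where C=1]) auto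

lemma integrable_product_kernel:
  assumes "integrable lborel f" "integrable lborel g"
    and "(\<lambda>(x, y). u x y) \<in> borel_measurable (lborel \<Otimes>\<^sub>M lborel)" "\<And>x y. cmod (u x y) \<le> 1"
  shows "integrable (lborel \<Otimes>\<^sub>M lborel) (\<lambda>(x::real, y::real). f x * g y * u x y :: complex)"
proof -
  note [measurable] = borel_measurable_integrable[OF assms(1)]
    borel_measurable_integrable[OF assms(2)] assms(3)
  have main: "integrable (lborel \<Otimes>\<^sub>M lborel) (\<lambda>(x, y). f x * g y)"
  proof (rule lborel_pair.Fubini_integrable)
    show "(\<lambda>(x, y). f x * g y) \<in> borel_measurable (lborel \<Otimes>\<^sub>M lborel)" by measurable
    show "integrable lborel (\<lambda>x. LINT y|lborel. norm (case (x, y) of (x, y) \<Rightarrow> f x * g y))"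
      using assms(1) by (simp add: norm_mult)
    show "AE x in lborel. integrable lborel (\<lambda>y. case (x, y) of (x, y) \<Rightarrow> f x * g y)"
      using assms(2) by simp
  qed
  show ?thesis
  proof (rule Bochner_Integration.integrable_bound[OF main])
    show "(\<lambda>(x, y). f x * g y * u x y) \<in> borel_measurable (lborel \<Otimes>\<^sub>M lborel)" by measurable
    have "cmod (f x * g y * u x y) \<le> cmod (f x * g y)" for x y
      using mult_left_mono[OF assms(4)[of x y], of "cmod (f x * g y)"] by (simp add: norm_mult)
    then show "AE p in lborel \<Otimes>\<^sub>M lborel. norm (case p of (x, y) \<Rightarrow> f x * g y * u x y)
        \<le> norm (case p of (x, y) \<Rightarrow> f x * g y)"
      by (simp add: split_beta)
  qed
qed

lemma borel_measurable_fourier_integral [measurable]: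
  assumes [measurable]: "f \<in> borel_measurable borel"
  shows "fourier_integral f \<in> borel_measurable borel"
  unfolding fourier_integral_def by measurable

lemma fourier_integral_le:
  assumes "integrable lborel f"
  shows "cmod (fourier_integral f \<xi>) \<le> (LINT x|lborel. cmod (f x)) / sqrt (2 * pi)"
proof -
  have "cmod (LINT x|lborel. f x * wave (\<xi> * x))
      \<le> (LINT x|lborel. cmod (f x * wave (\<xi> * x)))"
    by (rule integral_norm_bound)
  then show ?thesis
    by (simp add: fourier_integral_def norm_mult norm_divide divide_right_mono)
qed

lemma fourier_integral_add:
  "integrable lborel f \<Longrightarrow> integrable lborel g \<Longrightarrow>
    fourier_integral (\<lambda>x. f x + g x) = (\<lambda>\<xi>. fourier_integral f \<xi> + fourier_integral g \<xi>)"
  by (rule ext)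
    (simp add: fourier_integral_def distrib_right distrib_left integrable_mult_exp del: of_real_divide)

lemma fourier_integral_cmult:
  "fourier_integral (\<lambda>x. c * f x) = (\<lambda>\<xi>. c * fourier_integral f \<xi>)"
  by (rule ext) (simp add: fourier_integral_def mult.assoc)

lemma fourier_integral_diff:
  assumes "integrable lborel f" "integrable lborel g"
  shows "fourier_integral (\<lambda>x. f x - g x) = (\<lambda>\<xi>. fourier_integral f \<xi> - fourier_integral g \<xi>)"
  using fourier_integral_add[of f "\<lambda>x. (-1) * g x"] fourier_integral_cmult[of "-1" g] assms
  by simp

lemma fourier_integral_cnj:
  "cnj (fourier_integral f \<xi>) = fourier_integral (\<lambda>x. cnj (f x)) (- \<xi>)"
  by (simp add: fourier_integral_def flip: Bochner_Integration.integral_cnj)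

text \<open>Fubini's theorem. The formula moves the transform from one factor to the other; the boundedness of
  the transform in the square norm and the form of its adjoint both come from it.\<close>

lemma fourier_integral_multiplication_formula:
  assumes "integrable lborel f" "integrable lborel g"
  shows "(LINT \<xi>|lborel. fourier_integral f \<xi> * g \<xi>) = (LINT x|lborel. f x * fourier_integral g x)"
proof -
  let ?c = "complex_of_real (1 / sqrt (2 * pi))"
  have "integrable (lborel \<Otimes>\<^sub>M lborel)
      (\<lambda>(\<xi>, x). g \<xi> * f x * wave (\<xi> * x))"
    by (rule integrable_product_kernel) (use assms in auto)
  then have "(LINT x|lborel. LINT \<xi>|lborel. g \<xi> * f x * wave (\<xi> * x))
      = (LINT \<xi>|lborel. LINT x|lborel. g \<xi> * f x * wave (\<xi> * x))"
    by (rule lborel_pair.Fubini_integral)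
  moreover have "(LINT x|lborel. LINT \<xi>|lborel. g \<xi> * f x * wave (\<xi> * x))
      = (LINT x|lborel. f x * (LINT \<xi>|lborel. g \<xi> * wave (x * \<xi>)))"
    by (simp add: mult_ac flip: integral_mult_right_zero)
  moreover have "(LINT \<xi>|lborel. LINT x|lborel. g \<xi> * f x * wave (\<xi> * x))
      = (LINT \<xi>|lborel. g \<xi> * (LINT x|lborel. f x * wave (\<xi> * x)))"
    by (simp add: mult.assoc)
  ultimately have "?c * (LINT x|lborel. f x * (LINT \<xi>|lborel. g \<xi> * wave (x * \<xi>)))
      = ?c * (LINT \<xi>|lborel. g \<xi> * (LINT x|lborel. f x * wave (\<xi> * x)))"
    by simp
  moreover have "fourier_integral f \<xi> * g \<xi> = ?c * (g \<xi> * (LINT x|lborel. f x * wave (\<xi> * x)))"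
    "f x * fourier_integral g x = ?c * (f x * (LINT \<xi>|lborel. g \<xi> * wave (x * \<xi>)))" for \<xi> x
    by (simp_all add: fourier_integral_def)
  ultimately show ?thesis
    by (simp only: integral_mult_right_zero)
qed

section \<open>Gaussians\<close>

lemma integrable_gaussian: "integrable lborel (\<lambda>x. complex_of_real (exp (- x\<^sup>2 / 2)))"
proof -
  have "integrable lborel (\<lambda>x. sqrt (2 * pi) * std_normal_density x)"
    by (intro integrable_mult_right) (simp add: integrable_normal_density)
  then have "integrable lborel (\<lambda>x. exp (- x\<^sup>2 / 2) :: real)"
    by (simp add: std_normal_density_def)
  then show ?thesis by simp
qed

text \<open>The transform of the Gaussian is the characteristic function of the normal distribution.\<close>

lemma fourier_integral_gaussian:
  "fourier_integral (\<lambda>x. complex_of_real (exp (- x\<^sup>2 / 2))) \<xi> = complex_of_real (exp (- \<xi>\<^sup>2 / 2))"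
proof -
  have "char std_normal_distribution (- \<xi>)
      = (CLINT x|lborel. std_normal_density x *\<^sub>R iexp (- \<xi> * x))"
    unfolding char_def by (rule integral_density) (auto simp: normal_density_nonneg)
  also have "\<dots> = fourier_integral (\<lambda>x. complex_of_real (exp (- x\<^sup>2 / 2))) \<xi>"
    unfolding fourier_integral_def integral_mult_right_zero[symmetric]
    by (intro Bochner_Integration.integral_cong)
      (simp_all add: std_normal_density_def scaleR_conv_of_real wave_def)
  finally show ?thesis by (simp add: char_std_normal_distribution)
qed

lemma fourier_integral_modulated:
  "fourier_integral (\<lambda>x. f x * wave (a * x)) \<xi> = fourier_integral f (\<xi> + a)"
  by (simp add: fourier_integral_def mult.assoc flip: wave_add) (simp add: algebra_simps)

lemma fourier_integral_dilated:
  assumes "c > 0"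
  shows "fourier_integral (\<lambda>x. f (x / c)) \<xi> = complex_of_real c * fourier_integral f (c * \<xi>)"
  unfolding fourier_integral_def
  by (subst lborel_integral_real_affine[where c=c and t=0])
    (use assms in \<open>simp_all add: scaleR_conv_of_real mult_ac\<close>)

lemma fourier_integral_translated:
  "fourier_integral (\<lambda>x. f (x - a)) \<xi> = wave (\<xi> * a) * fourier_integral f \<xi>"
  unfolding fourier_integral_def
  by (subst lborel_integral_real_affine[where c=1 and t=a])
    (simp_all add: distrib_left wave_add mult_ac flip: integral_mult_right_zero)

lemma L2_gaussian: "(\<lambda>x. complex_of_real (exp (- x\<^sup>2 / 2))) \<in> L2"
proof (rule L2_I)
  show "integrable lborel (\<lambda>x. (cmod (complex_of_real (exp (- x\<^sup>2 / 2))))\<^sup>2)"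
  proof (rule Bochner_Integration.integrable_bound[OF integrable_gaussian])
    show "AE x in lborel. norm ((cmod (complex_of_real (exp (- x\<^sup>2 / 2))))\<^sup>2)
        \<le> norm (complex_of_real (exp (- x\<^sup>2 / 2)))"
      by (simp add: power2_eq_square mult_left_le)
  qed measurable
qed measurable

section \<open>Injectivity of the Fourier integral\<close>

text \<open>At frequency zero the hypothesis says that the positive and the negative part have the same
  integral. Normalised by it, they are probability densities with the same characteristic function,
  and Levy's uniqueness theorem applies.\<close>

lemma real_fourier_integral_injective:
  fixes h :: "real \<Rightarrow> real"
  assumes h: "integrable lborel h"
    and zero: "\<And>\<xi>. (LINT x|lborel. complex_of_real (h x) * wave (\<xi> * x)) = 0"
  shows "AE x in lborel. h x = 0"
proof -
  note [measurable] = borel_measurable_integrable[OF h]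
  define p where "p x = max (h x) 0" for x
  define q where "q x = max (- h x) 0" for x
  have p: "integrable lborel p" and q: "integrable lborel q"
    using h by (simp_all add: p_def[abs_def] q_def[abs_def])
  note [measurable] = borel_measurable_integrable[OF p] borel_measurable_integrable[OF q]
  have nonneg: "p x \<ge> 0" "q x \<ge> 0" and h_eq: "h x = p x - q x" for x
    by (auto simp: p_def q_def max_def)
  have int_kernel: "integrable lborel (\<lambda>x. complex_of_real (k x) * wave (\<xi> * x))"
    if "integrable lborel k" for k :: "real \<Rightarrow> real" and \<xi>
    by (rule integrable_mult_kernel[where C=1]) (use that in auto)
  have eq: "(LINT x|lborel. complex_of_real (p x) * wave (\<xi> * x))
      = (LINT x|lborel. complex_of_real (q x) * wave (\<xi> * x))" for \<xi>
    using zero[of \<xi>] int_kernel[OF p, of \<xi>] int_kernel[OF q, of \<xi>]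
    by (simp add: h_eq left_diff_distrib)
  define c where "c = (LINT x|lborel. p x)"
  have c_q: "c = (LINT x|lborel. q x)"
    using eq[of 0] by (simp add: c_def)
  show ?thesis
  proof (cases "c = 0")
    case True
    have "AE x in lborel. p x = 0"
      using True p nonneg by (simp add: c_def integral_nonneg_eq_0_iff_AE)
    moreover have "AE x in lborel. q x = 0"
      using True q nonneg by (simp add: c_q integral_nonneg_eq_0_iff_AE)
    ultimately show ?thesis by eventually_elim (simp add: h_eq)
  next
    case False
    then have c: "c > 0" using nonneg by (simp add: c_def less_le integral_nonneg)
    have dist: "real_distribution (density lborel (\<lambda>x. k x / c))"
      and char_eq: "char (density lborel (\<lambda>x. k x / c)) (- \<xi>)
        = (LINT x|lborel. complex_of_real (k x) * wave (\<xi> * x)) / complex_of_real c"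
      if k: "integrable lborel k" "\<And>x. k x \<ge> 0" "(LINT x|lborel. k x) = c" for k \<xi>
    proof -
      note [measurable] = borel_measurable_integrable[OF k(1)]
      have "emeasure (density lborel (\<lambda>x. k x / c)) (space (density lborel (\<lambda>x. k x / c)))
          = (\<integral>\<^sup>+x. ennreal (k x / c) \<partial>lborel)"
        by (simp add: emeasure_density)
      also have "\<dots> = ennreal (LINT x|lborel. k x / c)"
        by (rule nn_integral_eq_integral) (use k c in auto)
      also have "\<dots> = 1" using k c by simp
      finally have "prob_space (density lborel (\<lambda>x. k x / c))" by (rule prob_spaceI)
      then show "real_distribution (density lborel (\<lambda>x. k x / c))"
        by (simp add: real_distribution_def real_distribution_axioms_def)
      have "char (density lborel (\<lambda>x. k x / c)) (- \<xi>) = (LINT x|lborel. (k x / c) *\<^sub>R iexp (- \<xi> * x))"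
        unfolding char_def by (rule integral_density) (use k c in auto)
      also have "\<dots> = (LINT x|lborel. (k x / c) *\<^sub>R wave (\<xi> * x))"
        by (simp add: wave_def)
      also have "\<dots> = (LINT x|lborel. complex_of_real (k x) * wave (\<xi> * x)) / complex_of_real c"
        by (simp add: scaleR_conv_of_real flip: integral_divide_zero)
      finally show "char (density lborel (\<lambda>x. k x / c)) (- \<xi>)
        = (LINT x|lborel. complex_of_real (k x) * wave (\<xi> * x)) / complex_of_real c" .
    qed
    have "char (density lborel (\<lambda>x. p x / c)) = char (density lborel (\<lambda>x. q x / c))"
    proof
      fix \<xi>
      show "char (density lborel (\<lambda>x. p x / c)) \<xi> = char (density lborel (\<lambda>x. q x / c)) \<xi>"
        using char_eq[OF p nonneg(1) c_def[symmetric], of "- \<xi>"]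
          char_eq[OF q nonneg(2) c_q[symmetric], of "- \<xi>"] eq[of "- \<xi>"] by simp
    qed
    then have "density lborel (\<lambda>x. p x / c) = density lborel (\<lambda>x. q x / c)"
      by (rule Levy_uniqueness[OF dist[OF p nonneg(1) c_def[symmetric]]
            dist[OF q nonneg(2) c_q[symmetric]]])
    then have "AE x in lborel. ennreal (p x / c) = ennreal (q x / c)"
      by (subst (asm) sigma_finite_measure.density_unique_iff[OF sigma_finite_lborel]) auto
    then show ?thesis
      by eventually_elim (use c nonneg in \<open>simp add: h_eq\<close>)
  qed
qed

lemma fourier_integral_injective:
  assumes f: "integrable lborel f" and zero: "\<And>\<xi>. fourier_integral f \<xi> = 0"
  shows "AE x in lborel. f x = 0"
proof -
  have zero1: "(LINT x|lborel. f x * wave (\<xi> * x)) = 0" for \<xi>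
    using zero[of \<xi>] by (simp add: fourier_integral_def)
  have zero2: "(LINT x|lborel. cnj (f x) * wave (\<xi> * x)) = 0" for \<xi>
  proof -
    have "(LINT x|lborel. cnj (f x) * wave (\<xi> * x)) = cnj (LINT x|lborel. f x * wave (- \<xi> * x))"
      by (simp flip: Bochner_Integration.integral_cnj)
    then show ?thesis by (simp only: zero1 complex_cnj_zero)
  qed
  have int1: "integrable lborel (\<lambda>x. f x * wave (\<xi> * x))" for \<xi>
    by (rule integrable_mult_kernel[where C=1]) (use f in auto)
  have int2: "integrable lborel (\<lambda>x. cnj (f x) * wave (\<xi> * x))" for \<xi>
    by (rule integrable_mult_kernel[where C=1]) (use f in auto)
  have "AE x in lborel. Re (f x) = 0"
  proof (rule real_fourier_integral_injective)
    have "(LINT x|lborel. complex_of_real (Re (f x)) * wave (\<xi> * x))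
        = (LINT x|lborel. (1/2) * (f x * wave (\<xi> * x) + cnj (f x) * wave (\<xi> * x)))" for \<xi>
      by (intro Bochner_Integration.integral_cong) (auto simp: complex_eq_iff field_simps)
    then show "(LINT x|lborel. complex_of_real (Re (f x)) * wave (\<xi> * x)) = 0" for \<xi>
      by (simp only: integral_mult_right_zero Bochner_Integration.integral_add
          Bochner_Integration.integral_diff int1 int2 zero1 zero2) simp
  qed (use f in simp)
  moreover have "AE x in lborel. Im (f x) = 0"
  proof (rule real_fourier_integral_injective)
    have "(LINT x|lborel. complex_of_real (Im (f x)) * wave (\<xi> * x))
        = (LINT x|lborel. (- \<i> / 2) * (f x * wave (\<xi> * x) - cnj (f x) * wave (\<xi> * x)))" for \<xi>
      by (intro Bochner_Integration.integral_cong) (auto simp: complex_eq_iff field_simps)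
    then show "(LINT x|lborel. complex_of_real (Im (f x)) * wave (\<xi> * x)) = 0" for \<xi>
      by (simp only: integral_mult_right_zero Bochner_Integration.integral_add
          Bochner_Integration.integral_diff int1 int2 zero1 zero2) simp
  qed (use f in simp)
  ultimately show ?thesis by eventually_elim (simp add: complex_eq_iff)
qed

section \<open>The Fourier transform as a unitary operator\<close>

text \<open>By \<open>2ab \<le> a\<^sup>2 + b\<^sup>2\<close> each half of the form integrates the kernel in one variable only, where it
  has total mass one.\<close>

lemma nn_integral_probability_kernel_form:
  fixes u k :: "real \<Rightarrow> real"
  assumes [measurable]: "u \<in> borel_measurable borel" "k \<in> borel_measurable borel"
    and nonneg: "\<And>x. k x \<ge> 0" and k: "(\<integral>\<^sup>+z. ennreal (k z) \<partial>lborel) = 1"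
  shows "(\<integral>\<^sup>+x. \<integral>\<^sup>+y. ennreal (u x * u y * k (y - x)) \<partial>lborel \<partial>lborel)
    \<le> (\<integral>\<^sup>+x. ennreal ((u x)\<^sup>2) \<partial>lborel)"
proof -
  have kx: "(\<integral>\<^sup>+y. ennreal (k (y - x)) \<partial>lborel) = 1" for x
    using nn_integral_real_affine[of "\<lambda>z. ennreal (k z)" 1 "- x"] k by (simp add: add.commute)
  have ky: "(\<integral>\<^sup>+x. ennreal (k (y - x)) \<partial>lborel) = 1" for y
    using nn_integral_real_affine[of "\<lambda>z. ennreal (k z)" "-1" y] k by simp
  have "ennreal (u x * u y * k (y - x))
      \<le> ennreal ((u x)\<^sup>2 / 2) * ennreal (k (y - x)) + ennreal ((u y)\<^sup>2 / 2) * ennreal (k (y - x))" for x y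
  proof -
    have "u x * u y \<le> (u x)\<^sup>2 / 2 + (u y)\<^sup>2 / 2"
      using sum_squares_bound[of "u x" "u y"] by simp
    then have "u x * u y * k (y - x) \<le> ((u x)\<^sup>2 / 2 + (u y)\<^sup>2 / 2) * k (y - x)"
      by (intro mult_right_mono nonneg)
    then have "ennreal (u x * u y * k (y - x)) \<le> ennreal ((u x)\<^sup>2 / 2 * k (y - x) + (u y)\<^sup>2 / 2 * k (y - x))"
      by (intro ennreal_leI) (simp add: distrib_right)
    also have "\<dots> = ennreal ((u x)\<^sup>2 / 2) * ennreal (k (y - x)) + ennreal ((u y)\<^sup>2 / 2) * ennreal (k (y - x))"
      using nonneg by (simp add: ennreal_plus flip: ennreal_mult)
    finally show ?thesis .
  qed
  then have "(\<integral>\<^sup>+x. \<integral>\<^sup>+y. ennreal (u x * u y * k (y - x)) \<partial>lborel \<partial>lborel)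
      \<le> (\<integral>\<^sup>+x. \<integral>\<^sup>+y. ennreal ((u x)\<^sup>2 / 2) * ennreal (k (y - x))
          + ennreal ((u y)\<^sup>2 / 2) * ennreal (k (y - x)) \<partial>lborel \<partial>lborel)"
    by (intro nn_integral_mono)
  also have "\<dots> = (\<integral>\<^sup>+x. \<integral>\<^sup>+y. ennreal ((u x)\<^sup>2 / 2) * ennreal (k (y - x)) \<partial>lborel \<partial>lborel)
      + (\<integral>\<^sup>+x. \<integral>\<^sup>+y. ennreal ((u y)\<^sup>2 / 2) * ennreal (k (y - x)) \<partial>lborel \<partial>lborel)"
    by (simp add: nn_integral_add)
  also have "(\<integral>\<^sup>+x. \<integral>\<^sup>+y. ennreal ((u y)\<^sup>2 / 2) * ennreal (k (y - x)) \<partial>lborel \<partial>lborel)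
      = (\<integral>\<^sup>+y. \<integral>\<^sup>+x. ennreal ((u y)\<^sup>2 / 2) * ennreal (k (y - x)) \<partial>lborel \<partial>lborel)"
    by (rule lborel_pair.Fubini') measurable
  also have "(\<integral>\<^sup>+x. \<integral>\<^sup>+y. ennreal ((u x)\<^sup>2 / 2) * ennreal (k (y - x)) \<partial>lborel \<partial>lborel)
      = (\<integral>\<^sup>+x. ennreal ((u x)\<^sup>2 / 2) \<partial>lborel)"
    by (simp add: nn_integral_cmult kx)
  also have "(\<integral>\<^sup>+y. \<integral>\<^sup>+x. ennreal ((u y)\<^sup>2 / 2) * ennreal (k (y - x)) \<partial>lborel \<partial>lborel)
      = (\<integral>\<^sup>+y. ennreal ((u y)\<^sup>2 / 2) \<partial>lborel)"
    by (simp add: nn_integral_cmult ky)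
  also have "(\<integral>\<^sup>+x. ennreal ((u x)\<^sup>2 / 2) \<partial>lborel) + (\<integral>\<^sup>+y. ennreal ((u y)\<^sup>2 / 2) \<partial>lborel)
      = (\<integral>\<^sup>+x. ennreal ((u x)\<^sup>2) \<partial>lborel)"
    by (subst nn_integral_add[symmetric]) (simp_all flip: ennreal_plus)
  finally show ?thesis .
qed

lemma ennreal_norm_integral_le:
  "ennreal (cmod (LINT x|M. f x)) \<le> (\<integral>\<^sup>+x. ennreal (cmod (f x)) \<partial>M)"
  by (cases "integrable M f") (simp_all add: integral_norm_bound_ennreal not_integrable_integral_eq)

text \<open>Half of Plancherel's theorem. The integral of the squared transform is damped by a wide Gaussian.
  Two applications of the multiplication formula turn the damped integral into the quadratic form of
  \<open>f\<close> with a Gaussian probability kernel, which is at most the square norm of \<open>f\<close>. Fatou's lemma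
  removes the damping. The inequality suffices to extend the transform continuously; that it is an
  equality is contained in the inversion formula below.\<close>

lemma fourier_integral_L2:
  assumes f: "f \<in> L2" "integrable lborel f"
  shows "fourier_integral f \<in> L2" and "norm (abs_l2 (fourier_integral f)) \<le> norm (abs_l2 f)"
proof -
  note [measurable] = L2_measurable[OF f(1)]
  obtain B where B: "\<And>\<xi>. cmod (fourier_integral f \<xi>) \<le> B"
    using fourier_integral_le[OF f(2)] by blast
  \<comment> \<open>\<open>h n\<close> damps the frequencies; \<open>k n\<close> is its transform, normalised to total mass one.\<close>
  define h where "h n \<xi> = exp (- (\<xi> / real (Suc n))\<^sup>2 / 2)" for n \<xi>
  have [measurable]: "h n \<in> borel_measurable borel" for n unfolding h_def by measurable
  have h_nonneg: "h n \<xi> \<ge> 0" for n \<xi> by (simp add: h_def)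
  have h_int: "integrable lborel (\<lambda>\<xi>. complex_of_real (h n \<xi>))" for n
    using lborel_integrable_real_affine[OF integrable_gaussian, of "1 / real (Suc n)" 0]
    by (simp add: h_def)
  define k where "k n z = real (Suc n) / sqrt (2 * pi) * exp (- (real (Suc n) * z)\<^sup>2 / 2)" for n z
  have [measurable]: "k n \<in> borel_measurable borel" for n unfolding k_def by measurable
  have k_nonneg: "k n z \<ge> 0" for n z by (simp add: k_def)
  have k_density: "k n = normal_density 0 (1 / real (Suc n))" for n
  proof
    fix z
    define m where "m = real (Suc n)"
    have m: "m > 0" by (simp add: m_def)
    then have "sqrt (2 * pi * (1 / m)\<^sup>2) = sqrt (2 * pi) / m"
      by (simp add: real_sqrt_mult power_divide real_sqrt_divide)
    then show "k n z = normal_density 0 (1 / real (Suc n)) z"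
      unfolding k_def normal_density_def m_def[symmetric] using m
      by (simp add: power_mult_distrib power_divide mult.commute)
  qed
  have k_int: "(\<integral>\<^sup>+z. ennreal (k n z) \<partial>lborel) = 1" for n
    by (subst nn_integral_eq_integral) (simp_all add: k_density normal_density_nonneg)
  have main: "(\<integral>\<^sup>+\<xi>. ennreal (h n \<xi> * (cmod (fourier_integral f \<xi>))\<^sup>2) \<partial>lborel)
      \<le> ennreal ((norm (abs_l2 f))\<^sup>2)" for n
  proof -
    let ?G = "\<lambda>\<xi>. complex_of_real (h n \<xi>) * cnj (fourier_integral f \<xi>)"
    let ?c = "complex_of_real (1 / sqrt (2 * pi))"
    have G: "integrable lborel ?G"
      by (rule integrable_mult_kernel[OF h_int, where C=B]) (auto simp: B)
    have hw: "integrable lborel (\<lambda>\<xi>. complex_of_real (h n \<xi>) * wave (a * \<xi>))" for a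
      by (rule integrable_mult_kernel[OF h_int, where C=1]) auto
    have FG: "fourier_integral ?G x = (LINT y|lborel. cnj (f y) * complex_of_real (k n (y - x)))" for x
    proof -
      have "(LINT \<xi>|lborel. ?G \<xi> * wave (x * \<xi>))
          = (LINT \<xi>|lborel. ?G (- \<xi>) * wave (x * - \<xi>))"
        using lborel_integral_real_affine[of "-1" "\<lambda>\<xi>. ?G \<xi> * wave (x * \<xi>)" 0] by simp
      also have "\<dots> = (LINT \<xi>|lborel. fourier_integral (\<lambda>y. cnj (f y)) \<xi>
              * (complex_of_real (h n \<xi>) * wave (- x * \<xi>)))"
        by (intro Bochner_Integration.integral_cong) (simp_all add: fourier_integral_cnj h_def)
      finally have "fourier_integral ?G x
          = ?c * (LINT \<xi>|lborel. fourier_integral (\<lambda>y. cnj (f y)) \<xi>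
              * (complex_of_real (h n \<xi>) * wave (- x * \<xi>)))"
        by (simp only: fourier_integral_def[of ?G])
      also have "(LINT \<xi>|lborel. fourier_integral (\<lambda>y. cnj (f y)) \<xi>
              * (complex_of_real (h n \<xi>) * wave (- x * \<xi>)))
          = (LINT y|lborel. cnj (f y)
              * fourier_integral (\<lambda>\<xi>. complex_of_real (h n \<xi>) * wave (- x * \<xi>)) y)"
        by (rule fourier_integral_multiplication_formula[OF _ hw]) (use f in simp)
      also have "\<dots> = (LINT y|lborel. cnj (f y) * (complex_of_real (real (Suc n))
          * complex_of_real (exp (- (real (Suc n) * (y - x))\<^sup>2 / 2))))"
      proof -
        have "fourier_integral (\<lambda>\<xi>. complex_of_real (h n \<xi>) * wave (- x * \<xi>)) y
            = complex_of_real (real (Suc n)) * complex_of_real (exp (- (real (Suc n) * (y - x))\<^sup>2 / 2))" for y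
          unfolding fourier_integral_modulated h_def
          by (subst fourier_integral_dilated) (simp_all only: fourier_integral_gaussian, simp_all)
        then show ?thesis by simp
      qed
      also have "?c * \<dots> = (LINT y|lborel. cnj (f y) * complex_of_real (k n (y - x)))"
        unfolding integral_mult_right_zero[symmetric]
        by (intro Bochner_Integration.integral_cong) (simp_all add: k_def)
      finally show ?thesis .
    qed
    have real_eq: "fourier_integral f \<xi> * ?G \<xi> = complex_of_real (h n \<xi> * (cmod (fourier_integral f \<xi>))\<^sup>2)" for \<xi>
      using complex_norm_square[of "fourier_integral f \<xi>"] by simp
    have "integrable lborel (\<lambda>\<xi>. fourier_integral f \<xi> * ?G \<xi>)"
      using integrable_mult_kernel[OF G, of "fourier_integral f" B] B
      by (simp only: mult.commute[of "fourier_integral f _"]) simp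
    then have int: "integrable lborel (\<lambda>\<xi>. h n \<xi> * (cmod (fourier_integral f \<xi>))\<^sup>2)"
      unfolding real_eq complex_of_real_integrable_eq .
    have "(\<integral>\<^sup>+\<xi>. ennreal (h n \<xi> * (cmod (fourier_integral f \<xi>))\<^sup>2) \<partial>lborel)
        = ennreal (LINT \<xi>|lborel. h n \<xi> * (cmod (fourier_integral f \<xi>))\<^sup>2)"
      by (rule nn_integral_eq_integral[OF int]) (simp add: h_nonneg)
    also have "\<dots> = ennreal (cmod (LINT \<xi>|lborel. fourier_integral f \<xi> * ?G \<xi>))"
      unfolding real_eq integral_complex_of_real
      by (simp add: h_nonneg integral_nonneg del: of_real_mult)
    also have "(LINT \<xi>|lborel. fourier_integral f \<xi> * ?G \<xi>) = (LINT x|lborel. f x * fourier_integral ?G x)"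
      by (rule fourier_integral_multiplication_formula[OF f(2) G])
    also have "ennreal (cmod \<dots>) \<le> (\<integral>\<^sup>+x. ennreal (cmod (f x * fourier_integral ?G x)) \<partial>lborel)"
      by (rule ennreal_norm_integral_le)
    also have "\<dots> = (\<integral>\<^sup>+x. ennreal (cmod (f x)) * ennreal (cmod (fourier_integral ?G x)) \<partial>lborel)"
      by (simp add: norm_mult ennreal_mult)
    also have "\<dots> \<le> (\<integral>\<^sup>+x. ennreal (cmod (f x))
        * (\<integral>\<^sup>+y. ennreal (cmod (cnj (f y) * complex_of_real (k n (y - x)))) \<partial>lborel) \<partial>lborel)"
      unfolding FG by (intro nn_integral_mono mult_left_mono ennreal_norm_integral_le) simp
    also have "\<dots> = (\<integral>\<^sup>+x. \<integral>\<^sup>+y. ennreal (cmod (f x) * cmod (f y) * k n (y - x)) \<partial>lborel \<partial>lborel)"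
      by (subst nn_integral_cmult[symmetric])
        (simp_all add: norm_mult k_nonneg mult.assoc flip: ennreal_mult)
    also have "\<dots> \<le> (\<integral>\<^sup>+x. ennreal ((cmod (f x))\<^sup>2) \<partial>lborel)"
      by (rule nn_integral_probability_kernel_form) (simp_all add: k_nonneg k_int)
    also have "\<dots> = ennreal ((norm (abs_l2 f))\<^sup>2)"
      by (rule nn_integral_abs_l2) fact
    finally show ?thesis .
  qed
  have "(\<integral>\<^sup>+\<xi>. ennreal ((cmod (fourier_integral f \<xi>))\<^sup>2) \<partial>lborel)
      = (\<integral>\<^sup>+\<xi>. liminf (\<lambda>n. ennreal (h n \<xi> * (cmod (fourier_integral f \<xi>))\<^sup>2)) \<partial>lborel)"
  proof (rule nn_integral_cong)
    fix \<xi>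
    have "(\<lambda>n. 1 / real (Suc n)) \<longlonglongrightarrow> 0" by (rule LIMSEQ_Suc[OF lim_1_over_n])
    then have "(\<lambda>n. exp (- (\<xi> * (1 / real (Suc n)))\<^sup>2 / 2) * (cmod (fourier_integral f \<xi>))\<^sup>2)
        \<longlonglongrightarrow> exp (- (\<xi> * 0)\<^sup>2 / 2) * (cmod (fourier_integral f \<xi>))\<^sup>2"
      by (intro tendsto_intros) auto
    then have "(\<lambda>n. ennreal (h n \<xi> * (cmod (fourier_integral f \<xi>))\<^sup>2))
        \<longlonglongrightarrow> ennreal ((cmod (fourier_integral f \<xi>))\<^sup>2)"
      by (intro tendsto_ennrealI) (simp add: h_def)
    then show "ennreal ((cmod (fourier_integral f \<xi>))\<^sup>2)
        = liminf (\<lambda>n. ennreal (h n \<xi> * (cmod (fourier_integral f \<xi>))\<^sup>2))"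
      by (rule lim_imp_Liminf[symmetric, rotated]) simp
  qed
  also have "\<dots> \<le> liminf (\<lambda>n. \<integral>\<^sup>+\<xi>. ennreal (h n \<xi> * (cmod (fourier_integral f \<xi>))\<^sup>2) \<partial>lborel)"
    by (rule nn_integral_liminf) measurable
  also have "\<dots> \<le> liminf (\<lambda>n. ennreal ((norm (abs_l2 f))\<^sup>2))"
    by (intro Liminf_mono always_eventually allI main)
  also have "\<dots> = ennreal ((norm (abs_l2 f))\<^sup>2)"
    by (simp add: Liminf_const)
  finally show "fourier_integral f \<in> L2" "norm (abs_l2 (fourier_integral f)) \<le> norm (abs_l2 f)"
    by (auto intro!: L2_I_nn_integral)
qed

lemma fourier_integral_diff_le:
  assumes "f \<in> L2" "integrable lborel f" "g \<in> L2" "integrable lborel g"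
  shows "norm (abs_l2 (fourier_integral f) - abs_l2 (fourier_integral g)) \<le> norm (abs_l2 f - abs_l2 g)"
proof -
  have "abs_l2 (fourier_integral f) - abs_l2 (fourier_integral g)
      = abs_l2 (fourier_integral (\<lambda>x. f x - g x))"
    using assms by (simp add: fourier_integral_L2 fourier_integral_diff flip: abs_l2_diff)
  then show ?thesis
    using fourier_integral_L2(2)[of "\<lambda>x. f x - g x"] assms by (simp add: L2_diff abs_l2_diff)
qed

text \<open>The truncations are those in the definition of \<^const>\<open>is_fourier\<close>, so that the continuous extension
  obtained from them is the transform defined there.\<close>

definition cutoff :: "nat \<Rightarrow> real \<Rightarrow> complex" where
  "cutoff n = indicator {- real n..real n}"

lemma borel_measurable_cutoff [measurable]: "cutoff n \<in> borel_measurable borel"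
  unfolding cutoff_def by measurable

lemma norm_cutoff_le: "cmod (cutoff n x) \<le> 1"
  by (simp add: cutoff_def indicator_def)

lemma bounded_symbol_cutoff: "bounded_symbol (cutoff n)"
  by (rule bounded_symbolI[where C=1]) (simp_all add: norm_cutoff_le)

lemma cutoff_tendsto: "(\<lambda>n. cutoff n x) \<longlonglongrightarrow> 1"
proof (rule tendsto_eventually)
  obtain N :: nat where "\<bar>x\<bar> \<le> real N" using real_arch_simple by blast
  then have "cutoff n x = 1" if "n \<ge> N" for n
    using that by (auto simp: cutoff_def indicator_def)
  then show "eventually (\<lambda>n. cutoff n x = 1) sequentially"
    by (rule eventually_sequentiallyI)
qed

lemma mult_cutoff_tendsto: "(\<lambda>n. mult_l2 (cutoff n) U) \<longlonglongrightarrow> U"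
  using mult_l2_tendsto[of cutoff 1 "\<lambda>_. 1" U]
  by (simp add: norm_cutoff_le cutoff_tendsto mult_one_l2)

lemma integrable_cutoff:
  assumes "f \<in> L2" shows "integrable lborel (\<lambda>x. cutoff n x * f x)"
proof (rule L2_mult_integrable[OF _ assms])
  show "cutoff n \<in> L2"
  proof (rule L2_I)
    have "(\<lambda>x. (cmod (cutoff n x))\<^sup>2) = indicat_real {- real n..real n}"
      by (auto simp: cutoff_def indicator_def)
    then show "integrable lborel (\<lambda>x. (cmod (cutoff n x))\<^sup>2)" by simp
  qed measurable
qed

lemma cutoff_L2: "f \<in> L2 \<Longrightarrow> (\<lambda>x. cutoff n x * f x) \<in> L2"
  by (rule bounded_symbol_L2[OF bounded_symbol_cutoff])

definition truncated_fourier :: "nat \<Rightarrow> (real \<Rightarrow> complex) \<Rightarrow> l2" where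
  "truncated_fourier n f = abs_l2 (fourier_integral (\<lambda>x. cutoff n x * f x))"

definition fourier_l2 :: "l2 \<Rightarrow> l2" where
  "fourier_l2 U = lim (\<lambda>n. truncated_fourier n (rep_l2 U))"

lemma fourier_integral_cong_AE:
  assumes [measurable]: "f \<in> borel_measurable borel" "g \<in> borel_measurable borel"
    and eq: "AE x in lborel. f x = g x"
  shows "fourier_integral f = fourier_integral g"
proof
  fix \<xi>
  have "(LINT x|lborel. f x * wave (\<xi> * x)) = (LINT x|lborel. g x * wave (\<xi> * x))"
  proof (rule integral_cong_AE)
    show "AE x in lborel. f x * wave (\<xi> * x) = g x * wave (\<xi> * x)"
      using eq by eventually_elim simp
  qed measurable
  then show "fourier_integral f \<xi> = fourier_integral g \<xi>" by (simp add: fourier_integral_def)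
qed

lemma truncated_fourier_tendsto:
  assumes f: "f \<in> L2"
  shows "(\<lambda>n. truncated_fourier n f) \<longlonglongrightarrow> fourier_l2 (abs_l2 f)"
proof -
  have "Cauchy (\<lambda>n. mult_l2 (cutoff n) (abs_l2 f))"
    using mult_cutoff_tendsto by (rule LIMSEQ_imp_Cauchy)
  moreover have "dist (truncated_fourier m f) (truncated_fourier n f)
      \<le> dist (mult_l2 (cutoff m) (abs_l2 f)) (mult_l2 (cutoff n) (abs_l2 f))" for m n
    unfolding dist_norm truncated_fourier_def mult_abs_l2[OF bounded_symbol_cutoff f]
    by (intro fourier_integral_diff_le cutoff_L2 integrable_cutoff f)
  ultimately have "Cauchy (\<lambda>n. truncated_fourier n f)"
    unfolding Cauchy_def by (meson le_less_trans)
  moreover have "truncated_fourier n (rep_l2 (abs_l2 f)) = truncated_fourier n f" for n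
  proof -
    note [measurable] = L2_measurable[OF f]
    have "AE x in lborel. cutoff n x * rep_l2 (abs_l2 f) x = cutoff n x * f x"
      using rep_abs_l2[OF f] by eventually_elim simp
    then show ?thesis
      unfolding truncated_fourier_def by (subst fourier_integral_cong_AE) auto
  qed
  ultimately show ?thesis
    by (simp add: fourier_l2_def Cauchy_convergent_iff convergent_LIMSEQ_iff)
qed

lemma fourier_l2_integral:
  assumes f: "f \<in> L2" "integrable lborel f"
  shows "fourier_l2 (abs_l2 f) = abs_l2 (fourier_integral f)"
proof (rule LIMSEQ_unique[OF truncated_fourier_tendsto[OF f(1)]])
  have "(\<lambda>n. mult_l2 (cutoff n) (abs_l2 f) - abs_l2 f) \<longlonglongrightarrow> 0"
    using mult_cutoff_tendsto by (rule LIM_zero)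
  moreover have "norm (truncated_fourier n f - abs_l2 (fourier_integral f))
      \<le> norm (mult_l2 (cutoff n) (abs_l2 f) - abs_l2 f) * 1" for n
    unfolding truncated_fourier_def mult_abs_l2[OF bounded_symbol_cutoff f(1)] mult_1_right
    by (intro fourier_integral_diff_le cutoff_L2 integrable_cutoff f)
  ultimately have "(\<lambda>n. truncated_fourier n f - abs_l2 (fourier_integral f)) \<longlonglongrightarrow> 0"
    by (rule tendsto_0_le[OF _ always_eventually, rule_format])
  then show "(\<lambda>n. truncated_fourier n f) \<longlonglongrightarrow> abs_l2 (fourier_integral f)"
    by (rule LIM_zero_cancel)
qed

lemma fourier_l2_add: "fourier_l2 (U + V) = fourier_l2 U + fourier_l2 V"
proof -
  obtain f g where fg: "f \<in> L2" "g \<in> L2" "U = abs_l2 f" "V = abs_l2 g"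
    by (metis abs_l2_exists)
  have eq: "truncated_fourier n (\<lambda>x. f x + g x) = truncated_fourier n f + truncated_fourier n g" for n
    using fg by (simp add: truncated_fourier_def distrib_left fourier_integral_add
        integrable_cutoff cutoff_L2 fourier_integral_L2 abs_l2_add)
  have "(\<lambda>n. truncated_fourier n (\<lambda>x. f x + g x)) \<longlonglongrightarrow> fourier_l2 U + fourier_l2 V"
    unfolding eq fg(3,4) by (intro tendsto_add truncated_fourier_tendsto fg)
  moreover have "(\<lambda>n. truncated_fourier n (\<lambda>x. f x + g x)) \<longlonglongrightarrow> fourier_l2 (U + V)"
    using truncated_fourier_tendsto[OF L2_add[OF fg(1,2)]] fg by (simp add: abs_l2_add)
  ultimately show ?thesis by (metis LIMSEQ_unique)
qed

lemma bounded_symbol_const [simp]: "bounded_symbol (\<lambda>_. c)"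
  by (rule bounded_symbolI[where C="cmod c"]) auto

lemma fourier_l2_mult_const: "fourier_l2 (mult_l2 (\<lambda>_. c) U) = mult_l2 (\<lambda>_. c) (fourier_l2 U)"
proof -
  obtain f where f: "f \<in> L2" "U = abs_l2 f" by (rule abs_l2_exists)
  have eq: "truncated_fourier n (\<lambda>x. c * f x) = mult_l2 (\<lambda>_. c) (truncated_fourier n f)" for n
    using f fourier_integral_cmult[of c "\<lambda>x. cutoff n x * f x"]
    by (simp add: truncated_fourier_def mult_abs_l2 fourier_integral_L2 cutoff_L2 integrable_cutoff
        mult.left_commute)
  have "(\<lambda>n. truncated_fourier n (\<lambda>x. c * f x)) \<longlonglongrightarrow> mult_l2 (\<lambda>_. c) (fourier_l2 U)"
    unfolding eq f(2)
    by (intro bounded_linear.tendsto[OF bounded_linear_mult_l2] truncated_fourier_tendsto f) simp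
  moreover have "(\<lambda>n. truncated_fourier n (\<lambda>x. c * f x)) \<longlonglongrightarrow> fourier_l2 (mult_l2 (\<lambda>_. c) U)"
    using truncated_fourier_tendsto[OF L2_mult_const[OF f(1), of c]] f by (simp add: mult_abs_l2)
  ultimately show ?thesis by (metis LIMSEQ_unique)
qed

lemma scaleR_eq_mult_l2: "c *\<^sub>R U = mult_l2 (\<lambda>_. complex_of_real c) U"
  by (rule abs_l2_exists[of U]) (simp add: mult_abs_l2 scaleR_conv_of_real flip: abs_l2_scaleR)

lemma fourier_l2_scaleR: "fourier_l2 (c *\<^sub>R U) = c *\<^sub>R fourier_l2 U"
  by (simp add: scaleR_eq_mult_l2 fourier_l2_mult_const)

lemma norm_fourier_l2_le: "norm (fourier_l2 U) \<le> norm U"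
proof -
  obtain f where f: "f \<in> L2" "U = abs_l2 f" by (rule abs_l2_exists)
  have "norm (truncated_fourier n f) \<le> norm (mult_l2 (cutoff n) U)" for n
    unfolding truncated_fourier_def f(2) mult_abs_l2[OF bounded_symbol_cutoff f(1)]
    by (intro fourier_integral_L2 cutoff_L2 integrable_cutoff f)
  then have "norm (truncated_fourier n f) \<le> norm U" for n
    using norm_mult_l2_le[of "cutoff n" 1 U] norm_cutoff_le by (auto intro: order_trans)
  then show ?thesis
    using tendsto_norm[OF truncated_fourier_tendsto[OF f(1)]] f(2)
    by (auto intro: tendsto_upperbound)
qed

lemma bounded_linear_fourier_l2: "bounded_linear fourier_l2"
  by (intro bounded_linear_intro[where K=1] fourier_l2_add fourier_l2_scaleR)
    (simp add: norm_fourier_l2_le)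

text \<open>The integral formula for the inverse transform differs from the one for the transform by the sign
  in the exponent, that is, by conjugation before and after.\<close>

definition inv_fourier_l2 :: "l2 \<Rightarrow> l2" where
  "inv_fourier_l2 U = cnj_l2 (fourier_l2 (cnj_l2 U))"

lemma bounded_linear_inv_fourier_l2: "bounded_linear inv_fourier_l2"
  unfolding inv_fourier_l2_def
  by (intro bounded_linear_compose[OF bounded_linear_cnj_l2]
      bounded_linear_compose[OF bounded_linear_fourier_l2] bounded_linear_cnj_l2)

lemma inner_fourier_l2: "inner (fourier_l2 U) V = inner U (inv_fourier_l2 V)"
proof -
  obtain f g where fg: "f \<in> L2" "g \<in> L2" "U = abs_l2 f" "V = abs_l2 g"
    by (metis abs_l2_exists)
  have "inner (fourier_l2 (mult_l2 (cutoff n) U)) (mult_l2 (cutoff n) V)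
      = inner (mult_l2 (cutoff n) U) (inv_fourier_l2 (mult_l2 (cutoff n) V))" for n
  proof -
    let ?f = "\<lambda>x. cutoff n x * f x" and ?g = "\<lambda>x. cutoff n x * g x"
    have f: "?f \<in> L2" "integrable lborel ?f" and g: "?g \<in> L2" "integrable lborel ?g"
      using fg by (simp_all add: cutoff_L2 integrable_cutoff)
    have "(LINT \<xi>|lborel. fourier_integral ?f \<xi> * cnj (?g \<xi>))
        = (LINT x|lborel. ?f x * fourier_integral (\<lambda>x. cnj (?g x)) x)"
      by (rule fourier_integral_multiplication_formula[OF f(2) integrable_cnj[OF g(2)]])
    then have "inner (fourier_l2 (abs_l2 ?f)) (abs_l2 ?g) = inner (abs_l2 ?f) (inv_fourier_l2 (abs_l2 ?g))"
      using f g
      by (simp add: inv_fourier_l2_def cnj_abs_l2 L2_cnj fourier_l2_integral fourier_integral_L2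
          inner_abs_l2 del: complex_cnj_mult)
    then show ?thesis using fg by (simp add: mult_abs_l2 bounded_symbol_cutoff)
  qed
  note eq = this
  have "(\<lambda>n. inner (fourier_l2 (mult_l2 (cutoff n) U)) (mult_l2 (cutoff n) V))
      \<longlonglongrightarrow> inner (fourier_l2 U) V"
    by (intro tendsto_inner bounded_linear.tendsto[OF bounded_linear_fourier_l2] mult_cutoff_tendsto)
  moreover have "(\<lambda>n. inner (fourier_l2 (mult_l2 (cutoff n) U)) (mult_l2 (cutoff n) V))
      \<longlonglongrightarrow> inner U (inv_fourier_l2 V)"
    unfolding eq
    by (intro tendsto_inner bounded_linear.tendsto[OF bounded_linear_inv_fourier_l2] mult_cutoff_tendsto)
  ultimately show ?thesis by (rule LIMSEQ_unique)
qed

definition gaussian :: "real \<Rightarrow> complex" where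
  "gaussian x = complex_of_real (exp (- x\<^sup>2 / 2))"

lemma gaussian_nonzero [simp]: "gaussian x \<noteq> 0"
  by (simp add: gaussian_def)

lemma cnj_gaussian [simp]: "cnj (gaussian x) = gaussian x"
  by (simp add: gaussian_def)

lemma gaussian_L2: "gaussian \<in> L2"
  unfolding gaussian_def[abs_def] by (rule L2_gaussian)

lemma integrable_gaussian': "integrable lborel gaussian"
  unfolding gaussian_def[abs_def] by (rule integrable_gaussian)

lemma fourier_gaussian [simp]: "fourier_integral gaussian = gaussian"
  unfolding gaussian_def[abs_def] by (rule ext) (rule fourier_integral_gaussian)

lemma bounded_symbol_wave: "bounded_symbol (\<lambda>x. wave (a * x))"
  by (rule bounded_symbolI[where C=1]) auto

text \<open>On these functions the inversion formula is an explicit computation: modulation becomes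
  translation, and the Gaussian is its own transform.\<close>

lemma modulated_gaussian_inversion:
  defines "g \<equiv> (\<lambda>a c x. c * (gaussian x * wave (a * x)))"
  shows "g a c \<in> L2" and "inv_fourier_l2 (fourier_l2 (abs_l2 (g a c))) = abs_l2 (g a c)"
proof -
  have L2: "(\<lambda>x. gaussian x * wave (a * x)) \<in> L2"
    using bounded_symbol_L2[OF bounded_symbol_wave[of a] gaussian_L2]
    by (simp add: mult.commute[of "gaussian _"])
  then show g: "g a c \<in> L2" unfolding g_def by (rule L2_mult_const)
  have "integrable lborel (\<lambda>x. gaussian x * wave (a * x))"
    by (rule integrable_mult_exp) (rule integrable_gaussian')
  then have g_int: "integrable lborel (g a c)" unfolding g_def by simp
  let ?h = "\<lambda>\<xi>. c * gaussian (\<xi> + a)"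
  have Fg: "fourier_integral (g a c) = ?h"
    unfolding g_def fourier_integral_cmult fourier_integral_modulated by simp
  have h: "?h \<in> L2" using fourier_integral_L2(1)[OF g g_int] Fg by simp
  have "integrable lborel (\<lambda>\<xi>. gaussian (a + 1 * \<xi>))"
    by (rule lborel_integrable_real_affine[OF integrable_gaussian']) simp
  then have h_int: "integrable lborel (\<lambda>\<xi>. cnj c * gaussian (\<xi> + a))" by (simp add: add.commute)
  have h_L2: "(\<lambda>\<xi>. cnj c * gaussian (\<xi> + a)) \<in> L2"
    using L2_cnj[OF h] by simp
  have "fourier_integral (\<lambda>\<xi>. gaussian (\<xi> + a)) x = wave (- (a * x)) * gaussian x" for x
    using fourier_integral_translated[of gaussian "- a" x] by (simp add: mult.commute)
  then have "cnj (fourier_integral (\<lambda>\<xi>. cnj c * gaussian (\<xi> + a)) x) = g a c x" for x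
    by (simp add: fourier_integral_cmult g_def mult_ac)
  then show "inv_fourier_l2 (fourier_l2 (abs_l2 (g a c))) = abs_l2 (g a c)"
    using g g_int h h_int h_L2
    by (simp add: inv_fourier_l2_def fourier_l2_integral Fg cnj_abs_l2 fourier_integral_L2)
qed

text \<open>Orthogonality of \<open>f\<close> to all modulated Gaussians says that the integrable function \<open>f\<close> times the
  Gaussian has the transform zero. The factor \<open>c\<close> is there because the inner product is the real
  part of the complex one.\<close>

lemma modulated_gaussians_total:
  assumes "\<And>a c. inner W (abs_l2 (\<lambda>x. c * (gaussian x * wave (a * x)))) = 0"
  shows "W = 0"
proof -
  obtain f where f: "f \<in> L2" "W = abs_l2 f" by (rule abs_l2_exists)
  have int: "integrable lborel (\<lambda>x. f x * gaussian x)"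
    by (rule L2_mult_integrable[OF f(1) gaussian_L2])
  have "AE x in lborel. f x * gaussian x = 0"
  proof (rule fourier_integral_injective[OF int])
    fix \<xi>
    let ?I = "LINT x|lborel. f x * gaussian x * wave (\<xi> * x)"
    have "Re (cnj c * ?I) = 0" for c
    proof -
      have "Re (LINT x|lborel. f x * cnj (c * (gaussian x * wave (- \<xi> * x)))) = 0"
        using assms[of c "- \<xi>"] by (simp only: f(2) inner_abs_l2 f(1) modulated_gaussian_inversion(1))
      also have "(\<lambda>x. f x * cnj (c * (gaussian x * wave (- \<xi> * x))))
          = (\<lambda>x. cnj c * (f x * gaussian x * wave (\<xi> * x)))"
        by (simp add: mult_ac)
      finally show ?thesis by simp
    qed
    from this[of 1] this[of \<i>] have "?I = 0" by (simp add: complex_eq_iff)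
    then show "fourier_integral (\<lambda>x. f x * gaussian x) \<xi> = 0" by (simp add: fourier_integral_def)
  qed
  then have "AE x in lborel. f x = 0" by eventually_elim simp
  then show ?thesis
    using f by (simp add: abs_l2_eq_iff L2_zero flip: abs_l2_zero)
qed

text \<open>The two operators are adjoint, so the difference of the two sides is orthogonal to every function
  for which the formula is known; by totality the modulated Gaussians are enough.\<close>

lemma inv_fourier_fourier_l2 [simp]: "inv_fourier_l2 (fourier_l2 U) = U"
proof -
  have adj: "inner (inv_fourier_l2 A) B = inner A (fourier_l2 B)" for A B
    using inner_fourier_l2[of B A] by (simp add: inner_commute)
  have "inv_fourier_l2 (fourier_l2 U) - U = 0"
    by (rule modulated_gaussians_total)
      (simp add: inner_diff_left adj inner_fourier_l2 modulated_gaussian_inversion)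
  then show ?thesis by simp
qed

lemma fourier_inv_fourier_l2 [simp]: "fourier_l2 (inv_fourier_l2 U) = U"
  using arg_cong[OF inv_fourier_fourier_l2[of "cnj_l2 U"], of cnj_l2]
  by (simp add: inv_fourier_l2_def)

lemma fourier_l2_cancel: "fourier_l2 U = fourier_l2 V \<longleftrightarrow> U = V"
  by (metis inv_fourier_fourier_l2)

text \<open>The limit in the mean that defines the transform of a function is the continuous extension
  constructed above.\<close>

lemma is_fourier_iff:
  assumes f: "f \<in> L2"
  shows "is_fourier f g \<longleftrightarrow> g \<in> L2 \<and> abs_l2 g = fourier_l2 (abs_l2 f)"
proof (cases "g \<in> L2")
  case True
  have "complex_of_real (1 / sqrt (2 * pi)) *
      (LBINT x:{- real n..real n}. f x * exp (- (\<i> * complex_of_real (\<xi> * x))))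
      = fourier_integral (\<lambda>x. cutoff n x * f x) \<xi>" for n \<xi>
    unfolding fourier_integral_def set_lebesgue_integral_def
    by (intro arg_cong2[where f="(*)"] Bochner_Integration.integral_cong)
      (auto simp: cutoff_def indicator_def wave_def)
  then have "is_fourier f g \<longleftrightarrow>
      (\<lambda>n. ennreal ((norm (abs_l2 g - truncated_fourier n f))\<^sup>2)) \<longlonglongrightarrow> 0"
    using True f
    by (simp add: is_fourier_def truncated_fourier_def nn_integral_abs_l2_diff fourier_integral_L2
        cutoff_L2 integrable_cutoff)
  also have "\<dots> \<longleftrightarrow> (\<lambda>n. (norm (abs_l2 g - truncated_fourier n f))\<^sup>2) \<longlonglongrightarrow> 0"
    using tendsto_ennreal_iff[of "\<lambda>n. (norm (abs_l2 g - truncated_fourier n f))\<^sup>2" sequentially 0] by simp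
  also have "\<dots> \<longleftrightarrow> (\<lambda>n. abs_l2 g - truncated_fourier n f) \<longlonglongrightarrow> 0"
  proof
    assume "(\<lambda>n. (norm (abs_l2 g - truncated_fourier n f))\<^sup>2) \<longlonglongrightarrow> 0"
    then have "(\<lambda>n. sqrt ((norm (abs_l2 g - truncated_fourier n f))\<^sup>2)) \<longlonglongrightarrow> sqrt 0"
      by (rule tendsto_real_sqrt)
    then show "(\<lambda>n. abs_l2 g - truncated_fourier n f) \<longlonglongrightarrow> 0"
      by (simp add: tendsto_norm_zero_iff)
  next
    assume "(\<lambda>n. abs_l2 g - truncated_fourier n f) \<longlonglongrightarrow> 0"
    then have "(\<lambda>n. (norm (abs_l2 g - truncated_fourier n f))\<^sup>2) \<longlonglongrightarrow> (norm (0::l2))\<^sup>2"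
      by (intro tendsto_intros)
    then show "(\<lambda>n. (norm (abs_l2 g - truncated_fourier n f))\<^sup>2) \<longlonglongrightarrow> 0" by simp
  qed
  also have "\<dots> \<longleftrightarrow> abs_l2 g = fourier_l2 (abs_l2 f)"
  proof
    assume "(\<lambda>n. abs_l2 g - truncated_fourier n f) \<longlonglongrightarrow> 0"
    moreover have "(\<lambda>n. abs_l2 g - truncated_fourier n f) \<longlonglongrightarrow> abs_l2 g - fourier_l2 (abs_l2 f)"
      by (intro tendsto_intros truncated_fourier_tendsto f)
    ultimately have "0 = abs_l2 g - fourier_l2 (abs_l2 f)" by (rule LIMSEQ_unique)
    then show "abs_l2 g = fourier_l2 (abs_l2 f)" by simp
  next
    assume eq: "abs_l2 g = fourier_l2 (abs_l2 f)"
    have "(\<lambda>n. abs_l2 g - truncated_fourier n f) \<longlonglongrightarrow> abs_l2 g - fourier_l2 (abs_l2 f)"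
      by (intro tendsto_intros truncated_fourier_tendsto f)
    then show "(\<lambda>n. abs_l2 g - truncated_fourier n f) \<longlonglongrightarrow> 0" by (simp add: eq)
  qed
  finally show ?thesis using True by simp
qed (simp add: is_fourier_def)

lemma
  assumes "f \<in> L2"
  shows fourier_L2: "fourier f \<in> L2"
    and abs_fourier: "abs_l2 (fourier f) = fourier_l2 (abs_l2 f)"
proof -
  have "is_fourier f (fourier f)"
    unfolding fourier_def
    by (rule someI[of _ "rep_l2 (fourier_l2 (abs_l2 f))"]) (simp add: is_fourier_iff assms)
  then show "fourier f \<in> L2" "abs_l2 (fourier f) = fourier_l2 (abs_l2 f)"
    by (simp_all add: is_fourier_iff assms)
qed


section \<open>Convolution\<close>

definition conv :: "(real \<Rightarrow> complex) \<Rightarrow> (real \<Rightarrow> complex) \<Rightarrow> real \<Rightarrow> complex" where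
  "conv f g \<xi> = (LINT \<eta>|lborel. f \<eta> * g (\<xi> - \<eta>))"

lemma borel_measurable_conv [measurable]:
  assumes [measurable]: "f \<in> borel_measurable borel" "g \<in> borel_measurable borel"
  shows "conv f g \<in> borel_measurable borel"
  unfolding conv_def by measurable

lemma L2_reflect:
  assumes "g \<in> L2" shows "(\<lambda>\<eta>. g (\<xi> - \<eta>)) \<in> L2"
proof (rule L2_I)
  note [measurable] = L2_measurable[OF assms]
  show "(\<lambda>\<eta>. g (\<xi> - \<eta>)) \<in> borel_measurable borel" by measurable
  show "integrable lborel (\<lambda>\<eta>. (cmod (g (\<xi> - \<eta>)))\<^sup>2)"
    using lborel_integrable_real_affine[OF L2_integrable_square[OF assms], of "-1" \<xi>] by simp
qed

lemma AE_reflect: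
  assumes "AE x in lborel. P x" shows "AE \<eta> in lborel. P (\<xi> - \<eta> :: real)"
proof -
  from assms obtain N where N: "N \<in> null_sets lborel" "{x. \<not> P x} \<subseteq> N"
    by (auto simp: eventually_ae_filter)
  have "AE x in lborel. x \<notin> N" using N(1) by (rule AE_not_in)
  moreover have "Measurable.pred borel (\<lambda>x. x \<notin> N)"
  proof -
    have [measurable]: "N \<in> sets borel" using null_setsD2[OF N(1)] by simp
    show ?thesis by measurable
  qed
  ultimately have "AE \<eta> in lborel. \<xi> + (-1) * \<eta> \<notin> N"
    by (intro AE_borel_affine) auto
  then show ?thesis by eventually_elim (use N(2) in auto)
qed

lemma integrable_conv_kernel:
  "f \<in> L2 \<Longrightarrow> g \<in> L2 \<Longrightarrow> integrable lborel (\<lambda>\<eta>. f \<eta> * g (\<xi> - \<eta>))"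
  by (intro L2_mult_integrable L2_reflect)

lemma conv_add_left:
  "f \<in> L2 \<Longrightarrow> f' \<in> L2 \<Longrightarrow> g \<in> L2 \<Longrightarrow> conv (\<lambda>x. f x + f' x) g \<xi> = conv f g \<xi> + conv f' g \<xi>"
  by (simp add: conv_def distrib_right integrable_conv_kernel)

lemma conv_add_right:
  "f \<in> L2 \<Longrightarrow> g \<in> L2 \<Longrightarrow> g' \<in> L2 \<Longrightarrow> conv f (\<lambda>x. g x + g' x) \<xi> = conv f g \<xi> + conv f g' \<xi>"
  by (simp add: conv_def distrib_left integrable_conv_kernel)

lemma conv_mult_left: "conv (\<lambda>x. c * f x) g \<xi> = c * conv f g \<xi>"
  by (simp add: conv_def mult.assoc)

lemma conv_mult_right: "conv f (\<lambda>x. c * g x) \<xi> = c * conv f g \<xi>"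
  by (simp add: conv_def mult.left_commute)

lemma conv_commute: "conv f g \<xi> = conv g f \<xi>"
  using lborel_integral_real_affine[of "-1" "\<lambda>\<eta>. f \<eta> * g (\<xi> - \<eta>)" \<xi>]
  by (simp add: conv_def mult.commute)

lemma conv_reflect: "conv (\<lambda>x. f (- x)) (\<lambda>x. g (- x)) \<xi> = conv f g (- \<xi>)"
  using lborel_integral_real_affine[of "-1" "\<lambda>\<eta>. f (- \<eta>) * g (- (\<xi> - \<eta>))" 0]
  by (simp add: conv_def)

lemma conv_cnj: "conv (\<lambda>x. cnj (f x)) (\<lambda>x. cnj (g x)) \<xi> = cnj (conv f g \<xi>)"
  by (simp add: conv_def flip: Bochner_Integration.integral_cnj)

lemma conv_cong_AE:
  assumes "AE x in lborel. f x = f' x" "AE x in lborel. g x = g' x"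
    and [measurable]: "f \<in> borel_measurable borel" "f' \<in> borel_measurable borel"
    "g \<in> borel_measurable borel" "g' \<in> borel_measurable borel"
  shows "conv f g \<xi> = conv f' g' \<xi>"
  unfolding conv_def
proof (rule integral_cong_AE)
  show "AE \<eta> in lborel. f \<eta> * g (\<xi> - \<eta>) = f' \<eta> * g' (\<xi> - \<eta>)"
    using assms(1) AE_reflect[OF assms(2), of \<xi>] by eventually_elim simp
qed measurable

text \<open>Young's inequality for an integrable and a square-integrable factor: Cauchy--Schwarz with
  \<open>u = sqrt u * sqrt u\<close>, followed by an exchange of the integrals.\<close>

lemma nn_integral_Young:
  fixes u v :: "real \<Rightarrow> real"
  assumes [measurable]: "u \<in> borel_measurable borel" "v \<in> borel_measurable borel"
    and nonneg: "\<And>x. u x \<ge> 0" "\<And>x. v x \<ge> 0"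
  shows "(\<integral>\<^sup>+\<xi>. (\<integral>\<^sup>+\<eta>. ennreal (u \<eta> * v (\<xi> - \<eta>)) \<partial>lborel)\<^sup>2 \<partial>lborel)
    \<le> (\<integral>\<^sup>+\<eta>. ennreal (u \<eta>) \<partial>lborel)\<^sup>2 * (\<integral>\<^sup>+x. ennreal ((v x)\<^sup>2) \<partial>lborel)"
proof -
  let ?U = "\<integral>\<^sup>+\<eta>. ennreal (u \<eta>) \<partial>lborel"
  have "(\<integral>\<^sup>+\<eta>. ennreal (u \<eta> * v (\<xi> - \<eta>)) \<partial>lborel)\<^sup>2
      \<le> ?U * (\<integral>\<^sup>+\<eta>. ennreal (u \<eta> * (v (\<xi> - \<eta>))\<^sup>2) \<partial>lborel)" for \<xi>
  proof -
    have "(\<integral>\<^sup>+\<eta>. ennreal (u \<eta> * v (\<xi> - \<eta>)) \<partial>lborel)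
        = (\<integral>\<^sup>+\<eta>. ennreal (sqrt (u \<eta>)) * ennreal (sqrt (u \<eta>) * v (\<xi> - \<eta>)) \<partial>lborel)"
      using nonneg by (simp flip: ennreal_mult add: mult.assoc[symmetric])
    moreover have "(\<integral>\<^sup>+\<eta>. ennreal (sqrt (u \<eta>)) * ennreal (sqrt (u \<eta>) * v (\<xi> - \<eta>)) \<partial>lborel)\<^sup>2
        \<le> (\<integral>\<^sup>+\<eta>. (ennreal (sqrt (u \<eta>)))\<^sup>2 \<partial>lborel)
          * (\<integral>\<^sup>+\<eta>. (ennreal (sqrt (u \<eta>) * v (\<xi> - \<eta>)))\<^sup>2 \<partial>lborel)"
      by (rule Cauchy_Schwarz_nn_integral) measurable
    ultimately show ?thesis
      using nonneg by (simp add: ennreal_power power_mult_distrib)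
  qed
  then have "(\<integral>\<^sup>+\<xi>. (\<integral>\<^sup>+\<eta>. ennreal (u \<eta> * v (\<xi> - \<eta>)) \<partial>lborel)\<^sup>2 \<partial>lborel)
      \<le> (\<integral>\<^sup>+\<xi>. ?U * (\<integral>\<^sup>+\<eta>. ennreal (u \<eta> * (v (\<xi> - \<eta>))\<^sup>2) \<partial>lborel) \<partial>lborel)"
    by (rule nn_integral_mono)
  also have "\<dots> = ?U * (\<integral>\<^sup>+\<xi>. \<integral>\<^sup>+\<eta>. ennreal (u \<eta> * (v (\<xi> - \<eta>))\<^sup>2) \<partial>lborel \<partial>lborel)"
    by (rule nn_integral_cmult) measurable
  also have "(\<integral>\<^sup>+\<xi>. \<integral>\<^sup>+\<eta>. ennreal (u \<eta> * (v (\<xi> - \<eta>))\<^sup>2) \<partial>lborel \<partial>lborel)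
      = (\<integral>\<^sup>+\<eta>. \<integral>\<^sup>+\<xi>. ennreal (u \<eta> * (v (\<xi> - \<eta>))\<^sup>2) \<partial>lborel \<partial>lborel)"
    by (rule lborel_pair.Fubini') measurable
  also have "\<dots> = (\<integral>\<^sup>+\<eta>. ennreal (u \<eta>) * (\<integral>\<^sup>+x. ennreal ((v x)\<^sup>2) \<partial>lborel) \<partial>lborel)"
  proof (rule nn_integral_cong)
    fix \<eta>
    have "(\<integral>\<^sup>+\<xi>. ennreal (u \<eta> * (v (\<xi> - \<eta>))\<^sup>2) \<partial>lborel)
        = ennreal (u \<eta>) * (\<integral>\<^sup>+\<xi>. ennreal ((v (\<xi> - \<eta>))\<^sup>2) \<partial>lborel)"
      using nonneg by (subst nn_integral_cmult[symmetric]) (simp_all add: ennreal_mult)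
    also have "(\<integral>\<^sup>+\<xi>. ennreal ((v (\<xi> - \<eta>))\<^sup>2) \<partial>lborel) = (\<integral>\<^sup>+x. ennreal ((v x)\<^sup>2) \<partial>lborel)"
      using nn_integral_real_affine[of "\<lambda>x. ennreal ((v x)\<^sup>2)" 1 "- \<eta>"] by (simp add: add.commute)
    finally show "(\<integral>\<^sup>+\<xi>. ennreal (u \<eta> * (v (\<xi> - \<eta>))\<^sup>2) \<partial>lborel)
        = ennreal (u \<eta>) * (\<integral>\<^sup>+x. ennreal ((v x)\<^sup>2) \<partial>lborel)" .
  qed
  also have "\<dots> = ?U * (\<integral>\<^sup>+x. ennreal ((v x)\<^sup>2) \<partial>lborel)"
    by (rule nn_integral_multc) measurable
  finally show ?thesis by (simp add: power2_eq_square mult.assoc)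
qed

lemma conv_L2:
  assumes f: "integrable lborel f" and g: "g \<in> L2"
  shows "conv f g \<in> L2" and "norm (abs_l2 (conv f g)) \<le> (LINT x|lborel. cmod (f x)) * norm (abs_l2 g)"
proof -
  note [measurable] = borel_measurable_integrable[OF f] L2_measurable[OF g]
  have "(\<integral>\<^sup>+\<xi>. ennreal ((cmod (conv f g \<xi>))\<^sup>2) \<partial>lborel)
      \<le> (\<integral>\<^sup>+\<xi>. (\<integral>\<^sup>+\<eta>. ennreal (cmod (f \<eta>) * cmod (g (\<xi> - \<eta>))) \<partial>lborel)\<^sup>2 \<partial>lborel)"
    using ennreal_norm_integral_le[of lborel "\<lambda>\<eta>. f \<eta> * g (_ - \<eta>)"]
    by (intro nn_integral_mono)
      (simp add: conv_def norm_mult power_mono flip: ennreal_power)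
  also have "\<dots> \<le> (\<integral>\<^sup>+\<eta>. ennreal (cmod (f \<eta>)) \<partial>lborel)\<^sup>2 * (\<integral>\<^sup>+x. ennreal ((cmod (g x))\<^sup>2) \<partial>lborel)"
    by (rule nn_integral_Young) simp_all
  also have "(\<integral>\<^sup>+\<eta>. ennreal (cmod (f \<eta>)) \<partial>lborel) = ennreal (LINT x|lborel. cmod (f x))"
    by (rule nn_integral_eq_integral) (use f in simp_all)
  also have "(\<integral>\<^sup>+x. ennreal ((cmod (g x))\<^sup>2) \<partial>lborel) = ennreal ((norm (abs_l2 g))\<^sup>2)"
    by (rule nn_integral_abs_l2) fact
  also have "(ennreal (LINT x|lborel. cmod (f x)))\<^sup>2 * ennreal ((norm (abs_l2 g))\<^sup>2)
      = ennreal (((LINT x|lborel. cmod (f x)) * norm (abs_l2 g))\<^sup>2)"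
    by (simp add: ennreal_power ennreal_mult power_mult_distrib)
  finally show "conv f g \<in> L2"
    "norm (abs_l2 (conv f g)) \<le> (LINT x|lborel. cmod (f x)) * norm (abs_l2 g)"
    by (auto intro!: L2_I_nn_integral)
qed

lemma integrable_conv_product:
  fixes f g :: "real \<Rightarrow> complex"
  assumes f: "integrable lborel f" and g: "integrable lborel g"
  shows "integrable (lborel \<Otimes>\<^sub>M lborel) (\<lambda>(\<eta>, \<xi>). f \<eta> * g (\<xi> - \<eta>))"
proof (rule lborel_pair.Fubini_integrable)
  note [measurable] = borel_measurable_integrable[OF f] borel_measurable_integrable[OF g]
  have g': "integrable lborel (\<lambda>\<xi>. g (\<xi> - \<eta>))" for \<eta>
    using lborel_integrable_real_affine[OF g, of 1 "- \<eta>"] by (simp add: add.commute)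
  show "(\<lambda>(\<eta>, \<xi>). f \<eta> * g (\<xi> - \<eta>)) \<in> borel_measurable (lborel \<Otimes>\<^sub>M lborel)" by measurable
  show "AE \<eta> in lborel. integrable lborel (\<lambda>\<xi>. case (\<eta>, \<xi>) of (\<eta>, \<xi>) \<Rightarrow> f \<eta> * g (\<xi> - \<eta>))"
    using g' by simp
  have "(LINT \<xi>|lborel. cmod (g (\<xi> - \<eta>))) = (LINT x|lborel. cmod (g x))" for \<eta>
    using lborel_integral_real_affine[of 1 "\<lambda>x. cmod (g x)" "- \<eta>"] by (simp add: add.commute)
  then show "integrable lborel (\<lambda>\<eta>. LINT \<xi>|lborel. norm (case (\<eta>, \<xi>) of (\<eta>, \<xi>) \<Rightarrow> f \<eta> * g (\<xi> - \<eta>)))"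
    using f by (simp add: norm_mult)
qed

lemma
  assumes f: "integrable lborel f" and g: "integrable lborel g"
  shows integrable_conv: "integrable lborel (conv f g)"
    and fourier_integral_conv: "fourier_integral (conv f g) \<xi>
      = complex_of_real (sqrt (2 * pi)) * fourier_integral f \<xi> * fourier_integral g \<xi>"
proof -
  note [measurable] = borel_measurable_integrable[OF f] borel_measurable_integrable[OF g]
  show int: "integrable lborel (conv f g)"
    using lborel_pair.integrable_snd[OF integrable_conv_product[OF f g]]
    by (simp add: conv_def[abs_def])
  have "integrable (lborel \<Otimes>\<^sub>M lborel) (\<lambda>(\<eta>, x). f \<eta> * g (x - \<eta>) * wave (\<xi> * x))"
  proof (rule Bochner_Integration.integrable_bound[OF integrable_conv_product[OF f g]])
    show "(\<lambda>(\<eta>, x). f \<eta> * g (x - \<eta>) * wave (\<xi> * x)) \<in> borel_measurable (lborel \<Otimes>\<^sub>M lborel)"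
      by measurable
  qed (simp add: split_beta norm_mult)
  then have "(LINT x|lborel. LINT \<eta>|lborel. f \<eta> * g (x - \<eta>) * wave (\<xi> * x))
      = (LINT \<eta>|lborel. LINT x|lborel. f \<eta> * g (x - \<eta>) * wave (\<xi> * x))"
    by (rule lborel_pair.Fubini_integral)
  also have "\<dots> = (LINT \<eta>|lborel. f \<eta> * wave (\<xi> * \<eta>) * (LINT x|lborel. g x * wave (\<xi> * x)))"
  proof (rule Bochner_Integration.integral_cong[OF refl])
    fix \<eta>
    have "(LINT x|lborel. f \<eta> * g (x - \<eta>) * wave (\<xi> * x))
        = (LINT x|lborel. f \<eta> * wave (\<xi> * \<eta>) * (g x * wave (\<xi> * x)))"
      using lborel_integral_real_affine[of 1 "\<lambda>x. f \<eta> * g (x - \<eta>) * wave (\<xi> * x)" \<eta>]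
      by (simp add: distrib_left wave_add mult_ac)
    then show "(LINT x|lborel. f \<eta> * g (x - \<eta>) * wave (\<xi> * x))
        = f \<eta> * wave (\<xi> * \<eta>) * (LINT x|lborel. g x * wave (\<xi> * x))" by simp
  qed
  also have "\<dots> = (LINT \<eta>|lborel. f \<eta> * wave (\<xi> * \<eta>)) * (LINT x|lborel. g x * wave (\<xi> * x))"
    by simp
  finally have eq: "(LINT x|lborel. conv f g x * wave (\<xi> * x))
      = (LINT \<eta>|lborel. f \<eta> * wave (\<xi> * \<eta>)) * (LINT x|lborel. g x * wave (\<xi> * x))"
    by (simp add: conv_def)
  have "complex_of_real (sqrt (2 * pi)) * complex_of_real (1 / sqrt (2 * pi)) = 1"
    by (simp flip: of_real_mult)
  then show "fourier_integral (conv f g) \<xi>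
      = complex_of_real (sqrt (2 * pi)) * fourier_integral f \<xi> * fourier_integral g \<xi>"
  proof -
    let ?A = "LINT \<eta>|lborel. f \<eta> * wave (\<xi> * \<eta>)" and ?B = "LINT x|lborel. g x * wave (\<xi> * x)"
    let ?c = "complex_of_real (1 / sqrt (2 * pi))" and ?d = "complex_of_real (sqrt (2 * pi))"
    have "?d * (?c * ?A) * (?c * ?B) = (?d * ?c) * (?c * (?A * ?B))" by (simp only: mult_ac)
    also have "\<dots> = ?c * (?A * ?B)" by (simp only: \<open>?d * ?c = 1\<close> mult_1)
    finally show ?thesis unfolding fourier_integral_def eq by (rule sym)
  qed
qed

definition inv_fourier_integral :: "(real \<Rightarrow> complex) \<Rightarrow> real \<Rightarrow> complex" where
  "inv_fourier_integral g x = cnj (fourier_integral (\<lambda>\<xi>. cnj (g \<xi>)) x)"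

lemma inv_fourier_integral_L2:
  assumes "g \<in> L2" "integrable lborel g"
  shows "inv_fourier_integral g \<in> L2" "inv_fourier_l2 (abs_l2 g) = abs_l2 (inv_fourier_integral g)"
  using assms fourier_integral_L2(1)[of "\<lambda>x. cnj (g x)"]
  by (simp_all add: inv_fourier_integral_def[abs_def] inv_fourier_l2_def cnj_abs_l2 L2_cnj
      fourier_l2_integral)

lemma fourier_inversion:
  assumes "f \<in> L2" "g \<in> L2" "integrable lborel g" "fourier_l2 (abs_l2 f) = abs_l2 g"
  shows "AE x in lborel. f x = inv_fourier_integral g x"
proof -
  have "abs_l2 f = inv_fourier_l2 (fourier_l2 (abs_l2 f))" by simp
  also have "\<dots> = abs_l2 (inv_fourier_integral g)"
    by (simp only: assms(4) inv_fourier_integral_L2(2)[OF assms(2,3)])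
  finally show ?thesis
    by (rule abs_l2_eq_iff[THEN iffD1, OF assms(1) inv_fourier_integral_L2(1)[OF assms(2,3)]])
qed

text \<open>Both factors equal the inverse Fourier integrals of their integrable transforms almost everywhere,
  and the inverse Fourier integral of a convolution is a product.\<close>

theorem fourier_l2_product:
  assumes f: "f \<in> L2" and g: "g \<in> L2"
    and F: "F \<in> L2" "integrable lborel F" "fourier_l2 (abs_l2 f) = abs_l2 F"
    and G: "G \<in> L2" "integrable lborel G" "fourier_l2 (abs_l2 g) = abs_l2 G"
  shows "(\<lambda>x. f x * g x) \<in> L2"
    and "fourier_l2 (abs_l2 (\<lambda>x. f x * g x))
      = abs_l2 (\<lambda>\<xi>. complex_of_real (1 / sqrt (2 * pi)) * conv F G \<xi>)"
proof -
  let ?c = "complex_of_real (1 / sqrt (2 * pi))"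
  let ?p = "\<lambda>\<xi>. ?c * conv F G \<xi>"
  note [measurable] = L2_measurable[OF f] L2_measurable[OF g]
  have p: "?p \<in> L2" "integrable lborel ?p"
    using conv_L2(1)[OF F(2) G(1)] integrable_conv[OF F(2) G(2)]
    by (simp_all only: L2_mult_const integrable_mult_right)
  have c: "?c * complex_of_real (sqrt (2 * pi)) = 1"
    by (simp flip: of_real_mult)
  have inv_p: "inv_fourier_integral ?p x = inv_fourier_integral F x * inv_fourier_integral G x" for x
  proof -
    have "(\<lambda>\<xi>. cnj (?p \<xi>)) = (\<lambda>\<xi>. ?c * conv (\<lambda>x. cnj (F x)) (\<lambda>x. cnj (G x)) \<xi>)"
      by (simp add: conv_cnj)
    then have "fourier_integral (\<lambda>\<xi>. cnj (?p \<xi>)) x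
        = ?c * (complex_of_real (sqrt (2 * pi)) * fourier_integral (\<lambda>x. cnj (F x)) x
          * fourier_integral (\<lambda>x. cnj (G x)) x)"
      using F G by (simp only: fourier_integral_cmult fourier_integral_conv integrable_cnj)
    also have "\<dots> = (?c * complex_of_real (sqrt (2 * pi))) * (fourier_integral (\<lambda>x. cnj (F x)) x
          * fourier_integral (\<lambda>x. cnj (G x)) x)"
      by (simp only: mult.assoc)
    finally show ?thesis by (simp only: c inv_fourier_integral_def) simp
  qed
  have eq: "AE x in lborel. inv_fourier_integral ?p x = f x * g x"
    using fourier_inversion[OF f F] fourier_inversion[OF g G]
    by eventually_elim (simp only: inv_p)
  show fg: "(\<lambda>x. f x * g x) \<in> L2"
    by (rule L2_cong_AE[OF inv_fourier_integral_L2(1)[OF p] _ eq]) measurable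
  have "abs_l2 (\<lambda>x. f x * g x) = inv_fourier_l2 (abs_l2 ?p)"
    unfolding inv_fourier_integral_L2(2)[OF p]
    by (rule abs_l2_eq_iff[THEN iffD2, OF fg inv_fourier_integral_L2(1)[OF p]])
      (use eq in eventually_elim, simp)
  then show "fourier_l2 (abs_l2 (\<lambda>x. f x * g x)) = abs_l2 ?p"
    by (simp only: fourier_inv_fourier_l2)
qed


section \<open>The quadratic nonlinearity in weighted Fourier space\<close>

definition weight :: "real \<Rightarrow> real \<Rightarrow> real" where
  "weight r \<xi> = (1 + \<xi>\<^sup>2) powr (r / 2)"

lemma one_plus_square_pos: "0 < 1 + (\<xi>::real)\<^sup>2"
  using zero_le_power2[of \<xi>] by linarith

lemma weight_pos [simp]: "0 < weight r \<xi>"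
  using one_plus_square_pos[of \<xi>] by (simp add: weight_def)

lemma weight_nonneg [simp]: "0 \<le> weight r \<xi>"
  by (simp add: less_imp_le)

lemma weight_0 [simp]: "weight 0 \<xi> = 1"
  using one_plus_square_pos[of \<xi>] by (simp add: weight_def)

lemma weight_2: "weight 2 \<xi> = 1 + \<xi>\<^sup>2"
  using one_plus_square_pos[of \<xi>] by (simp add: weight_def)

lemma weight_mult: "weight r \<xi> * weight t \<xi> = weight (r + t) \<xi>"
  by (simp add: weight_def add_divide_distrib powr_add)

lemma weight_square: "(weight r \<xi>)\<^sup>2 = weight (2 * r) \<xi>"
  by (simp add: power2_eq_square weight_mult)

lemma weight_double: "weight (2 * s) \<xi> = (1 + \<xi>\<^sup>2) powr s"
  by (simp add: weight_def)

lemma weight_minus [simp]: "weight r (- \<xi>) = weight r \<xi>"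
  by (simp add: weight_def)

lemma weight_cancel: "weight r \<xi> * (weight (- r) \<xi> * c) = c"
  by (simp add: weight_mult flip: mult.assoc)

lemma weight_le_1: "r \<le> 0 \<Longrightarrow> weight r \<xi> \<le> 1"
  using powr_mono[of "r / 2" 0 "1 + \<xi>\<^sup>2"] one_plus_square_pos[of \<xi>] by (simp add: weight_def)

lemma borel_measurable_weight [measurable]: "weight r \<in> borel_measurable borel"
  unfolding weight_def by measurable

text \<open>The larger of \<open>\<eta>\<close> and \<open>\<xi> - \<eta>\<close> controls \<open>\<xi>\<close>. This is what lets all derivatives of a product fall on one
  factor at a time.\<close>

lemma weight_triangle:
  assumes "r \<ge> 0"
  shows "weight r \<xi> \<le> 2 powr r * (weight r \<eta> + weight r (\<xi> - \<eta>))"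
proof -
  define m where "m = max (1 + \<eta>\<^sup>2) (1 + (\<xi> - \<eta>)\<^sup>2)"
  have m: "m > 0" using one_plus_square_pos[of \<eta>] by (simp add: m_def less_max_iff_disj)
  have "\<xi>\<^sup>2 \<le> 2 * \<eta>\<^sup>2 + 2 * (\<xi> - \<eta>)\<^sup>2"
    using zero_le_power2[of "2 * \<eta> - \<xi>"] by (simp add: power2_eq_square algebra_simps)
  moreover have "1 + \<eta>\<^sup>2 \<le> m" "1 + (\<xi> - \<eta>)\<^sup>2 \<le> m" by (simp_all add: m_def)
  ultimately have "1 + \<xi>\<^sup>2 \<le> 4 * m" by linarith
  then have "weight r \<xi> \<le> (4 * m) powr (r / 2)"
    unfolding weight_def using assms one_plus_square_pos[of \<xi>] by (intro powr_mono2) auto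
  also have "\<dots> = 4 powr (r / 2) * m powr (r / 2)"
    using m by (simp add: powr_mult)
  also have "(4::real) powr (r / 2) = 2 powr r"
    using powr_powr[of 2 2 "r / 2"] by simp
  also have "m powr (r / 2) \<le> weight r \<eta> + weight r (\<xi> - \<eta>)"
    using weight_nonneg[of r \<eta>] weight_nonneg[of r "\<xi> - \<eta>"]
    unfolding m_def weight_def max_def by auto
  finally show ?thesis by simp
qed

abbreviation weightC :: "real \<Rightarrow> real \<Rightarrow> complex" where
  "weightC r \<equiv> \<lambda>\<xi>. complex_of_real (weight r \<xi>)"

lemma bounded_symbol_weight: "r \<le> 0 \<Longrightarrow> bounded_symbol (weightC r)"
  by (rule bounded_symbolI[where C=1]) (simp_all add: weight_le_1)

lemma weight_minus_1_L2: "weightC (- 1) \<in> L2"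
proof (rule L2_I)
  have "integrable lborel (\<lambda>x::real. inverse (1 + x\<^sup>2))"
    using integrable_inverse_1_plus_square by (simp add: set_integrable_def)
  moreover have "(\<lambda>x. (cmod (weightC (- 1) x))\<^sup>2) = (\<lambda>x. inverse (1 + x\<^sup>2))"
  proof
    fix x :: real
    have "weight (- 2) x * weight 2 x = 1" by (simp add: weight_mult)
    then have "weight (- 2) x = inverse (1 + x\<^sup>2)"
      using one_plus_square_pos[of x] by (simp add: weight_2 field_simps)
    then show "(cmod (weightC (- 1) x))\<^sup>2 = inverse (1 + x\<^sup>2)"
      by (simp add: weight_square)
  qed
  ultimately show "integrable lborel (\<lambda>x. (cmod (weightC (- 1) x))\<^sup>2)" by simp
qed measurable

text \<open>An element \<open>U\<close> stands for the function \<open>u\<close> of Sobolev order \<open>s\<close> whose transform is \<open>hat s U\<close>; the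
  norm of \<open>U\<close> is the Sobolev norm of \<open>u\<close>.\<close>

definition hat :: "real \<Rightarrow> l2 \<Rightarrow> real \<Rightarrow> complex" where
  "hat s U \<xi> = weightC (- s) \<xi> * rep_l2 U \<xi>"

text \<open>The Sobolev norm of order one of the same function.\<close>

definition energy_norm :: "real \<Rightarrow> l2 \<Rightarrow> real" where
  "energy_norm s U = norm (mult_l2 (weightC (1 - s)) U)"

definition weight_const :: real where
  "weight_const = norm (abs_l2 (weightC (- 1)))"

lemma weight_const_nonneg [simp]: "weight_const \<ge> 0"
  by (simp add: weight_const_def)

lemma borel_measurable_hat [measurable]: "hat s U \<in> borel_measurable borel"
  unfolding hat_def by measurable

lemma hat_L2: "s \<ge> 0 \<Longrightarrow> hat s U \<in> L2"
  unfolding hat_def by (rule bounded_symbol_L2[OF bounded_symbol_weight]) auto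

lemma L2_cmod: "f \<in> L2 \<Longrightarrow> (\<lambda>x. complex_of_real (cmod (f x))) \<in> L2"
  by (rule L2_dominated[of f]) simp_all

lemma norm_abs_l2_cmod: "f \<in> L2 \<Longrightarrow> norm (abs_l2 (\<lambda>x. complex_of_real (cmod (f x)))) = norm (abs_l2 f)"
  by (simp add: norm_abs_l2 L2_cmod)

lemma norm_abs_l2_mono:
  assumes "f \<in> L2" "g \<in> L2" "\<And>x. cmod (f x) \<le> cmod (g x)"
  shows "norm (abs_l2 f) \<le> norm (abs_l2 g)"
  using assms
  by (simp add: norm_abs_l2) (intro integral_mono L2_integrable_square power_mono, simp_all)

lemma L2_L1_le:
  assumes "f \<in> L2" "g \<in> L2"
  shows "(LINT x|lborel. cmod (f x * g x)) \<le> norm (abs_l2 f) * norm (abs_l2 g)"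
proof -
  have "(LINT x|lborel. cmod (f x * g x))
      = inner (abs_l2 (\<lambda>x. complex_of_real (cmod (f x)))) (abs_l2 (\<lambda>x. complex_of_real (cmod (g x))))"
    using assms by (simp add: inner_abs_l2 L2_cmod norm_mult flip: of_real_mult)
  also have "\<dots> \<le> norm (abs_l2 f) * norm (abs_l2 g)"
    using norm_cauchy_schwarz assms by (metis norm_abs_l2_cmod)
  finally show ?thesis .
qed

text \<open>The Sobolev embedding on the Fourier side: the transform is \<open>weight (- 1)\<close>, which is
  square-integrable on the line, times a function whose norm is the norm of order one.\<close>

lemma
  assumes "s \<ge> 1"
  shows integrable_hat: "integrable lborel (hat s U)"
    and hat_L1_le: "(LINT x|lborel. cmod (hat s U x)) \<le> weight_const * energy_norm s U"
proof -
  let ?V = "\<lambda>x. weightC (1 - s) x * rep_l2 U x"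
  have V: "?V \<in> L2" using assms by (intro bounded_symbol_L2 bounded_symbol_weight) auto
  have eq: "hat s U = (\<lambda>x. weightC (- 1) x * ?V x)"
    by (rule ext) (simp add: hat_def weight_mult flip: mult.assoc of_real_mult)
  show "integrable lborel (hat s U)"
    unfolding eq by (rule L2_mult_integrable[OF weight_minus_1_L2 V])
  show "(LINT x|lborel. cmod (hat s U x)) \<le> weight_const * energy_norm s U"
    unfolding eq using L2_L1_le[OF weight_minus_1_L2 V]
    by (simp only: weight_const_def energy_norm_def mult_l2_def)
qed

lemma energy_norm_le: "s \<ge> 1 \<Longrightarrow> energy_norm s U \<le> norm U"
  unfolding energy_norm_def using norm_mult_l2_le[of "weightC (1 - s)" 1 U]
  by (simp add: weight_le_1)

lemma energy_norm_nonneg [simp]: "energy_norm s U \<ge> 0"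
  by (simp add: energy_norm_def)

lemma hat_add: "AE \<xi> in lborel. hat s (U + V) \<xi> = hat s U \<xi> + hat s V \<xi>"
proof -
  have "AE \<xi> in lborel. rep_l2 (U + V) \<xi> = rep_l2 U \<xi> + rep_l2 V \<xi>"
    using rep_abs_l2[OF L2_add[of "rep_l2 U" "rep_l2 V"]] by (simp add: abs_l2_add)
  then show ?thesis by eventually_elim (simp add: hat_def distrib_left)
qed

lemma hat_scaleR: "AE \<xi> in lborel. hat s (c *\<^sub>R U) \<xi> = complex_of_real c * hat s U \<xi>"
proof -
  have "AE \<xi> in lborel. rep_l2 (c *\<^sub>R U) \<xi> = c *\<^sub>R rep_l2 U \<xi>"
    using rep_abs_l2[OF L2_scaleR[of "rep_l2 U" c]] by (simp add: abs_l2_scaleR)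
  then show ?thesis by eventually_elim (simp add: hat_def scaleR_conv_of_real mult_ac)
qed

text \<open>Minus \<open>\<i>\<close> times the symbol \<open>\<psi>\<close>, the weight of the target space, and the factor of the convolution
  theorem. Hence \<open>nonlinearity \<nu> s U U\<close> represents \<open>- \<i> \<psi>(\<partial>\<^sub>x) u\<^sup>2\<close>.\<close>

definition nonlinear_symbol :: "real \<Rightarrow> real \<Rightarrow> real \<Rightarrow> complex" where
  "nonlinear_symbol \<nu> s \<xi> = - (\<i> * complex_of_real (kdv_bbm_psi \<nu> \<xi> * weight s \<xi> / sqrt (2 * pi)))"

definition nonlinearity :: "real \<Rightarrow> real \<Rightarrow> l2 \<Rightarrow> l2 \<Rightarrow> l2" where
  "nonlinearity \<nu> s U V = abs_l2 (\<lambda>\<xi>. nonlinear_symbol \<nu> s \<xi> * conv (hat s U) (hat s V) \<xi>)"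

lemma borel_measurable_psi [measurable]: "kdv_bbm_psi \<nu> \<in> borel_measurable borel"
  unfolding kdv_bbm_psi_def by measurable

lemma borel_measurable_nonlinear_symbol [measurable]:
  "nonlinear_symbol \<nu> s \<in> borel_measurable borel"
  unfolding nonlinear_symbol_def by measurable

lemma psi_bounded:
  assumes "\<nu> < 1/6"
  shows "\<bar>kdv_bbm_psi \<nu> \<xi>\<bar> \<le> max 1 (1 / (1/6 - \<nu>))"
proof -
  define \<alpha> where "\<alpha> = 1/6 - \<nu>"
  have \<alpha>: "\<alpha> > 0" using assms by (simp add: \<alpha>_def)
  define M where "M = max 1 (1 / \<alpha>)"
  have M: "M \<ge> 1" "M * \<alpha> \<ge> 1"
    using \<alpha> by (auto simp: M_def max_def field_simps)
  have "\<bar>\<xi>\<bar> \<le> 1 + \<xi>\<^sup>2"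
    using zero_le_power2[of "\<bar>\<xi>\<bar> - 1"] zero_le_power2[of \<xi>] by (simp add: power2_diff)
  also have "1 + \<xi>\<^sup>2 \<le> M * (\<alpha> * \<xi>\<^sup>2 + 1)"
    using M mult_right_mono[OF M(2), of "\<xi>\<^sup>2"] by (simp add: algebra_simps)
  finally have "3 * \<bar>\<xi>\<bar> \<le> 4 * (M * (\<alpha> * \<xi>\<^sup>2 + 1))"
    using abs_ge_zero[of \<xi>] by linarith
  then have "3 * \<bar>\<xi>\<bar> \<le> M * (4 * (\<alpha> * \<xi>\<^sup>2 + 1))" by (simp only: mult.left_commute)
  moreover have "\<alpha> * \<xi>\<^sup>2 + 1 > 0" using \<alpha> by (simp add: add_nonneg_pos)
  ultimately have "\<bar>3 * \<xi> / (4 * (\<alpha> * \<xi>\<^sup>2 + 1))\<bar> \<le> M"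
    by (simp add: abs_mult abs_divide divide_le_eq)
  then show ?thesis by (simp add: kdv_bbm_psi_def M_def \<alpha>_def)
qed

definition nonlinear_const :: "real \<Rightarrow> real \<Rightarrow> real" where
  "nonlinear_const \<nu> s = max 1 (1 / (1/6 - \<nu>)) * 2 powr s"

lemma nonlinear_const_nonneg: "nonlinear_const \<nu> s \<ge> 0"
  by (simp add: nonlinear_const_def)

text \<open>The weight of the output frequency is passed to one of the two input frequencies, where it
  cancels the negative weight in \<^const>\<open>hat\<close>; the factor \<open>1 / sqrt (2 * pi)\<close> is estimated by one.\<close>

lemma nonlinear_pointwise_le:
  assumes "s \<ge> 1" "\<nu> < 1/6"
  shows "cmod (nonlinear_symbol \<nu> s \<xi> * conv (hat s U) (hat s V) \<xi>)
    \<le> cmod (complex_of_real (nonlinear_const \<nu> s) *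
        (conv (\<lambda>x. complex_of_real (cmod (rep_l2 U x))) (\<lambda>x. complex_of_real (cmod (hat s V x))) \<xi>
       + conv (\<lambda>x. complex_of_real (cmod (hat s U x))) (\<lambda>x. complex_of_real (cmod (rep_l2 V x))) \<xi>))"
proof -
  let ?u = "\<lambda>x. cmod (rep_l2 U x)" and ?v = "\<lambda>x. cmod (rep_l2 V x)"
  let ?a = "\<lambda>x. cmod (hat s U x)" and ?b = "\<lambda>x. cmod (hat s V x)"
  have conv_real: "conv (\<lambda>x. complex_of_real (f x)) (\<lambda>x. complex_of_real (g x)) \<xi>
      = complex_of_real (LINT \<eta>|lborel. f \<eta> * g (\<xi> - \<eta>))" for f g
    by (simp add: conv_def flip: of_real_mult)
  have s0: "s \<ge> 0" using assms by simp
  have int: "integrable lborel (\<lambda>\<eta>. cmod (f \<eta>) * cmod (g (\<xi> - \<eta>)))" if "f \<in> L2" "g \<in> L2" for f g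
    using integrable_norm[OF integrable_conv_kernel[OF that, of \<xi>]] by (simp add: norm_mult)
  have wa: "weight s \<eta> * ?a \<eta> = ?u \<eta>" and wb: "weight s \<eta> * ?b \<eta> = ?v \<eta>" for \<eta>
    by (simp_all add: hat_def norm_mult weight_cancel)
  have "weight s \<xi> * cmod (conv (hat s U) (hat s V) \<xi>)
      \<le> weight s \<xi> * (LINT \<eta>|lborel. ?a \<eta> * ?b (\<xi> - \<eta>))"
    unfolding conv_def
    using integral_norm_bound[of lborel "\<lambda>\<eta>. hat s U \<eta> * hat s V (\<xi> - \<eta>)"]
    by (intro mult_left_mono) (simp_all add: norm_mult)
  also have "\<dots> = (LINT \<eta>|lborel. weight s \<xi> * (?a \<eta> * ?b (\<xi> - \<eta>)))" by simp
  also have "\<dots> \<le> (LINT \<eta>|lborel. 2 powr s * (?u \<eta> * ?b (\<xi> - \<eta>) + ?a \<eta> * ?v (\<xi> - \<eta>)))"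
  proof (rule integral_mono)
    show "integrable lborel (\<lambda>\<eta>. weight s \<xi> * (?a \<eta> * ?b (\<xi> - \<eta>)))"
      by (intro integrable_mult_right int hat_L2 s0)
    show "integrable lborel (\<lambda>\<eta>. 2 powr s * (?u \<eta> * ?b (\<xi> - \<eta>) + ?a \<eta> * ?v (\<xi> - \<eta>)))"
      by (intro integrable_mult_right Bochner_Integration.integrable_add int hat_L2 s0 rep_l2_L2)
    fix \<eta>
    have "weight s \<xi> * (?a \<eta> * ?b (\<xi> - \<eta>))
        \<le> 2 powr s * (weight s \<eta> + weight s (\<xi> - \<eta>)) * (?a \<eta> * ?b (\<xi> - \<eta>))"
      by (intro mult_right_mono weight_triangle s0) simp
    also have "\<dots> = 2 powr s * ((weight s \<eta> * ?a \<eta>) * ?b (\<xi> - \<eta>)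
        + ?a \<eta> * (weight s (\<xi> - \<eta>) * ?b (\<xi> - \<eta>)))"
      by (simp add: algebra_simps)
    finally show "weight s \<xi> * (?a \<eta> * ?b (\<xi> - \<eta>))
        \<le> 2 powr s * (?u \<eta> * ?b (\<xi> - \<eta>) + ?a \<eta> * ?v (\<xi> - \<eta>))"
      by (simp only: wa wb)
  qed
  also have "\<dots> = 2 powr s * ((LINT \<eta>|lborel. ?u \<eta> * ?b (\<xi> - \<eta>)) + (LINT \<eta>|lborel. ?a \<eta> * ?v (\<xi> - \<eta>)))"
    by (simp add: int hat_L2 s0)
  finally have main: "weight s \<xi> * cmod (conv (hat s U) (hat s V) \<xi>) \<le> 2 powr s *
      ((LINT \<eta>|lborel. ?u \<eta> * ?b (\<xi> - \<eta>)) + (LINT \<eta>|lborel. ?a \<eta> * ?v (\<xi> - \<eta>)))"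
    (is "_ \<le> _ * ?S") .
  have S: "?S \<ge> 0" by (intro add_nonneg_nonneg integral_nonneg) simp_all
  have "sqrt 1 \<le> sqrt (2 * pi)" using pi_ge_two by (intro real_sqrt_le_mono) linarith
  then have "\<bar>kdv_bbm_psi \<nu> \<xi>\<bar> / sqrt (2 * pi) \<le> max 1 (1 / (1/6 - \<nu>)) / 1"
    using psi_bounded[OF assms(2), of \<xi>] by (intro frac_le) auto
  then have "\<bar>kdv_bbm_psi \<nu> \<xi>\<bar> / sqrt (2 * pi) * (weight s \<xi> * cmod (conv (hat s U) (hat s V) \<xi>))
      \<le> max 1 (1 / (1/6 - \<nu>)) * (2 powr s * ?S)"
    by (intro mult_mono[OF _ main]) simp_all
  moreover have "cmod (nonlinear_symbol \<nu> s \<xi> * conv (hat s U) (hat s V) \<xi>)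
      = \<bar>kdv_bbm_psi \<nu> \<xi>\<bar> / sqrt (2 * pi) * (weight s \<xi> * cmod (conv (hat s U) (hat s V) \<xi>))"
    by (simp add: nonlinear_symbol_def norm_mult norm_divide abs_mult)
  ultimately show ?thesis
    unfolding conv_real using S nonlinear_const_nonneg[of \<nu> s]
    by (simp add: norm_mult nonlinear_const_def mult.assoc flip: of_real_add)
qed

text \<open>The tame estimate: one factor is measured in the full norm, the other one only in the norm of
  order one, which the energy controls. So the equation is linearly bounded in the full norm, and
  Gronwall's lemma gives global bounds of every order.\<close>

lemma
  assumes s: "s \<ge> 1" and \<nu>: "\<nu> < 1/6"
  shows nonlinear_L2: "(\<lambda>\<xi>. nonlinear_symbol \<nu> s \<xi> * conv (hat s U) (hat s V) \<xi>) \<in> L2" (is "?N \<in> L2")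
    and norm_nonlinearity_le: "norm (nonlinearity \<nu> s U V)
      \<le> nonlinear_const \<nu> s * weight_const * (norm U * energy_norm s V + energy_norm s U * norm V)"
proof -
  let ?m = "\<lambda>f x. complex_of_real (cmod (f x))"
  let ?f = "conv (?m (rep_l2 U)) (?m (hat s V))" and ?g = "conv (?m (hat s U)) (?m (rep_l2 V))"
  have f_eq: "?f = conv (?m (hat s V)) (?m (rep_l2 U))" by (rule ext) (rule conv_commute)
  have L1: "integrable lborel (?m (hat s W))" for W
    using integrable_norm[OF integrable_hat[OF s, of W]] by simp
  have f: "?f \<in> L2" "norm (abs_l2 ?f) \<le> weight_const * energy_norm s V * norm U"
    unfolding f_eq using conv_L2[OF L1[of V] L2_cmod[OF rep_l2_L2[of U]]]
      mult_right_mono[OF hat_L1_le[OF s, of V], of "norm U"]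
    by (simp_all add: norm_abs_l2_cmod)
  have g: "?g \<in> L2" "norm (abs_l2 ?g) \<le> weight_const * energy_norm s U * norm V"
    using conv_L2[OF L1[of U] L2_cmod[OF rep_l2_L2[of V]]]
      mult_right_mono[OF hat_L1_le[OF s, of U], of "norm V"]
    by (simp_all add: norm_abs_l2_cmod)
  let ?h = "\<lambda>\<xi>. complex_of_real (nonlinear_const \<nu> s) * (?f \<xi> + ?g \<xi>)"
  have h: "?h \<in> L2" by (intro L2_mult_const L2_add f g)
  show N: "?N \<in> L2"
    by (rule L2_dominated[OF h]) (measurable, rule nonlinear_pointwise_le[OF s \<nu>])
  have "norm (nonlinearity \<nu> s U V) \<le> norm (abs_l2 ?h)"
    unfolding nonlinearity_def
    by (rule norm_abs_l2_mono[OF N h]) (rule nonlinear_pointwise_le[OF s \<nu>])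
  also have "abs_l2 ?h = nonlinear_const \<nu> s *\<^sub>R (abs_l2 ?f + abs_l2 ?g)"
    using f g by (simp add: L2_add scaleR_conv_of_real flip: abs_l2_add abs_l2_scaleR)
  also have "norm \<dots> \<le> nonlinear_const \<nu> s * (norm (abs_l2 ?f) + norm (abs_l2 ?g))"
    using nonlinear_const_nonneg by (simp add: mult_left_mono norm_triangle_ineq)
  also have "\<dots> \<le> nonlinear_const \<nu> s
      * (weight_const * energy_norm s V * norm U + weight_const * energy_norm s U * norm V)"
    using nonlinear_const_nonneg f g by (intro mult_left_mono add_mono)
  finally show "norm (nonlinearity \<nu> s U V)
      \<le> nonlinear_const \<nu> s * weight_const * (norm U * energy_norm s V + energy_norm s U * norm V)"
    by (simp add: algebra_simps)
qed

lemma bounded_bilinear_nonlinearity: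
  assumes s: "s \<ge> 1" and \<nu>: "\<nu> < 1/6"
  shows "bounded_bilinear (nonlinearity \<nu> s)"
proof
  have s0: "s \<ge> 0" using s by simp
  note L2 = nonlinear_L2[OF s \<nu>]
  show "nonlinearity \<nu> s (U + U') V = nonlinearity \<nu> s U V + nonlinearity \<nu> s U' V" for U U' V
  proof -
    have "conv (hat s (U + U')) (hat s V) \<xi> = conv (hat s U) (hat s V) \<xi> + conv (hat s U') (hat s V) \<xi>" for \<xi>
      by (subst conv_add_left[symmetric])
        (simp_all add: hat_L2 s0, rule conv_cong_AE[OF hat_add], simp_all)
    then show ?thesis
      by (simp add: nonlinearity_def distrib_left L2 abs_l2_add)
  qed
  show "nonlinearity \<nu> s U (V + V') = nonlinearity \<nu> s U V + nonlinearity \<nu> s U V'" for U V V'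
  proof -
    have "conv (hat s U) (hat s (V + V')) \<xi> = conv (hat s U) (hat s V) \<xi> + conv (hat s U) (hat s V') \<xi>" for \<xi>
      by (subst conv_add_right[symmetric])
        (simp_all add: hat_L2 s0, rule conv_cong_AE[OF _ hat_add], simp_all)
    then show ?thesis
      by (simp add: nonlinearity_def distrib_left L2 abs_l2_add)
  qed
  show "nonlinearity \<nu> s (r *\<^sub>R U) V = r *\<^sub>R nonlinearity \<nu> s U V" for r U V
  proof -
    have "conv (hat s (r *\<^sub>R U)) (hat s V) \<xi> = complex_of_real r * conv (hat s U) (hat s V) \<xi>" for \<xi>
      by (subst conv_mult_left[symmetric]) (rule conv_cong_AE[OF hat_scaleR], simp_all)
    then show ?thesis
      using L2 by (simp add: nonlinearity_def scaleR_conv_of_real mult.left_commute flip: abs_l2_scaleR)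
  qed
  show "nonlinearity \<nu> s U (r *\<^sub>R V) = r *\<^sub>R nonlinearity \<nu> s U V" for r U V
  proof -
    have "conv (hat s U) (hat s (r *\<^sub>R V)) \<xi> = complex_of_real r * conv (hat s U) (hat s V) \<xi>" for \<xi>
      by (subst conv_mult_right[symmetric]) (rule conv_cong_AE[OF _ hat_scaleR], simp_all)
    then show ?thesis
      using L2 by (simp add: nonlinearity_def scaleR_conv_of_real mult.left_commute flip: abs_l2_scaleR)
  qed
  show "\<exists>K. \<forall>U V. norm (nonlinearity \<nu> s U V) \<le> norm U * norm V * K"
  proof (intro exI allI)
    fix U V
    have "norm (nonlinearity \<nu> s U V)
        \<le> nonlinear_const \<nu> s * weight_const * (norm U * energy_norm s V + energy_norm s U * norm V)"
      by (rule norm_nonlinearity_le[OF s \<nu>])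
    also have "\<dots> \<le> nonlinear_const \<nu> s * weight_const * (norm U * norm V + norm U * norm V)"
      using nonlinear_const_nonneg
      by (intro mult_left_mono add_mono mult_right_mono energy_norm_le s) simp_all
    finally show "norm (nonlinearity \<nu> s U V) \<le> norm U * norm V * (2 * nonlinear_const \<nu> s * weight_const)"
      by (simp add: algebra_simps)
  qed
qed

section \<open>The linear group, real functions and the conserved energy\<close>

definition evolution :: "real \<Rightarrow> real \<Rightarrow> l2 \<Rightarrow> l2" where
  "evolution \<nu> t = mult_l2 (\<lambda>\<xi>. wave (kdv_bbm_phi \<nu> \<xi> * t))"

lemma borel_measurable_phi [measurable]: "kdv_bbm_phi \<nu> \<in> borel_measurable borel"
  unfolding kdv_bbm_phi_def by measurable

lemma bounded_symbol_evolution: "bounded_symbol (\<lambda>\<xi>. wave (kdv_bbm_phi \<nu> \<xi> * t))"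
  by (rule bounded_symbolI[where C=1]) simp_all

lemma bounded_linear_evolution: "bounded_linear (evolution \<nu> t)"
  unfolding evolution_def by (rule bounded_linear_mult_l2[OF bounded_symbol_evolution])

lemma norm_evolution: "norm (evolution \<nu> t U) = norm U"
  unfolding evolution_def by (rule norm_mult_l2_unimodular) simp_all

lemma evolution_0: "evolution \<nu> 0 U = U"
  by (simp add: evolution_def mult_one_l2)

lemma evolution_add: "evolution \<nu> (r + t) U = evolution \<nu> r (evolution \<nu> t U)"
  by (simp add: evolution_def mult_mult_l2 bounded_symbol_evolution distrib_left wave_add)

lemma isCont_wave: "isCont wave t"
  unfolding wave_def by (intro continuous_intros)

lemma continuous_evolution: "continuous_on UNIV (\<lambda>t. evolution \<nu> t U)"
proof (rule continuous_on_sequentiallyI)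
  fix r :: "nat \<Rightarrow> real" and t assume r: "r \<longlonglongrightarrow> t"
  show "(\<lambda>n. evolution \<nu> (r n) U) \<longlonglongrightarrow> evolution \<nu> t U"
    unfolding evolution_def
  proof (rule mult_l2_tendsto[where C=1])
    show "(\<lambda>n. wave (kdv_bbm_phi \<nu> x * r n)) \<longlonglongrightarrow> wave (kdv_bbm_phi \<nu> x * t)" for x
      by (intro isCont_tendsto_compose[OF isCont_wave] tendsto_intros r)
  qed simp_all
qed

text \<open>Complex conjugation of a function is this operation on its transform, so its fixed points represent
  the real-valued functions.\<close>

definition reflect_cnj :: "l2 \<Rightarrow> l2" where
  "reflect_cnj U = abs_l2 (\<lambda>\<xi>. cnj (rep_l2 U (- \<xi>)))"

lemma reflect_cnj_L2: "f \<in> L2 \<Longrightarrow> (\<lambda>\<xi>. cnj (f (- \<xi>))) \<in> L2"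
  using L2_cnj[OF L2_reflect[of f 0]] by simp

lemma reflect_cnj_abs:
  assumes "f \<in> L2" shows "reflect_cnj (abs_l2 f) = abs_l2 (\<lambda>\<xi>. cnj (f (- \<xi>)))"
proof -
  have "AE \<xi> in lborel. rep_l2 (abs_l2 f) (- \<xi>) = f (- \<xi>)"
    using AE_reflect[OF rep_abs_l2[OF assms], of 0] by simp
  then have "AE \<xi> in lborel. cnj (rep_l2 (abs_l2 f) (- \<xi>)) = cnj (f (- \<xi>))"
    by eventually_elim simp
  then show ?thesis
    by (simp add: reflect_cnj_def abs_l2_eq_iff reflect_cnj_L2 assms)
qed

lemma norm_reflect_cnj: "norm (reflect_cnj U) = norm U"
proof -
  obtain f where f: "f \<in> L2" "U = abs_l2 f" by (rule abs_l2_exists)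
  show ?thesis
    using lborel_integral_real_affine[of "-1" "\<lambda>x. (cmod (f x))\<^sup>2" 0]
    by (simp add: f reflect_cnj_abs norm_abs_l2 reflect_cnj_L2)
qed

lemma bounded_linear_reflect_cnj: "bounded_linear reflect_cnj"
proof (rule bounded_linear_intro[where K=1])
  show "reflect_cnj (U + V) = reflect_cnj U + reflect_cnj V" for U V
    by (rule abs_l2_exists[of U], rule abs_l2_exists[of V])
      (simp add: reflect_cnj_abs reflect_cnj_L2 L2_add flip: abs_l2_add)
  show "reflect_cnj (r *\<^sub>R U) = r *\<^sub>R reflect_cnj U" for r U
    by (rule abs_l2_exists[of U])
      (simp add: reflect_cnj_abs reflect_cnj_L2 L2_scaleR flip: abs_l2_scaleR)
qed (simp add: norm_reflect_cnj)

lemma bounded_symbol_reflect_cnj: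
  assumes "bounded_symbol m" shows "bounded_symbol (\<lambda>\<xi>. cnj (m (- \<xi>)))"
proof -
  note [measurable] = bounded_symbol_measurable[OF assms]
  obtain C where "\<And>x. cmod (m x) \<le> C" using assms by (auto simp: bounded_symbol_def)
  then show ?thesis by (intro bounded_symbolI[where C=C]) simp_all
qed

lemma reflect_cnj_mult:
  "bounded_symbol m \<Longrightarrow> reflect_cnj (mult_l2 m U) = mult_l2 (\<lambda>\<xi>. cnj (m (- \<xi>))) (reflect_cnj U)"
  by (rule abs_l2_exists[of U])
    (simp add: mult_abs_l2 reflect_cnj_abs reflect_cnj_L2 bounded_symbol_L2 bounded_symbol_reflect_cnj)

lemma phi_odd: "kdv_bbm_phi \<nu> (- \<xi>) = - kdv_bbm_phi \<nu> \<xi>"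
  by (simp add: kdv_bbm_phi_def)

lemma psi_odd: "kdv_bbm_psi \<nu> (- \<xi>) = - kdv_bbm_psi \<nu> \<xi>"
  by (simp add: kdv_bbm_psi_def)

lemma reflect_cnj_evolution: "reflect_cnj (evolution \<nu> t U) = evolution \<nu> t (reflect_cnj U)"
  by (simp add: evolution_def reflect_cnj_mult bounded_symbol_evolution phi_odd)

lemma hat_reflect_cnj: "AE \<xi> in lborel. hat s (reflect_cnj U) \<xi> = cnj (hat s U (- \<xi>))"
  using rep_abs_l2[OF reflect_cnj_L2[OF rep_l2_L2[of U]]]
  unfolding reflect_cnj_def[symmetric] by eventually_elim (simp add: hat_def)

lemma conv_hat_reflect_cnj:
  "conv (hat s (reflect_cnj U)) (hat s (reflect_cnj V)) \<xi> = cnj (conv (hat s U) (hat s V) (- \<xi>))"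
proof -
  have "conv (hat s (reflect_cnj U)) (hat s (reflect_cnj V)) \<xi>
      = conv (\<lambda>x. cnj (hat s U (- x))) (\<lambda>x. cnj (hat s V (- x))) \<xi>"
    by (rule conv_cong_AE[OF hat_reflect_cnj hat_reflect_cnj]) simp_all
  then show ?thesis
    by (simp add: conv_cnj[of "\<lambda>x. hat s U (- x)" "\<lambda>x. hat s V (- x)"] conv_reflect)
qed

lemma reflect_cnj_nonlinearity:
  assumes s: "s \<ge> 1" and \<nu>: "\<nu> < 1/6"
  shows "reflect_cnj (nonlinearity \<nu> s U V) = nonlinearity \<nu> s (reflect_cnj U) (reflect_cnj V)"
proof -
  have "cnj (nonlinear_symbol \<nu> s (- \<xi>)) = nonlinear_symbol \<nu> s \<xi>" for \<xi>
    by (simp add: nonlinear_symbol_def psi_odd)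
  then show ?thesis
    by (simp add: nonlinearity_def reflect_cnj_abs nonlinear_L2[OF s \<nu>] conv_hat_reflect_cnj)
qed

text \<open>The energy is the integral of \<open>u\<^sup>2 + (1/6 - \<nu>) u\<^sub>x\<^sup>2\<close>. The negative weight undoes the weight \<open>s\<close> in both
  arguments.\<close>

definition energy_symbol :: "real \<Rightarrow> real \<Rightarrow> real \<Rightarrow> real" where
  "energy_symbol \<nu> s \<xi> = (1 + (1/6 - \<nu>) * \<xi>\<^sup>2) * weight (- (2 * s)) \<xi>"

definition energy :: "real \<Rightarrow> real \<Rightarrow> l2 \<Rightarrow> l2 \<Rightarrow> real" where
  "energy \<nu> s U V = inner (mult_l2 (\<lambda>\<xi>. complex_of_real (energy_symbol \<nu> s \<xi>)) U) V"

lemma weight_double_minus: "weight (- (2 * s)) \<xi> * (1 + \<xi>\<^sup>2) = (weight (1 - s) \<xi>)\<^sup>2"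
  by (simp add: weight_square weight_mult flip: weight_2)

lemma bounded_symbol_energy:
  assumes s: "s \<ge> 1" and \<nu>: "\<nu> < 1/6"
  shows "bounded_symbol (\<lambda>\<xi>. complex_of_real (energy_symbol \<nu> s \<xi>))"
proof (rule bounded_symbolI)
  show "(\<lambda>\<xi>. complex_of_real (energy_symbol \<nu> s \<xi>)) \<in> borel_measurable borel"
    unfolding energy_symbol_def by measurable
  fix \<xi> :: real
  define M where "M = max 1 (1/6 - \<nu>)"
  have M: "1 \<le> M" "1/6 - \<nu> \<le> M" by (auto simp: M_def)
  have pos: "0 \<le> 1 + (1/6 - \<nu>) * \<xi>\<^sup>2" using \<nu> by (intro add_nonneg_nonneg mult_nonneg_nonneg) auto
  have "1 + (1/6 - \<nu>) * \<xi>\<^sup>2 \<le> M * (1 + \<xi>\<^sup>2)"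
    using M mult_right_mono[OF M(2), of "\<xi>\<^sup>2"] by (simp add: distrib_left)
  then have "energy_symbol \<nu> s \<xi> \<le> M * (1 + \<xi>\<^sup>2) * weight (- (2 * s)) \<xi>"
    unfolding energy_symbol_def by (rule mult_right_mono) simp
  also have "\<dots> = M * (weight (1 - s) \<xi>)\<^sup>2"
    by (simp add: weight_double_minus[symmetric])
  also have "\<dots> \<le> M * 1"
    using M s weight_le_1[of "1 - s" \<xi>] by (intro mult_left_mono power_le_one) auto
  finally show "cmod (complex_of_real (energy_symbol \<nu> s \<xi>)) \<le> M"
    using pos by (simp add: energy_symbol_def del: of_real_mult)
qed

lemma bounded_bilinear_energy:
  assumes s: "s \<ge> 1" and \<nu>: "\<nu> < 1/6"
  shows "bounded_bilinear (energy \<nu> s)"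
  unfolding energy_def
  by (rule bounded_bilinear.comp1[OF bounded_bilinear_inner
        bounded_linear_mult_l2[OF bounded_symbol_energy[OF s \<nu>]]])

lemma energy_commute:
  assumes s: "s \<ge> 1" and \<nu>: "\<nu> < 1/6"
  shows "energy \<nu> s U V = energy \<nu> s V U"
  unfolding energy_def by (subst inner_mult_l2[OF bounded_symbol_energy[OF s \<nu>]])
    (simp add: inner_commute)

lemma energy_evolution:
  assumes s: "s \<ge> 1" and \<nu>: "\<nu> < 1/6"
  shows "energy \<nu> s (evolution \<nu> t U) (evolution \<nu> t V) = energy \<nu> s U V"
proof -
  let ?e = "\<lambda>\<xi>. complex_of_real (energy_symbol \<nu> s \<xi>)"
  let ?w = "\<lambda>t \<xi>. wave (kdv_bbm_phi \<nu> \<xi> * t)"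
  note e = bounded_symbol_energy[OF s \<nu>]
  have w: "wave (- x) * (c * wave x) = c" for x c
    by (simp add: mult.left_commute flip: wave_add)
  have "energy \<nu> s (evolution \<nu> t U) (evolution \<nu> t V)
      = inner (mult_l2 (?w t) V) (mult_l2 ?e (mult_l2 (?w t) U))"
    by (simp add: energy_def evolution_def inner_commute)
  also have "\<dots> = inner V (mult_l2 (\<lambda>\<xi>. ?w (- t) \<xi> * (?e \<xi> * ?w t \<xi>)) U)"
    using bounded_symbol_evolution[of \<nu> t] bounded_symbol_evolution[of \<nu> "- t"] e
    by (subst inner_mult_l2) (simp_all add: mult_mult_l2 bounded_symbol_mult)
  also have "\<dots> = energy \<nu> s U V"
    by (simp add: w energy_def inner_commute)
  finally show ?thesis .
qed

lemma inner_mult_l2_real: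
  assumes "bounded_symbol (\<lambda>\<xi>. complex_of_real (m \<xi>))"
  shows "integrable lborel (\<lambda>\<xi>. m \<xi> * (cmod (rep_l2 U \<xi>))\<^sup>2)"
    and "inner (mult_l2 (\<lambda>\<xi>. complex_of_real (m \<xi>)) U) U = (LINT \<xi>|lborel. m \<xi> * (cmod (rep_l2 U \<xi>))\<^sup>2)"
proof -
  let ?f = "\<lambda>\<xi>. complex_of_real (m \<xi>) * rep_l2 U \<xi>"
  have f: "?f \<in> L2" by (rule bounded_symbol_L2[OF assms]) simp
  have eq: "?f \<xi> * cnj (rep_l2 U \<xi>) = complex_of_real (m \<xi> * (cmod (rep_l2 U \<xi>))\<^sup>2)" for \<xi>
    by (simp only: of_real_mult complex_norm_square mult.assoc)
  have "integrable lborel (\<lambda>\<xi>. ?f \<xi> * cnj (rep_l2 U \<xi>))"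
    by (rule L2_mult_integrable[OF f]) (simp add: L2_cnj)
  then show "integrable lborel (\<lambda>\<xi>. m \<xi> * (cmod (rep_l2 U \<xi>))\<^sup>2)"
    unfolding eq complex_of_real_integrable_eq .
  have "inner (mult_l2 (\<lambda>\<xi>. complex_of_real (m \<xi>)) U) U = inner (abs_l2 ?f) (abs_l2 (rep_l2 U))"
    by (simp add: mult_l2_def)
  also have "\<dots> = Re (LINT \<xi>|lborel. ?f \<xi> * cnj (rep_l2 U \<xi>))"
    by (rule inner_abs_l2[OF f]) simp
  also have "\<dots> = (LINT \<xi>|lborel. m \<xi> * (cmod (rep_l2 U \<xi>))\<^sup>2)"
    unfolding eq integral_complex_of_real by simp
  finally show "inner (mult_l2 (\<lambda>\<xi>. complex_of_real (m \<xi>)) U) U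
    = (LINT \<xi>|lborel. m \<xi> * (cmod (rep_l2 U \<xi>))\<^sup>2)" .
qed

lemma energy_coercive:
  assumes s: "s \<ge> 1" and \<nu>: "\<nu> < 1/6"
  shows "min 1 (1/6 - \<nu>) * (energy_norm s U)\<^sup>2 \<le> energy \<nu> s U U"
proof -
  define c where "c = min 1 (1/6 - \<nu>)"
  have c: "c \<ge> 0" "c \<le> 1" "c \<le> 1/6 - \<nu>" using \<nu> by (auto simp: c_def)
  let ?w = "\<lambda>\<xi>. complex_of_real (weight (1 - s) \<xi>)"
  have w: "bounded_symbol ?w" using s by (intro bounded_symbol_weight) simp
  have w2: "bounded_symbol (\<lambda>\<xi>. complex_of_real ((weight (1 - s) \<xi>)\<^sup>2))"
    using bounded_symbol_mult[OF w w] by (simp add: power2_eq_square)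
  note e = bounded_symbol_energy[OF s \<nu>]
  have "(energy_norm s U)\<^sup>2 = inner (mult_l2 ?w U) (mult_l2 ?w U)"
    by (simp add: energy_norm_def power2_norm_eq_inner)
  also have "\<dots> = inner (mult_l2 (\<lambda>\<xi>. complex_of_real ((weight (1 - s) \<xi>)\<^sup>2)) U) U"
    using inner_mult_l2[OF w, of U "mult_l2 ?w U"]
    by (simp add: mult_mult_l2 w inner_commute power2_eq_square)
  also have "\<dots> = (LINT \<xi>|lborel. (weight (1 - s) \<xi>)\<^sup>2 * (cmod (rep_l2 U \<xi>))\<^sup>2)"
    by (rule inner_mult_l2_real(2)[OF w2])
  finally have "c * (energy_norm s U)\<^sup>2
      = (LINT \<xi>|lborel. c * ((weight (1 - s) \<xi>)\<^sup>2 * (cmod (rep_l2 U \<xi>))\<^sup>2))" by simp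
  also have "\<dots> \<le> (LINT \<xi>|lborel. energy_symbol \<nu> s \<xi> * (cmod (rep_l2 U \<xi>))\<^sup>2)"
  proof (rule integral_mono)
    show "integrable lborel (\<lambda>\<xi>. c * ((weight (1 - s) \<xi>)\<^sup>2 * (cmod (rep_l2 U \<xi>))\<^sup>2))"
      by (intro integrable_mult_right inner_mult_l2_real(1)[OF w2])
    show "integrable lborel (\<lambda>\<xi>. energy_symbol \<nu> s \<xi> * (cmod (rep_l2 U \<xi>))\<^sup>2)"
      by (rule inner_mult_l2_real(1)[OF e])
    fix \<xi> :: real
    have "c * (1 + \<xi>\<^sup>2) \<le> 1 + (1/6 - \<nu>) * \<xi>\<^sup>2"
      using c mult_right_mono[OF c(3), of "\<xi>\<^sup>2"] by (simp add: distrib_left)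
    then have "c * (1 + \<xi>\<^sup>2) * weight (- (2 * s)) \<xi> \<le> energy_symbol \<nu> s \<xi>"
      unfolding energy_symbol_def by (rule mult_right_mono) simp
    then have "c * (weight (1 - s) \<xi>)\<^sup>2 \<le> energy_symbol \<nu> s \<xi>"
      by (simp add: mult_ac flip: weight_double_minus)
    then show "c * ((weight (1 - s) \<xi>)\<^sup>2 * (cmod (rep_l2 U \<xi>))\<^sup>2)
        \<le> energy_symbol \<nu> s \<xi> * (cmod (rep_l2 U \<xi>))\<^sup>2"
      using mult_right_mono[of _ _ "(cmod (rep_l2 U \<xi>))\<^sup>2"] by (simp flip: mult.assoc)
  qed
  also have "\<dots> = energy \<nu> s U U"
    unfolding energy_def by (rule inner_mult_l2_real(2)[OF e, symmetric])
  finally show ?thesis by (simp add: c_def)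
qed

text \<open>This is \<open>\<integral> u\<^sup>2 u\<^sub>x = 0\<close> in terms of transforms. The product \<open>a \<xi> * a \<eta> * a (- \<xi> - \<eta>)\<close> is symmetric in
  three frequencies with sum zero, so the integrals with the factors \<open>\<xi>\<close>, \<open>\<eta>\<close> and \<open>- \<xi> - \<eta>\<close> are
  equal, and they add up to zero.\<close>

lemma trilinear_cancellation:
  assumes a: "a \<in> L2" "integrable lborel a" and b: "(\<lambda>\<xi>. complex_of_real \<xi> * a \<xi>) \<in> L2"
  shows "(LINT \<xi>|lborel. complex_of_real \<xi> * a \<xi> * conv a a (- \<xi>)) = 0"
proof -
  note [measurable] = L2_measurable[OF a(1)] L2_measurable[OF b]
  define b where "b \<xi> = complex_of_real \<xi> * a \<xi>" for \<xi>
  have b_L2: "b \<in> L2" using b by (simp add: b_def[abs_def])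
  note [measurable] = L2_measurable[OF b_L2]
  let ?I = "LINT \<xi>|lborel. b \<xi> * conv a a (- \<xi>)"
  have int: "integrable lborel (\<lambda>\<xi>. a \<eta> * (f \<xi> * a (- \<eta> - \<xi>)))" if "f \<in> L2" for f \<eta>
    by (intro integrable_mult_right integrable_conv_kernel that a)
  have bound: "(LINT \<xi>|lborel. cmod (b \<xi> * a (- \<eta> - \<xi>))) \<le> norm (abs_l2 b) * norm (abs_l2 a)" for \<eta>
  proof -
    have "norm (abs_l2 (\<lambda>\<xi>. a (- \<eta> - \<xi>))) = norm (abs_l2 a)"
      using lborel_integral_real_affine[of "-1" "\<lambda>x. (cmod (a x))\<^sup>2" "- \<eta>"]
      by (simp add: norm_abs_l2 a L2_reflect)
    then show ?thesis using L2_L1_le[OF b_L2 L2_reflect[OF a(1)], of "- \<eta>"] by simp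
  qed
  have "integrable (lborel \<Otimes>\<^sub>M lborel) (\<lambda>(\<eta>, \<xi>). a \<eta> * (b \<xi> * a (- \<eta> - \<xi>)))"
  proof (rule lborel_pair.Fubini_integrable)
    show "(\<lambda>(\<eta>, \<xi>). a \<eta> * (b \<xi> * a (- \<eta> - \<xi>))) \<in> borel_measurable (lborel \<Otimes>\<^sub>M lborel)"
      by measurable
    show "AE \<eta> in lborel. integrable lborel (\<lambda>\<xi>. case (\<eta>, \<xi>) of (\<eta>, \<xi>) \<Rightarrow> a \<eta> * (b \<xi> * a (- \<eta> - \<xi>)))"
      using int[OF b_L2] by simp
    show "integrable lborel (\<lambda>\<eta>. LINT \<xi>|lborel. norm (case (\<eta>, \<xi>) of (\<eta>, \<xi>) \<Rightarrow> a \<eta> * (b \<xi> * a (- \<eta> - \<xi>))))"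
    proof (rule Bochner_Integration.integrable_bound)
      show "integrable lborel (\<lambda>\<eta>. norm (abs_l2 b) * norm (abs_l2 a) * cmod (a \<eta>))"
        using a by simp
      show "(\<lambda>\<eta>. LINT \<xi>|lborel. norm (case (\<eta>, \<xi>) of (\<eta>, \<xi>) \<Rightarrow> a \<eta> * (b \<xi> * a (- \<eta> - \<xi>))))
          \<in> borel_measurable lborel" by measurable
      have "cmod (a \<eta>) * (LINT \<xi>|lborel. cmod (b \<xi> * a (- \<eta> - \<xi>)))
          \<le> norm (abs_l2 b) * norm (abs_l2 a) * cmod (a \<eta>)" for \<eta>
        using mult_left_mono[OF bound[of \<eta>], of "cmod (a \<eta>)"] by (simp add: mult_ac)
      then show "AE \<eta> in lborel. norm (LINT \<xi>|lborel. norm (case (\<eta>, \<xi>) of (\<eta>, \<xi>) \<Rightarrow> a \<eta> * (b \<xi> * a (- \<eta> - \<xi>))))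
          \<le> norm (norm (abs_l2 b) * norm (abs_l2 a) * cmod (a \<eta>))"
        by (simp add: norm_mult abs_mult integral_nonneg)
    qed
  qed
  then have swap: "(LINT \<xi>|lborel. LINT \<eta>|lborel. a \<eta> * (b \<xi> * a (- \<eta> - \<xi>)))
      = (LINT \<eta>|lborel. LINT \<xi>|lborel. a \<eta> * (b \<xi> * a (- \<eta> - \<xi>)))"
    by (rule lborel_pair.Fubini_integral)
  have I1: "?I = (LINT \<xi>|lborel. LINT \<eta>|lborel. a \<eta> * (b \<xi> * a (- \<eta> - \<xi>)))"
  proof (rule Bochner_Integration.integral_cong[OF refl])
    fix \<xi>
    have "(LINT \<eta>|lborel. a \<eta> * (b \<xi> * a (- \<eta> - \<xi>))) = (LINT \<eta>|lborel. b \<xi> * (a \<eta> * a (- \<xi> - \<eta>)))"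
      by (intro Bochner_Integration.integral_cong)
        (simp_all only: minus_diff_commute[of \<xi>] mult.left_commute[of "b \<xi>"])
    then show "b \<xi> * conv a a (- \<xi>) = (LINT \<eta>|lborel. a \<eta> * (b \<xi> * a (- \<eta> - \<xi>)))"
      by (simp add: conv_def)
  qed
  \<comment> \<open>For fixed \<open>\<eta>\<close> the substitution \<open>\<xi> \<rightarrow> - \<eta> - \<xi>\<close> exchanges two of the frequencies.\<close>
  have eta: "(LINT \<xi>|lborel. a \<eta> * (b \<xi> * a (- \<eta> - \<xi>))) * 2 = - (b \<eta> * conv a a (- \<eta>))" for \<eta>
  proof -
    have "(LINT \<xi>|lborel. a \<eta> * (b \<xi> * a (- \<eta> - \<xi>)))
        = (LINT \<xi>|lborel. a \<eta> * (b (- \<eta> - \<xi>) * a \<xi>))"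
      using lborel_integral_real_affine[of "-1" "\<lambda>\<xi>. a \<eta> * (b \<xi> * a (- \<eta> - \<xi>))" "- \<eta>"] by simp
    also have "\<dots> = (LINT \<xi>|lborel. - (b \<eta> * (a \<xi> * a (- \<eta> - \<xi>))) - a \<eta> * (b \<xi> * a (- \<eta> - \<xi>)))"
      by (intro Bochner_Integration.integral_cong) (simp_all add: b_def algebra_simps)
    also have "\<dots> = - (b \<eta> * conv a a (- \<eta>)) - (LINT \<xi>|lborel. a \<eta> * (b \<xi> * a (- \<eta> - \<xi>)))"
      using int[OF b_L2, of \<eta>] integrable_conv_kernel[OF a(1) a(1), of "- \<eta>"]
      by (simp add: conv_def)
    finally show ?thesis by algebra
  qed
  have "?I * 2 = (LINT \<eta>|lborel. (LINT \<xi>|lborel. a \<eta> * (b \<xi> * a (- \<eta> - \<xi>))) * 2)"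
    by (simp only: I1 swap integral_mult_left_zero)
  also have "\<dots> = - ?I" by (simp only: eta integral_minus)
  finally have "?I = 0" by (simp add: eq_neg_iff_add_eq_0)
  then show ?thesis by (simp add: b_def)
qed

text \<open>The factor \<open>1 + (1/6 - \<nu>) \<xi>\<^sup>2\<close> of the energy is the denominator of \<open>\<psi>\<close>. What is left of \<open>\<psi>\<close> is a
  multiple of \<open>\<xi>\<close>, and for a real function the trilinear cancellation applies.\<close>

lemma energy_nonlinearity:
  assumes s: "s \<ge> 1" and \<nu>: "\<nu> < 1/6" and real: "reflect_cnj U = U"
  shows "energy \<nu> s U (nonlinearity \<nu> s U U) = 0"
proof -
  let ?a = "hat s U"
  let ?f = "\<lambda>\<xi>. complex_of_real (energy_symbol \<nu> s \<xi>) * rep_l2 U \<xi>"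
  let ?g = "\<lambda>\<xi>. nonlinear_symbol \<nu> s \<xi> * conv ?a ?a \<xi>"
  have a: "?a \<in> L2" "integrable lborel ?a"
    using s by (simp_all add: hat_L2 integrable_hat)
  have f: "?f \<in> L2" by (rule bounded_symbol_L2[OF bounded_symbol_energy[OF s \<nu>]]) simp
  have b: "(\<lambda>\<xi>. complex_of_real \<xi> * ?a \<xi>) \<in> L2"
  proof (rule L2_dominated[OF rep_l2_L2[of U]])
    fix \<xi> :: real
    have "\<bar>\<xi>\<bar> \<le> weight 1 \<xi>"
      by (rule power2_le_imp_le) (simp_all add: weight_square weight_2)
    then have "\<bar>\<xi>\<bar> * weight (- s) \<xi> \<le> weight 1 \<xi> * weight (- s) \<xi>" by (rule mult_right_mono) simp
    also have "\<dots> \<le> 1" using s by (simp add: weight_mult weight_le_1)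
    finally have "\<bar>\<xi>\<bar> * weight (- s) \<xi> * cmod (rep_l2 U \<xi>) \<le> 1 * cmod (rep_l2 U \<xi>)"
      by (rule mult_right_mono) simp
    then show "cmod (complex_of_real \<xi> * ?a \<xi>) \<le> cmod (rep_l2 U \<xi>)"
      by (simp add: hat_def norm_mult mult.assoc)
  qed measurable
  have "?f \<xi> * cnj (?g \<xi>) = \<i> * complex_of_real (3 / 4 / sqrt (2 * pi)) * (complex_of_real \<xi> * ?a \<xi> * conv ?a ?a (- \<xi>))" for \<xi>
  proof -
    have cnj_conv: "cnj (conv ?a ?a \<xi>) = conv ?a ?a (- \<xi>)"
      using conv_hat_reflect_cnj[of s U U "- \<xi>"] by (simp add: real)
    have psi: "(1 + (1/6 - \<nu>) * \<xi>\<^sup>2) * kdv_bbm_psi \<nu> \<xi> = 3 / 4 * \<xi>"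
    proof -
      have "(1/6 - \<nu>) * \<xi>\<^sup>2 + 1 > 0" using \<nu> by (simp add: add_nonneg_pos)
      then show ?thesis by (simp add: kdv_bbm_psi_def divide_simps)
    qed
    have "energy_symbol \<nu> s \<xi> * (kdv_bbm_psi \<nu> \<xi> * weight s \<xi> / sqrt (2 * pi))
        = ((1 + (1/6 - \<nu>) * \<xi>\<^sup>2) * kdv_bbm_psi \<nu> \<xi>) * (weight (- (2 * s)) \<xi> * weight s \<xi>) / sqrt (2 * pi)"
      by (simp add: energy_symbol_def mult_ac)
    also have "\<dots> = 3 / 4 * \<xi> * weight (- s) \<xi> / sqrt (2 * pi)"
      unfolding psi by (simp add: weight_mult)
    finally have symbol: "energy_symbol \<nu> s \<xi> * (kdv_bbm_psi \<nu> \<xi> * weight s \<xi> / sqrt (2 * pi))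
        = 3 / 4 / sqrt (2 * pi) * (\<xi> * weight (- s) \<xi>)" by simp
    let ?P = "complex_of_real (kdv_bbm_psi \<nu> \<xi> * weight s \<xi> / sqrt (2 * pi))"
    have "cnj (nonlinear_symbol \<nu> s \<xi>) = \<i> * ?P" by (simp add: nonlinear_symbol_def)
    then have "?f \<xi> * cnj (?g \<xi>)
        = \<i> * (complex_of_real (energy_symbol \<nu> s \<xi>) * ?P) * (rep_l2 U \<xi> * conv ?a ?a (- \<xi>))"
      by (simp only: complex_cnj_mult cnj_conv mult_ac)
    also have "complex_of_real (energy_symbol \<nu> s \<xi>) * ?P
        = complex_of_real (3 / 4 / sqrt (2 * pi)) * (complex_of_real \<xi> * complex_of_real (weight (- s) \<xi>))"
      by (simp only: of_real_mult[symmetric] symbol)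
    finally show ?thesis by (simp only: hat_def[of s U \<xi>] mult_ac)
  qed
  then have "(LINT \<xi>|lborel. ?f \<xi> * cnj (?g \<xi>)) = 0"
    by (simp only: integral_mult_right_zero trilinear_cancellation[OF a b] mult_zero_right)
  moreover have "energy \<nu> s U (nonlinearity \<nu> s U U) = inner (abs_l2 ?f) (abs_l2 ?g)"
    by (simp only: energy_def nonlinearity_def mult_l2_def)
  ultimately show ?thesis
    by (simp only: inner_abs_l2[OF f nonlinear_L2[OF s \<nu>]] zero_complex.sel)
qed


section \<open>Quadratic evolution equations with a conserved energy\<close>

lemma gronwall:
  fixes f :: "real \<Rightarrow> real"
  assumes f: "continuous_on {0..T} f" and b: "b \<ge> 0"
    and le: "\<And>t. t \<in> {0..T} \<Longrightarrow> f t \<le> a + b * integral {0..t} f"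
    and t: "t \<in> {0..T}"
  shows "f t \<le> a * exp (b * t)"
proof -
  define G where "G r = a + b * integral {0..r} f" for r
  define h where "h r = exp (- b * r) * G r" for r
  have h': "(h has_real_derivative exp (- b * r) * (b * f r) - b * exp (- b * r) * G r) (at r within {0..T})"
    if "r \<in> {0..T}" for r
  proof -
    have "((\<lambda>r. integral {0..r} f) has_real_derivative f r) (at r within {0..T})"
      using integral_has_vector_derivative[OF f that]
      by (simp add: has_real_derivative_iff_has_vector_derivative)
    then have "(G has_real_derivative b * f r) (at r within {0..T})"
      unfolding G_def by (auto intro!: derivative_eq_intros)
    then show ?thesis
      unfolding h_def by (auto intro!: derivative_eq_intros)
  qed
  have "h t \<le> h 0"
  proof (rule DERIV_nonpos_imp_decreasing_open[of 0 t h])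
    show "0 \<le> t" using t by simp
    show "continuous_on {0..t} h"
      using h' t by (intro continuous_on_subset[OF DERIV_continuous_on[of "{0..T}"]]) auto
    fix r assume r: "0 < r" "r < t"
    have "f r \<le> G r" unfolding G_def by (rule le) (use r t in auto)
    then have "exp (- b * r) * (b * f r) - b * exp (- b * r) * G r \<le> 0"
      using mult_left_mono[of "f r" "G r" "b * exp (- b * r)"] b by (simp add: mult_ac)
    moreover have "(h has_real_derivative exp (- b * r) * (b * f r) - b * exp (- b * r) * G r) (at r)"
      using h'[of r] r t at_within_Icc_at[of 0 r T] by simp
    ultimately show "\<exists>y. (h has_real_derivative y) (at r) \<and> y \<le> 0" by blast
  qed
  then have "exp (- b * t) * G t \<le> a" by (simp add: h_def G_def)
  then have "G t \<le> a * exp (b * t)" by (simp add: exp_minus field_simps)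
  moreover have "f t \<le> G t" unfolding G_def by (rule le[OF t])
  ultimately show ?thesis by simp
qed

text \<open>The generator of the group may be unbounded; only strong continuity is assumed.\<close>

locale isometric_group =
  fixes E :: "real \<Rightarrow> 'a::banach \<Rightarrow> 'a"
  assumes bounded_linear_E: "bounded_linear (E t)"
    and norm_E: "norm (E t x) = norm x"
    and E_0: "E 0 x = x"
    and E_add: "E (r + t) x = E r (E t x)"
    and continuous_E: "continuous_on UNIV (\<lambda>t. E t x)"
begin

lemma E_diff: "E t (x - y) = E t x - E t y"
  by (rule linear_diff[OF bounded_linear.linear[OF bounded_linear_E]])

lemma E_cancel: "E (- t) (E t x) = x" "E t (E (- t) x) = x"
  by (simp_all add: E_0 flip: E_add)

lemma continuous_on_E:
  fixes S :: "real set"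
  assumes h: "continuous_on S h" and u: "continuous_on S u"
  shows "continuous_on S (\<lambda>t. E (h t) (u t))"
proof (rule continuous_on_sequentiallyI)
  fix r :: "nat \<Rightarrow> real" and t
  assume r: "\<forall>n. r n \<in> S" "t \<in> S" "r \<longlonglongrightarrow> t"
  have h_r: "(\<lambda>n. h (r n)) \<longlonglongrightarrow> h t" and u_r: "(\<lambda>n. u (r n)) \<longlonglongrightarrow> u t"
    using h u r by (auto simp: continuous_on_sequentially o_def)
  have "(\<lambda>n. E (h (r n)) (u (r n) - u t)) \<longlonglongrightarrow> 0"
    by (rule tendsto_norm_zero_cancel) (simp add: norm_E tendsto_norm_zero LIM_zero u_r)
  moreover have "(\<lambda>n. E (h (r n)) (u t)) \<longlonglongrightarrow> E (h t) (u t)"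
    by (rule continuous_on_tendsto_compose[OF continuous_E h_r]) auto
  ultimately have "(\<lambda>n. E (h (r n)) (u (r n) - u t) + E (h (r n)) (u t)) \<longlonglongrightarrow> 0 + E (h t) (u t)"
    by (rule tendsto_add)
  then show "(\<lambda>n. E (h (r n)) (u (r n))) \<longlonglongrightarrow> E (h t) (u t)"
    by (simp add: E_diff)
qed

definition mild :: "('a \<Rightarrow> 'a) \<Rightarrow> real \<Rightarrow> 'a \<Rightarrow> (real \<Rightarrow> 'a) \<Rightarrow> bool" where
  "mild F T x u \<longleftrightarrow> continuous_on {0..T} u \<and>
    (\<forall>t\<in>{0..T}. ((\<lambda>\<tau>. E (t - \<tau>) (F (u \<tau>))) has_integral (u t - E t x)) {0..t})"

text \<open>In the variable \<open>E (- t) (u t)\<close> the linear part disappears from the integral equation. For a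
  continuous nonlinearity the new variable is differentiable although \<open>u\<close> itself need not be, and
  energies that are invariant under the group can be differentiated along it.\<close>

lemma mild_interaction:
  "mild F T x u \<longleftrightarrow> continuous_on {0..T} u \<and>
    (\<forall>t\<in>{0..T}. ((\<lambda>\<tau>. E (- \<tau>) (F (u \<tau>))) has_integral (E (- t) (u t) - x)) {0..t})"
proof -
  have "((\<lambda>\<tau>. E (t - \<tau>) (F (u \<tau>))) has_integral (u t - E t x)) {0..t}
      \<longleftrightarrow> ((\<lambda>\<tau>. E (- \<tau>) (F (u \<tau>))) has_integral (E (- t) (u t) - x)) {0..t}" (is "?A \<longleftrightarrow> ?B") for t
  proof
    assume ?A
    from has_integral_linear[OF this bounded_linear_E[of "- t"]] show ?B
      by (simp add: o_def E_diff E_0 flip: E_add)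
  next
    assume ?B
    from has_integral_linear[OF this bounded_linear_E[of t]] show ?A
      by (simp add: o_def E_diff E_0 flip: E_add)
  qed
  then show ?thesis by (simp add: mild_def)
qed

lemma mild_continuous: "mild F T x u \<Longrightarrow> continuous_on {0..T} u"
  by (simp add: mild_def)

lemma mild_initial: "mild F T x u \<Longrightarrow> T \<ge> 0 \<Longrightarrow> u 0 = x"
proof -
  assume "mild F T x u" "T \<ge> 0"
  then have "((\<lambda>\<tau>. E (0 - \<tau>) (F (u \<tau>))) has_integral (u 0 - E 0 x)) {0..0}"
    unfolding mild_def by (elim conjE) (erule bspec, simp)
  then have "u 0 - E 0 x = 0"
    by (simp only: atLeastAtMost_singleton) (rule has_integral_unique[OF _ has_integral_refl(2)])
  then show "u 0 = x" by (simp add: E_0)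
qed

lemma continuous_interaction:
  assumes "continuous_on UNIV F" "continuous_on {0..T} u"
  shows "continuous_on {0..T} (\<lambda>\<tau>. E (- \<tau>) (F (u \<tau>)))"
  by (intro continuous_on_E continuous_intros continuous_on_compose2[OF assms(1) assms(2)]) simp

lemma mild_integral:
  assumes "mild F T x u" "t \<in> {0..T}"
  shows "E (- t) (u t) = x + integral {0..t} (\<lambda>\<tau>. E (- \<tau>) (F (u \<tau>)))"
  using assms by (auto simp: mild_interaction dest!: bspec[of _ _ t] integral_unique)

lemma mild_has_vector_derivative:
  assumes F: "continuous_on UNIV F" and u: "mild F T x u" and t: "t \<in> {0..T}"
  shows "((\<lambda>r. E (- r) (u r)) has_vector_derivative E (- t) (F (u t))) (at t within {0..T})"
proof -
  have "((\<lambda>r. integral {0..r} (\<lambda>\<tau>. E (- \<tau>) (F (u \<tau>)))) has_vector_derivative E (- t) (F (u t)))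
      (at t within {0..T})"
    by (rule integral_has_vector_derivative[OF continuous_interaction[OF F mild_continuous[OF u]] t])
  then have "((\<lambda>r. x + integral {0..r} (\<lambda>\<tau>. E (- \<tau>) (F (u \<tau>)))) has_vector_derivative E (- t) (F (u t)))
      (at t within {0..T})"
    by (auto intro!: derivative_eq_intros)
  then show ?thesis
    by (rule has_vector_derivative_transform[OF t, rotated]) (simp add: mild_integral[OF u])
qed

lemma mild_difference:
  assumes F: "continuous_on UNIV F" and u: "mild F T x u" and v: "mild F T y v"
    and L: "L \<ge> 0" "\<And>t. t \<in> {0..T} \<Longrightarrow> norm (F (u t) - F (v t)) \<le> L * norm (u t - v t)"
    and t: "t \<in> {0..T}"
  shows "norm (u t - v t) \<le> norm (x - y) * exp (L * t)"
proof -
  note cu = mild_continuous[OF u] and cv = mild_continuous[OF v]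
  have cont: "continuous_on {0..T} (\<lambda>t. norm (u t - v t))" by (intro continuous_intros cu cv)
  show ?thesis
  proof (rule gronwall[OF cont L(1) _ t])
    fix t assume t: "t \<in> {0..T}"
    then have sub: "{0..t} \<subseteq> {0..T}" by auto
    have iu: "(\<lambda>\<tau>. E (- \<tau>) (F (u \<tau>))) integrable_on {0..t}"
      and iv: "(\<lambda>\<tau>. E (- \<tau>) (F (v \<tau>))) integrable_on {0..t}"
      by (intro integrable_continuous_real continuous_on_subset[OF continuous_interaction sub] F cu cv)+
    have iuv: "(\<lambda>\<tau>. L * norm (u \<tau> - v \<tau>)) integrable_on {0..t}"
      by (intro integrable_continuous_real continuous_on_subset[OF _ sub] continuous_intros cu cv)
    have "norm (u t - v t) = norm (E (- t) (u t) - E (- t) (v t))"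
      by (simp add: norm_E flip: E_diff)
    also have "\<dots> = norm ((x - y) + integral {0..t} (\<lambda>\<tau>. E (- \<tau>) (F (u \<tau>)) - E (- \<tau>) (F (v \<tau>))))"
      using iu iv t by (simp add: mild_integral[OF u] mild_integral[OF v] integral_diff add_diff_add)
    also have "\<dots> \<le> norm (x - y)
        + norm (integral {0..t} (\<lambda>\<tau>. E (- \<tau>) (F (u \<tau>)) - E (- \<tau>) (F (v \<tau>))))"
      by (rule norm_triangle_ineq)
    also have "norm (integral {0..t} (\<lambda>\<tau>. E (- \<tau>) (F (u \<tau>)) - E (- \<tau>) (F (v \<tau>))))
        \<le> integral {0..t} (\<lambda>\<tau>. L * norm (u \<tau> - v \<tau>))"
    proof (rule integral_norm_bound_integral[OF integrable_diff[OF iu iv] iuv])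
      fix \<tau> assume "\<tau> \<in> {0..t}"
      then show "norm (E (- \<tau>) (F (u \<tau>)) - E (- \<tau>) (F (v \<tau>))) \<le> L * norm (u \<tau> - v \<tau>)"
        using L(2)[of \<tau>] sub by (auto simp: norm_E simp flip: E_diff)
    qed
    finally show "norm (u t - v t) \<le> norm (x - y) + L * integral {0..t} (\<lambda>\<tau>. norm (u \<tau> - v \<tau>))"
      by simp
  qed
qed

text \<open>The Picard map is a contraction on the whole interval, with factor one half, for the supremum norm
  of \<open>exp (- 2 L t) *\<^sub>R z t\<close>, where \<open>z\<close> is the solution in the interaction variable. The map \<open>cl\<close> freezes
  the curves outside the interval, so that the complete space of bounded continuous functions on the
  line can be used.\<close>

lemma mild_exists_Lipschitz:
  assumes F: "\<And>x y. norm (F x - F y) \<le> L * norm (x - y)" and L: "L > 0" and T: "T \<ge> 0"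
  shows "\<exists>u. mild F T x u"
proof -
  have contF: "continuous_on UNIV F"
  proof (rule lipschitz_on_continuous_on)
    show "L-lipschitz_on UNIV F" using F L by (intro lipschitz_onI) (auto simp: dist_norm)
  qed
  define g where "g w \<tau> = E (- \<tau>) (F (E \<tau> (exp (2 * L * \<tau>) *\<^sub>R w \<tau>)))" for w and \<tau> :: real
  define \<psi> where "\<psi> w t = exp (- (2 * L * t)) *\<^sub>R (x + integral {0..t} (g w))" for w t
  define cl where "cl t = max 0 (min T t)" for t :: real
  have cl: "cl t \<in> {0..T}" for t using T by (auto simp: cl_def)
  have cl_id: "cl t = t" if "t \<in> {0..T}" for t using that by (auto simp: cl_def)
  have g_cont: "continuous_on {0..T} (g w)" if "continuous_on {0..T} w" for w
    unfolding g_def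
    by (intro continuous_on_E continuous_on_compose2[OF contF] continuous_intros that) simp
  have \<psi>_cont: "continuous_on {0..T} (\<psi> w)" if "continuous_on {0..T} w" for w
    unfolding \<psi>_def
    by (intro continuous_intros indefinite_integral_continuous_1 integrable_continuous_real g_cont that)
  have mem: "(\<lambda>t. \<psi> (apply_bcontfun w) (cl t)) \<in> bcontfun" for w
  proof -
    have c: "continuous_on {0..T} (\<psi> (apply_bcontfun w))" by (rule \<psi>_cont) simp
    have "continuous_on UNIV (\<lambda>t. \<psi> (apply_bcontfun w) (cl t))"
      unfolding cl_def
      by (rule continuous_on_compose2[OF c]) (use T in \<open>auto intro!: continuous_intros\<close>)
    moreover have "bounded (\<psi> (apply_bcontfun w) ` {0..T})"
      by (intro compact_imp_bounded compact_continuous_image c) simp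
    then have "bounded (range (\<lambda>t. \<psi> (apply_bcontfun w) (cl t)))"
      by (rule bounded_subset) (use cl in auto)
    ultimately show ?thesis by (simp add: bcontfun_def)
  qed
  define \<Phi> where "\<Phi> w = Bcontfun (\<lambda>t. \<psi> (apply_bcontfun w) (cl t))" for w :: "real \<Rightarrow>\<^sub>C 'a"
  have \<Phi>: "apply_bcontfun (\<Phi> w) t = \<psi> (apply_bcontfun w) (cl t)" for w t
    by (simp add: \<Phi>_def Bcontfun_inverse mem)
  have "dist (\<Phi> w) (\<Phi> v) \<le> 1/2 * dist w v" for w v
  proof (rule dist_bound)
    fix t0
    define t where "t = cl t0"
    have t: "t \<in> {0..T}" "{0..t} \<subseteq> {0..T}" using cl[of t0] by (auto simp: t_def)
    have iw: "g (apply_bcontfun w) integrable_on {0..t}" for w :: "real \<Rightarrow>\<^sub>C 'a"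
      by (intro integrable_continuous_real continuous_on_subset[OF g_cont t(2)]) simp
    have expint: "((\<lambda>\<tau>. L * dist w v * exp (2 * L * \<tau>)) has_integral
        (dist w v / 2 * exp (2 * L * t) - dist w v / 2 * exp (2 * L * 0))) {0..t}"
    proof (rule fundamental_theorem_of_calculus)
      show "0 \<le> t" using t by simp
      show "((\<lambda>\<tau>. dist w v / 2 * exp (2 * L * \<tau>)) has_vector_derivative L * dist w v * exp (2 * L * \<tau>))
          (at \<tau> within {0..t})" for \<tau>
        by (auto intro!: derivative_eq_intros simp flip: has_real_derivative_iff_has_vector_derivative)
    qed
    have "norm (integral {0..t} (\<lambda>\<tau>. g (apply_bcontfun w) \<tau> - g (apply_bcontfun v) \<tau>))
        \<le> integral {0..t} (\<lambda>\<tau>. L * dist w v * exp (2 * L * \<tau>))"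
    proof (rule integral_norm_bound_integral[OF integrable_diff[OF iw iw] has_integral_integrable[OF expint]])
      fix \<tau>
      have "norm (g (apply_bcontfun w) \<tau> - g (apply_bcontfun v) \<tau>)
          = norm (F (E \<tau> (exp (2 * L * \<tau>) *\<^sub>R w \<tau>)) - F (E \<tau> (exp (2 * L * \<tau>) *\<^sub>R v \<tau>)))"
        by (simp add: g_def norm_E flip: E_diff)
      also have "\<dots> \<le> L * norm (E \<tau> (exp (2 * L * \<tau>) *\<^sub>R w \<tau>) - E \<tau> (exp (2 * L * \<tau>) *\<^sub>R v \<tau>))"
        by (rule F)
      also have "\<dots> = L * (exp (2 * L * \<tau>) * dist (w \<tau>) (v \<tau>))"
        by (simp add: norm_E dist_norm flip: E_diff scaleR_diff_right)
      also have "\<dots> \<le> L * (exp (2 * L * \<tau>) * dist w v)"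
        using L by (intro mult_left_mono dist_bounded) auto
      finally show "norm (g (apply_bcontfun w) \<tau> - g (apply_bcontfun v) \<tau>) \<le> L * dist w v * exp (2 * L * \<tau>)"
        by (simp add: mult_ac)
    qed
    also have "\<dots> = dist w v / 2 * exp (2 * L * t) - dist w v / 2"
      using integral_unique[OF expint] by simp
    also have "\<dots> \<le> dist w v / 2 * exp (2 * L * t)" by simp
    finally have le: "norm (integral {0..t} (\<lambda>\<tau>. g (apply_bcontfun w) \<tau> - g (apply_bcontfun v) \<tau>))
        \<le> dist w v / 2 * exp (2 * L * t)" .
    have "dist (\<Phi> w t0) (\<Phi> v t0) = norm (exp (- (2 * L * t)) *\<^sub>R
        (integral {0..t} (g (apply_bcontfun w)) - integral {0..t} (g (apply_bcontfun v))))"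
      unfolding \<Phi> t_def[symmetric] by (simp add: \<psi>_def dist_norm flip: scaleR_diff_right)
    also have "\<dots> = exp (- (2 * L * t))
        * norm (integral {0..t} (\<lambda>\<tau>. g (apply_bcontfun w) \<tau> - g (apply_bcontfun v) \<tau>))"
      by (simp add: integral_diff[OF iw iw])
    also have "\<dots> \<le> exp (- (2 * L * t)) * (dist w v / 2 * exp (2 * L * t))"
      by (intro mult_left_mono le) simp
    also have "\<dots> = 1/2 * dist w v" by (simp add: exp_minus)
    finally show "dist (\<Phi> w t0) (\<Phi> v t0) \<le> 1/2 * dist w v" .
  qed
  then obtain w where w: "\<Phi> w = w"
    using banach_fix_type[of "1/2" \<Phi>] by auto
  define u where "u t = E t (exp (2 * L * t) *\<^sub>R w t)" for t
  have g_u: "g (apply_bcontfun w) = (\<lambda>\<tau>. E (- \<tau>) (F (u \<tau>)))"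
    by (rule ext) (simp only: g_def u_def)
  have "E (- t) (u t) = x + integral {0..t} (\<lambda>\<tau>. E (- \<tau>) (F (u \<tau>)))" if "t \<in> {0..T}" for t
  proof -
    have "w t = \<psi> (apply_bcontfun w) t" using \<Phi>[of w t] cl_id[OF that] by (simp add: w)
    then have "exp (2 * L * t) *\<^sub>R w t = x + integral {0..t} (g (apply_bcontfun w))"
      by (simp add: \<psi>_def flip: exp_add)
    then show ?thesis by (simp only: g_u[symmetric]) (simp only: u_def E_cancel)
  qed
  moreover have "continuous_on {0..T} u"
    unfolding u_def by (intro continuous_on_E continuous_intros) simp
  moreover have "(\<lambda>\<tau>. E (- \<tau>) (F (u \<tau>))) integrable_on {0..t}" if "t \<in> {0..T}" for t
    by (rule integrable_continuous_real)
      (rule continuous_on_subset[OF continuous_interaction[OF contF \<open>continuous_on {0..T} u\<close>]], use that in auto)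
  ultimately have "mild F T x u"
    by (auto simp: mild_interaction dest: integrable_integral)
  then show ?thesis by blast
qed

end

text \<open>Composition with the radial retraction onto a ball makes a quadratic map globally Lipschitz. It
  changes the quadratic term only by a scalar factor between zero and one, so a conserved quadratic
  energy remains conserved and upper bounds of the term remain valid. The solution of the truncated
  equation therefore obeys the a priori bound of the original one.\<close>

definition radial_factor :: "real \<Rightarrow> 'a::real_normed_vector \<Rightarrow> real" where
  "radial_factor R x = R / max R (norm x)"

lemma radial_factor_bounds:
  assumes "R > 0" shows "0 \<le> radial_factor R x" "radial_factor R x \<le> 1"
  using assms by (auto simp: radial_factor_def divide_le_eq_1 less_max_iff_disj le_max_iff_disj)

lemma radial_factor_eq_1: "R > 0 \<Longrightarrow> norm x \<le> R \<Longrightarrow> radial_factor R x = 1"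
  by (simp add: radial_factor_def max_def)

lemma norm_radial_le:
  assumes "R > 0" shows "norm (radial_factor R x *\<^sub>R x) \<le> R"
proof -
  have "R * norm x \<le> R * max R (norm x)" using assms by (intro mult_left_mono) auto
  then show ?thesis
    using assms by (simp add: radial_factor_def divide_le_eq less_max_iff_disj)
qed

lemma radial_Lipschitz:
  assumes R: "R > 0"
  shows "norm (radial_factor R x *\<^sub>R x - radial_factor R y *\<^sub>R y) \<le> 2 * norm (x - y)"
proof -
  have half: "norm (radial_factor R x *\<^sub>R x - radial_factor R y *\<^sub>R y) \<le> 2 * norm (x - y)"
    if le: "norm y \<le> norm x" for x y :: 'a
  proof -
    let ?a = "max R (norm x)" and ?b = "max R (norm y)"
    have pos: "?a > 0" "?b > 0" using R by (auto simp: less_max_iff_disj)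
    have ab: "?a - ?b \<le> norm (x - y)" "?b \<le> ?a"
      using le norm_triangle_ineq2[of x y] by (auto simp: max_def)
    have "radial_factor R x *\<^sub>R x - radial_factor R y *\<^sub>R y
        = radial_factor R x *\<^sub>R (x - y) - (radial_factor R y - radial_factor R x) *\<^sub>R y"
      by (simp add: algebra_simps)
    then have "norm (radial_factor R x *\<^sub>R x - radial_factor R y *\<^sub>R y)
        \<le> radial_factor R x * norm (x - y) + \<bar>radial_factor R y - radial_factor R x\<bar> * norm y"
      using norm_triangle_ineq4[of "radial_factor R x *\<^sub>R (x - y)" "(radial_factor R y - radial_factor R x) *\<^sub>R y"]
        radial_factor_bounds(1)[OF R, of x] by simp
    also have "radial_factor R x * norm (x - y) \<le> 1 * norm (x - y)"
      by (intro mult_right_mono radial_factor_bounds R) simp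
    also have "\<bar>radial_factor R y - radial_factor R x\<bar> * norm y \<le> norm (x - y)"
    proof -
      have eq: "radial_factor R y - radial_factor R x = R * (?a - ?b) / (?a * ?b)"
        using pos by (simp add: radial_factor_def field_simps)
      have "\<bar>radial_factor R y - radial_factor R x\<bar> * norm y = (R / ?a) * (norm y / ?b) * (?a - ?b)"
        unfolding eq using pos ab R by (simp add: abs_mult abs_divide)
      also have "\<dots> \<le> 1 * 1 * (?a - ?b)"
        using pos ab R by (intro mult_right_mono mult_mono) auto
      finally show ?thesis using ab by simp
    qed
    finally show ?thesis by simp
  qed
  show ?thesis
  proof (cases "norm y \<le> norm x")
    case True then show ?thesis by (rule half)
  next
    case False then show ?thesis using half[of x y] by (simp add: norm_minus_commute)
  qed
qed

text \<open>The equation is \<open>u' = A u + B u u\<close>, where \<open>E\<close> is the group generated by \<open>A\<close>. The form \<open>Q\<close> is an energy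
  that is weaker than the norm; it is conserved for the fixed points of \<open>J\<close>, which are the real-valued
  functions in the application, and by \<open>B_tame\<close> it controls the growth rate of the norm.\<close>

locale quadratic_evolution = isometric_group E for E :: "real \<Rightarrow> 'a::banach \<Rightarrow> 'a" +
  fixes B :: "'a \<Rightarrow> 'a \<Rightarrow> 'a" and Q :: "'a \<Rightarrow> 'a \<Rightarrow> real" and J :: "'a \<Rightarrow> 'a" and K :: real
  assumes bounded_bilinear_B: "bounded_bilinear B"
    and bounded_bilinear_Q: "bounded_bilinear Q"
    and Q_commute: "Q x y = Q y x"
    and Q_nonneg: "0 \<le> Q x x"
    and Q_E: "Q (E t x) (E t y) = Q x y"
    and Q_B: "J x = x \<Longrightarrow> Q x (B x x) = 0"
    and bounded_linear_J: "bounded_linear J"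
    and J_E: "J (E t x) = E t (J x)"
    and J_B: "J (B x y) = B (J x) (J y)"
    and norm_J: "norm (J x) = norm x"
    and K_nonneg: "K \<ge> 0"
    and B_tame: "norm (B x x) \<le> K * sqrt (Q x x) * norm x"
begin

interpretation B: bounded_bilinear B by (rule bounded_bilinear_B)
interpretation Q: bounded_bilinear Q by (rule bounded_bilinear_Q)

text \<open>The scalar factor \<open>c\<close> covers the truncated equation as well as the original one.\<close>

lemma energy_conserved:
  assumes F: "continuous_on UNIV F" "\<And>x. F x = c x *\<^sub>R B x x"
    and u: "mild F T x u" and J: "\<And>t. t \<in> {0..T} \<Longrightarrow> J (u t) = u t"
    and t: "t \<in> {0..T}"
  shows "Q (u t) (u t) = Q x x"
proof -
  let ?z = "\<lambda>r. E (- r) (u r)"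
  have "((\<lambda>r. Q (?z r) (?z r)) has_vector_derivative 0) (at r within {0..T})" if r: "r \<in> {0..T}" for r
  proof -
    have "((\<lambda>r. Q (?z r) (?z r)) has_vector_derivative
        Q (?z r) (E (- r) (F (u r))) + Q (E (- r) (F (u r))) (?z r)) (at r within {0..T})"
      by (rule Q.has_vector_derivative) (rule mild_has_vector_derivative[OF F(1) u r])+
    also have "Q (?z r) (E (- r) (F (u r))) + Q (E (- r) (F (u r))) (?z r) = 0"
      using Q_B[OF J[OF r]] by (simp add: Q_E F(2) Q_commute[of "_ *\<^sub>R _"] Q.scaleR_right)
    finally show ?thesis .
  qed
  then obtain c where c: "\<And>r. r \<in> {0..T} \<Longrightarrow> Q (?z r) (?z r) = c"
    using has_vector_derivative_zero_constant[of "{0..T}" "\<lambda>r. Q (?z r) (?z r)"] by auto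
  have "Q (?z t) (?z t) = Q (?z 0) (?z 0)" using c[OF t] c[of 0] t by simp
  then show ?thesis using mild_initial[OF u] t by (simp add: Q_E E_0)
qed

lemma a_priori_bound:
  assumes F: "continuous_on UNIV F" "\<And>x. F x = c x *\<^sub>R B x x" "\<And>x. \<bar>c x\<bar> \<le> 1"
    and u: "mild F T x u" and J: "\<And>t. t \<in> {0..T} \<Longrightarrow> J (u t) = u t"
    and t: "t \<in> {0..T}"
  shows "norm (u t) \<le> norm x * exp (K * sqrt (Q x x) * t)"
proof -
  note cu = mild_continuous[OF u]
  have F_le: "norm (F (u r)) \<le> K * sqrt (Q x x) * norm (u r)" if "r \<in> {0..T}" for r
  proof -
    have "norm (F (u r)) = \<bar>c (u r)\<bar> * norm (B (u r) (u r))" by (simp add: F(2))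
    also have "\<dots> \<le> 1 * norm (B (u r) (u r))" by (intro mult_right_mono F(3)) simp
    also have "\<dots> \<le> K * sqrt (Q x x) * norm (u r)"
      using B_tame[of "u r"] energy_conserved[OF F(1,2) u J that] by simp
    finally show ?thesis .
  qed
  show ?thesis
  proof (rule gronwall[where f="\<lambda>t. norm (u t)", OF _ _ _ t])
    show "continuous_on {0..T} (\<lambda>t. norm (u t))" by (intro continuous_intros cu)
    show "0 \<le> K * sqrt (Q x x)" using Q_nonneg K_nonneg by simp
    fix t assume t: "t \<in> {0..T}"
    then have sub: "{0..t} \<subseteq> {0..T}" by auto
    have int: "(\<lambda>\<tau>. E (- \<tau>) (F (u \<tau>))) integrable_on {0..t}"
      by (intro integrable_continuous_real continuous_on_subset[OF continuous_interaction sub] F(1) cu)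
    have int': "(\<lambda>\<tau>. K * sqrt (Q x x) * norm (u \<tau>)) integrable_on {0..t}"
      by (intro integrable_continuous_real continuous_on_subset[OF _ sub] continuous_intros cu)
    have "norm (u t) = norm (x + integral {0..t} (\<lambda>\<tau>. E (- \<tau>) (F (u \<tau>))))"
      using mild_integral[OF u t] norm_E[of "- t" "u t"] by simp
    also have "\<dots> \<le> norm x + norm (integral {0..t} (\<lambda>\<tau>. E (- \<tau>) (F (u \<tau>))))"
      by (rule norm_triangle_ineq)
    also have "norm (integral {0..t} (\<lambda>\<tau>. E (- \<tau>) (F (u \<tau>))))
        \<le> integral {0..t} (\<lambda>\<tau>. K * sqrt (Q x x) * norm (u \<tau>))"
      by (rule integral_norm_bound_integral[OF int int']) (use F_le sub in \<open>auto simp: norm_E\<close>)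
    finally show "norm (u t) \<le> norm x + K * sqrt (Q x x) * integral {0..t} (\<lambda>t. norm (u t))"
      by simp
  qed
qed

definition nonlin :: "'a \<Rightarrow> 'a" where
  "nonlin x = B x x"

definition truncated_nonlin :: "real \<Rightarrow> 'a \<Rightarrow> 'a" where
  "truncated_nonlin R x = B (radial_factor R x *\<^sub>R x) (radial_factor R x *\<^sub>R x)"

lemma nonlin_difference:
  assumes "norm x \<le> M" "norm y \<le> M" and C: "C \<ge> 0" "\<And>x y. norm (B x y) \<le> norm x * norm y * C"
  shows "norm (B x x - B y y) \<le> 2 * M * C * norm (x - y)"
proof -
  have "B x x - B y y = B (x - y) x + B y (x - y)"
    by (simp add: B.diff_left B.diff_right)
  then have "norm (B x x - B y y) \<le> norm (B (x - y) x) + norm (B y (x - y))"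
    by (simp add: norm_triangle_ineq)
  also have "\<dots> \<le> norm (x - y) * norm x * C + norm y * norm (x - y) * C"
    by (intro add_mono C)
  also have "\<dots> \<le> norm (x - y) * M * C + M * norm (x - y) * C"
    using assms by (intro add_mono mult_right_mono mult_left_mono) auto
  finally show ?thesis by (simp add: algebra_simps)
qed

lemma continuous_nonlin: "continuous_on UNIV nonlin"
  unfolding nonlin_def by (intro B.continuous_on continuous_intros)

lemma B_bound: obtains C where "C > 0" "\<And>x y. norm (B x y) \<le> norm x * norm y * C"
  using B.pos_bounded by blast

lemma truncated_nonlin_eq: "truncated_nonlin R x = (radial_factor R x)\<^sup>2 *\<^sub>R B x x"
  by (simp add: truncated_nonlin_def B.scaleR_left B.scaleR_right power2_eq_square)

lemma truncated_nonlin_Lipschitz: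
  assumes R: "R > 0"
  obtains L where "L > 0" "\<And>x y. norm (truncated_nonlin R x - truncated_nonlin R y) \<le> L * norm (x - y)"
proof -
  obtain C where C: "C > 0" "\<And>x y. norm (B x y) \<le> norm x * norm y * C" using B_bound by blast
  have "norm (truncated_nonlin R x - truncated_nonlin R y) \<le> 4 * R * C * norm (x - y)" for x y
  proof -
    have "norm (truncated_nonlin R x - truncated_nonlin R y)
        \<le> 2 * R * C * norm (radial_factor R x *\<^sub>R x - radial_factor R y *\<^sub>R y)"
      unfolding truncated_nonlin_def
      by (intro nonlin_difference norm_radial_le R C(2)) (use C in simp)
    also have "\<dots> \<le> 2 * R * C * (2 * norm (x - y))"
      using R C by (intro mult_left_mono radial_Lipschitz) auto
    finally show ?thesis by simp
  qed
  then show ?thesis using R C(1) by (intro that[of "4 * R * C"]) auto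
qed

lemma J_scaleR: "J (r *\<^sub>R x) = r *\<^sub>R J x"
  by (rule linear_scale[OF bounded_linear.linear[OF bounded_linear_J]])

lemma J_diff: "J (x - y) = J x - J y"
  by (rule linear_diff[OF bounded_linear.linear[OF bounded_linear_J]])

text \<open>The truncation radius exceeds the a priori bound, so the truncation is never active along the
  solution. The bound needs a real solution: \<open>J\<close> maps the solution to a solution of the same truncated
  equation with the same initial value, hence to itself.\<close>

theorem mild_exists:
  assumes x: "J x = x" and T: "T \<ge> 0"
  obtains u where "mild nonlin T x u" "\<And>t. t \<in> {0..T} \<Longrightarrow> J (u t) = u t"
proof -
  define R where "R = norm x * exp (K * sqrt (Q x x) * T) + 1"
  have R: "R > 0" by (simp add: R_def add_nonneg_pos)
  obtain L where L: "L > 0"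
    "\<And>x y. norm (truncated_nonlin R x - truncated_nonlin R y) \<le> L * norm (x - y)"
    using truncated_nonlin_Lipschitz[OF R] by blast
  obtain u where u: "mild (truncated_nonlin R) T x u"
    using mild_exists_Lipschitz[OF L(2) L(1) T] by blast
  have cont: "continuous_on UNIV (truncated_nonlin R)"
    by (rule lipschitz_on_continuous_on[of L], rule lipschitz_onI)
      (use L in \<open>auto simp: dist_norm\<close>)
  have "mild (truncated_nonlin R) T x (\<lambda>t. J (u t))"
    unfolding mild_def
  proof (intro conjI ballI)
    show "continuous_on {0..T} (\<lambda>t. J (u t))"
      by (intro bounded_linear.continuous_on[OF bounded_linear_J] mild_continuous[OF u])
    fix t assume "t \<in> {0..T}"
    then have "((\<lambda>\<tau>. E (t - \<tau>) (truncated_nonlin R (u \<tau>))) has_integral (u t - E t x)) {0..t}"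
      using u by (simp add: mild_def)
    from has_integral_linear[OF this bounded_linear_J]
    show "((\<lambda>\<tau>. E (t - \<tau>) (truncated_nonlin R (J (u \<tau>)))) has_integral (J (u t) - E t x)) {0..t}"
      by (simp add: o_def J_diff J_E x truncated_nonlin_eq J_scaleR J_B radial_factor_def norm_J)
  qed
  note Ju = mild_difference[OF cont this u less_imp_le[OF L(1)] L(2)]
  have real: "J (u t) = u t" if "t \<in> {0..T}" for t
    using Ju[OF that] by simp
  have bound: "norm (u t) \<le> R" if t: "t \<in> {0..T}" for t
  proof -
    have "norm (u t) \<le> norm x * exp (K * sqrt (Q x x) * t)"
    proof (rule a_priori_bound[OF cont truncated_nonlin_eq _ u real t])
      show "\<bar>(radial_factor R y)\<^sup>2\<bar> \<le> 1" for y :: 'a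
        using radial_factor_bounds[OF R, of y] by (simp add: power_le_one)
    qed
    also have "\<dots> \<le> norm x * exp (K * sqrt (Q x x) * T)"
      using t K_nonneg Q_nonneg[of x] by (intro mult_left_mono) (auto intro!: mult_left_mono)
    finally show ?thesis by (simp add: R_def)
  qed
  have eq: "truncated_nonlin R (u t) = nonlin (u t)" if "t \<in> {0..T}" for t
    using radial_factor_eq_1[OF R bound[OF that]] by (simp add: truncated_nonlin_eq nonlin_def)
  have "mild nonlin T x u"
    unfolding mild_def
  proof (intro conjI ballI mild_continuous[OF u])
    fix t assume t: "t \<in> {0..T}"
    then have "((\<lambda>\<tau>. E (t - \<tau>) (truncated_nonlin R (u \<tau>))) has_integral (u t - E t x)) {0..t}"
      using u by (simp add: mild_def)
    then show "((\<lambda>\<tau>. E (t - \<tau>) (nonlin (u \<tau>))) has_integral (u t - E t x)) {0..t}"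
      by (rule has_integral_eq[rotated]) (use t in \<open>simp add: eq\<close>)
  qed
  then show ?thesis using real that by blast
qed

text \<open>The a priori bound holds uniformly for all initial values at distance less than one from \<open>x\<close>. On the
  corresponding ball the quadratic term is Lipschitz, and Gronwall's lemma compares two solutions.\<close>

theorem mild_continuous_dependence:
  assumes x: "T \<ge> 0" and \<epsilon>: "\<epsilon> > 0"
  obtains \<delta> where "\<delta> > 0"
    "\<And>y u v t. norm (y - x) < \<delta> \<Longrightarrow> mild nonlin T x u \<Longrightarrow> mild nonlin T y v \<Longrightarrow>
      (\<And>t. t \<in> {0..T} \<Longrightarrow> J (u t) = u t) \<Longrightarrow> (\<And>t. t \<in> {0..T} \<Longrightarrow> J (v t) = v t) \<Longrightarrow>
      t \<in> {0..T} \<Longrightarrow> norm (v t - u t) < \<epsilon>"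
proof -
  obtain C where C: "C > 0" "\<And>x y. norm (B x y) \<le> norm x * norm y * C" using B_bound by blast
  obtain D where D: "D > 0" "\<And>x y. norm (Q x y) \<le> norm x * norm y * D"
    using Q.pos_bounded by blast
  define N where "N = norm x + 1"
  define M where "M = N * exp (K * sqrt (N * N * D) * T)"
  have N: "N \<ge> 0" by (simp add: N_def)
  have bound: "norm (v t) \<le> M"
    if v: "mild nonlin T y v" "\<And>t. t \<in> {0..T} \<Longrightarrow> J (v t) = v t" and y: "norm y \<le> N" and t: "t \<in> {0..T}"
    for y v t
  proof -
    have "Q y y \<le> norm y * norm y * D" using D(2)[of y y] by simp
    also have "\<dots> \<le> N * N * D" using y D N by (intro mult_right_mono mult_mono) auto
    finally have "sqrt (Q y y) \<le> sqrt (N * N * D)" by simp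
    then have "K * sqrt (Q y y) * t \<le> K * sqrt (N * N * D) * T"
      using t K_nonneg N D Q_nonneg[of y] by (intro mult_mono mult_left_mono) auto
    moreover have "norm (v t) \<le> norm y * exp (K * sqrt (Q y y) * t)"
      by (rule a_priori_bound[OF continuous_nonlin _ _ v t, of "\<lambda>_. 1"]) (simp_all add: nonlin_def)
    ultimately show ?thesis
      unfolding M_def using y by (meson exp_le_cancel_iff exp_ge_zero mult_mono norm_ge_zero order_trans N)
  qed
  define L where "L = 2 * M * C"
  have M: "M \<ge> 0" by (simp add: M_def N)
  have L: "L \<ge> 0" using C(1) M by (simp add: L_def)
  define \<delta> where "\<delta> = min 1 (\<epsilon> / exp (L * T))"
  show ?thesis
  proof (rule that[of \<delta>])
    show "\<delta> > 0" using \<epsilon> by (simp add: \<delta>_def)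
    fix y u v t
    assume xy: "norm (y - x) < \<delta>" and u: "mild nonlin T x u" "\<And>t. t \<in> {0..T} \<Longrightarrow> J (u t) = u t"
      and v: "mild nonlin T y v" "\<And>t. t \<in> {0..T} \<Longrightarrow> J (v t) = v t" and t: "t \<in> {0..T}"
    have "norm y \<le> N" using xy norm_triangle_ineq2[of y x] by (simp add: N_def \<delta>_def)
    then have diff: "norm (nonlin (v r) - nonlin (u r)) \<le> L * norm (v r - u r)" if "r \<in> {0..T}" for r
      unfolding nonlin_def L_def using that C
      by (intro nonlin_difference bound[OF v] bound[OF u]) (auto simp: N_def)
    have "norm (v t - u t) \<le> norm (y - x) * exp (L * t)"
      by (rule mild_difference[OF continuous_nonlin v(1) u(1) L diff t])
    also have "\<dots> \<le> norm (y - x) * exp (L * T)"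
      using t L by (intro mult_left_mono) (auto intro!: mult_left_mono)
    also have "\<dots> < \<epsilon> / exp (L * T) * exp (L * T)"
      using xy by (intro mult_strict_right_mono) (auto simp: \<delta>_def)
    finally show "norm (v t - u t) < \<epsilon>" by simp
  qed
qed

theorem mild_unique:
  assumes u: "mild nonlin T x u" and v: "mild nonlin T x v" and t: "t \<in> {0..T}"
  shows "u t = v t"
proof -
  obtain C where C: "C > 0" "\<And>x y. norm (B x y) \<le> norm x * norm y * C" using B_bound by blast
  have "bounded (u ` {0..T} \<union> v ` {0..T})"
    using mild_continuous[OF u] mild_continuous[OF v]
    by (intro compact_imp_bounded compact_Un compact_continuous_image) auto
  then obtain M where "\<forall>x\<in>u ` {0..T} \<union> v ` {0..T}. norm x \<le> M"
    by (auto simp only: bounded_iff)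
  then have M: "\<And>r. r \<in> {0..T} \<Longrightarrow> norm (u r) \<le> M" "\<And>r. r \<in> {0..T} \<Longrightarrow> norm (v r) \<le> M"
    by auto
  have "M \<ge> 0" using M(1)[OF t] norm_ge_zero order_trans by blast
  then have "norm (u t - v t) \<le> norm (x - x) * exp (2 * M * C * t)"
    using C unfolding nonlin_def
    by (intro mild_difference[OF continuous_nonlin u v _ _ t])
      (auto simp: nonlin_def intro!: nonlin_difference M)
  then show ?thesis by simp
qed

end


section \<open>Sobolev spaces on the Fourier side\<close>

text \<open>This map identifies the Sobolev space of order \<open>s\<close>, modulo null sets, isometrically with the whole
  Hilbert space.\<close>

definition sobolev_transform :: "real \<Rightarrow> (real \<Rightarrow> complex) \<Rightarrow> l2" where
  "sobolev_transform s f = abs_l2 (\<lambda>\<xi>. weightC s \<xi> * fourier f \<xi>)"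

lemma cmod_weight_square:
  "(cmod (weightC s \<xi> * z))\<^sup>2 = (1 + \<xi>\<^sup>2) powr s * (cmod z)\<^sup>2"
  by (simp add: norm_mult power_mult_distrib weight_square weight_double)

lemma sobolev_iff_weighted:
  assumes "f \<in> L2" shows "f \<in> sobolev s \<longleftrightarrow> (\<lambda>\<xi>. weightC s \<xi> * fourier f \<xi>) \<in> L2"
proof -
  note [measurable] = L2_measurable[OF fourier_L2[OF assms]]
  have "(\<lambda>\<xi>. weightC s \<xi> * fourier f \<xi>) \<in> borel_measurable borel" by measurable
  then show ?thesis
    using assms by (simp add: sobolev_def L2_def cmod_weight_square)
qed

lemma sobolev_L2: "f \<in> sobolev s \<Longrightarrow> f \<in> L2"
  by (simp add: sobolev_def)

lemma sobolev_norm_eq: "f \<in> sobolev s \<Longrightarrow> sobolev_norm s f = norm (sobolev_transform s f)"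
  using sobolev_iff_weighted[OF sobolev_L2, of f s]
  by (simp add: sobolev_norm_def sobolev_transform_def norm_abs_l2 cmod_weight_square)

text \<open>Stated with \<open>weight (- s)\<close> on the other side, the relation involves bounded operators only; the
  properties of the identification follow from it by calculation in the Hilbert space.\<close>

lemma sobolev_transform_iff:
  assumes s: "s \<ge> 0" and f: "f \<in> L2"
  shows "f \<in> sobolev s \<and> sobolev_transform s f = U
    \<longleftrightarrow> fourier_l2 (abs_l2 f) = mult_l2 (weightC (- s)) U"
proof -
  let ?g = "\<lambda>\<xi>. weightC s \<xi> * fourier f \<xi>" and ?h = "\<lambda>\<xi>. weightC (- s) \<xi> * rep_l2 U \<xi>"
  note [measurable] = L2_measurable[OF fourier_L2[OF f]]
  have h: "?h \<in> L2" using s by (intro bounded_symbol_L2 bounded_symbol_weight) simp_all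
  have "fourier_l2 (abs_l2 f) = mult_l2 (weightC (- s)) U \<longleftrightarrow> (AE \<xi> in lborel. fourier f \<xi> = ?h \<xi>)"
    unfolding abs_fourier[OF f, symmetric] mult_l2_def by (rule abs_l2_eq_iff[OF fourier_L2[OF f] h])
  also have "\<dots> \<longleftrightarrow> (AE \<xi> in lborel. ?g \<xi> = rep_l2 U \<xi>)"
  proof (intro iffI)
    have w: "weightC s \<xi> * (weightC (- s) \<xi> * c) = c" "weightC (- s) \<xi> * (weightC s \<xi> * c) = c" for \<xi> c
      by (simp_all add: weight_mult flip: mult.assoc of_real_mult)
    show "AE \<xi> in lborel. ?g \<xi> = rep_l2 U \<xi>" if "AE \<xi> in lborel. fourier f \<xi> = ?h \<xi>"
      using that by eventually_elim (simp only: w)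
    show "AE \<xi> in lborel. fourier f \<xi> = ?h \<xi>" if "AE \<xi> in lborel. ?g \<xi> = rep_l2 U \<xi>"
      using that
    proof eventually_elim
      case (elim \<xi>)
      show ?case unfolding elim[symmetric] by (simp only: w)
    qed
  qed
  also have "\<dots> \<longleftrightarrow> ?g \<in> L2 \<and> abs_l2 ?g = U"
  proof
    assume eq: "AE \<xi> in lborel. ?g \<xi> = rep_l2 U \<xi>"
    then have eq': "AE \<xi> in lborel. rep_l2 U \<xi> = ?g \<xi>" by eventually_elim simp
    have g: "?g \<in> L2" by (rule L2_cong_AE[OF rep_l2_L2 _ eq']) measurable
    moreover have "abs_l2 ?g = abs_l2 (rep_l2 U)"
      by (rule abs_l2_eq_iff[THEN iffD2, OF g rep_l2_L2 eq])
    ultimately show "?g \<in> L2 \<and> abs_l2 ?g = U" by simp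
  next
    assume "?g \<in> L2 \<and> abs_l2 ?g = U"
    then show "AE \<xi> in lborel. ?g \<xi> = rep_l2 U \<xi>"
      using abs_l2_eq_iff[of ?g "rep_l2 U"] by simp
  qed
  also have "\<dots> \<longleftrightarrow> f \<in> sobolev s \<and> sobolev_transform s f = U"
    by (simp add: sobolev_iff_weighted f sobolev_transform_def)
  finally show ?thesis by simp
qed

lemma fourier_l2_sobolev:
  "s \<ge> 0 \<Longrightarrow> f \<in> sobolev s \<Longrightarrow>
    fourier_l2 (abs_l2 f) = mult_l2 (weightC (- s)) (sobolev_transform s f)"
  using sobolev_transform_iff[of s f "sobolev_transform s f"] sobolev_L2 by blast

lemma sobolevI:
  assumes "s \<ge> 0" "f \<in> L2" "fourier_l2 (abs_l2 f) = mult_l2 (weightC (- s)) U"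
  shows "f \<in> sobolev s" "sobolev_transform s f = U"
  using sobolev_transform_iff[OF assms(1,2), of U] assms(3) by simp_all

lemma sobolev_exists:
  assumes "s \<ge> 0" obtains f where "f \<in> sobolev s" "sobolev_transform s f = U"
proof -
  have "fourier_l2 (abs_l2 (rep_l2 (inv_fourier_l2 (mult_l2 (weightC (- s)) U)))) = mult_l2 (weightC (- s)) U"
    by simp
  from sobolevI[OF assms rep_l2_L2 this] show ?thesis using that by blast
qed

lemma sobolev_transform_eq_iff:
  assumes s: "s \<ge> 0" and f: "f \<in> sobolev s" and g: "g \<in> sobolev s"
  shows "sobolev_transform s f = sobolev_transform s g \<longleftrightarrow> (AE x in lborel. f x = g x)"
proof
  assume "sobolev_transform s f = sobolev_transform s g"
  then have "fourier_l2 (abs_l2 f) = fourier_l2 (abs_l2 g)"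
    using s f g by (simp add: fourier_l2_sobolev)
  then show "AE x in lborel. f x = g x"
    using f g by (simp add: fourier_l2_cancel abs_l2_eq_iff sobolev_L2)
next
  assume "AE x in lborel. f x = g x"
  then have eq: "abs_l2 f = abs_l2 g" using f g by (simp add: abs_l2_eq_iff sobolev_L2)
  show "sobolev_transform s f = sobolev_transform s g"
    by (rule sobolevI(2)[OF s sobolev_L2[OF f]]) (simp add: eq fourier_l2_sobolev s g)
qed

lemma
  assumes s: "s \<ge> 0" and f: "f \<in> sobolev s" and g: "g \<in> sobolev s"
  shows sobolev_add: "(\<lambda>x. f x + g x) \<in> sobolev s"
    and sobolev_transform_add:
      "sobolev_transform s (\<lambda>x. f x + g x) = sobolev_transform s f + sobolev_transform s g"
proof -
  have "fourier_l2 (abs_l2 (\<lambda>x. f x + g x))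
      = mult_l2 (weightC (- s)) (sobolev_transform s f + sobolev_transform s g)"
    using s f g
    by (simp add: abs_l2_add sobolev_L2 fourier_l2_add fourier_l2_sobolev mult_l2_add bounded_symbol_weight)
  from sobolevI[OF s _ this]
  show "(\<lambda>x. f x + g x) \<in> sobolev s"
    "sobolev_transform s (\<lambda>x. f x + g x) = sobolev_transform s f + sobolev_transform s g"
    using f g by (simp_all add: L2_add sobolev_L2)
qed

lemma mult_l2_commute:
  "bounded_symbol m \<Longrightarrow> bounded_symbol n \<Longrightarrow> mult_l2 m (mult_l2 n U) = mult_l2 n (mult_l2 m U)"
  by (simp add: mult_mult_l2 mult.commute)

lemma
  assumes s: "s \<ge> 0" and f: "f \<in> sobolev s"
  shows sobolev_cmult: "(\<lambda>x. c * f x) \<in> sobolev s"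
    and sobolev_transform_cmult:
      "sobolev_transform s (\<lambda>x. c * f x) = mult_l2 (\<lambda>_. c) (sobolev_transform s f)"
proof -
  have "abs_l2 (\<lambda>x. c * f x) = mult_l2 (\<lambda>_. c) (abs_l2 f)"
    using f by (simp add: mult_abs_l2 sobolev_L2)
  then have "fourier_l2 (abs_l2 (\<lambda>x. c * f x))
      = mult_l2 (weightC (- s)) (mult_l2 (\<lambda>_. c) (sobolev_transform s f))"
    using s f mult_l2_commute[of "\<lambda>_. c" "weightC (- s)"]
    by (simp add: fourier_l2_mult_const fourier_l2_sobolev bounded_symbol_weight)
  from sobolevI[OF s _ this]
  show "(\<lambda>x. c * f x) \<in> sobolev s"
    "sobolev_transform s (\<lambda>x. c * f x) = mult_l2 (\<lambda>_. c) (sobolev_transform s f)"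
    using f by (simp_all add: L2_mult_const sobolev_L2)
qed

lemma mult_l2_minus_1: "mult_l2 (\<lambda>_. - 1) U = - U"
  using scaleR_eq_mult_l2[of "-1" U] by simp

lemma
  assumes s: "s \<ge> 0" and f: "f \<in> sobolev s" and g: "g \<in> sobolev s"
  shows sobolev_diff: "(\<lambda>x. f x - g x) \<in> sobolev s"
    and sobolev_transform_diff:
      "sobolev_transform s (\<lambda>x. f x - g x) = sobolev_transform s f - sobolev_transform s g"
  using sobolev_add[OF s f sobolev_cmult[OF s g, of "-1"]]
    sobolev_transform_add[OF s f sobolev_cmult[OF s g, of "-1"]]
    sobolev_transform_cmult[OF s g, of "-1"]
  by (simp_all add: mult_l2_minus_1)

lemma
  assumes s: "s \<ge> 0" and f: "f \<in> sobolev s"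
  shows sobolev_scaleR: "(\<lambda>x. c *\<^sub>R f x) \<in> sobolev s"
    and sobolev_transform_scaleR:
      "sobolev_transform s (\<lambda>x. c *\<^sub>R f x) = c *\<^sub>R sobolev_transform s f"
  using sobolev_cmult[OF s f, of "complex_of_real c"] sobolev_transform_cmult[OF s f, of "complex_of_real c"]
  by (simp_all add: scaleR_conv_of_real scaleR_eq_mult_l2)

lemma sobolev_zero:
  assumes s: "s \<ge> 0"
  shows "(\<lambda>_. 0) \<in> sobolev s" "sobolev_transform s (\<lambda>_. 0) = 0"
proof -
  obtain f where "f \<in> sobolev s" by (rule sobolev_exists[OF s])
  from sobolev_scaleR[OF s this, of 0] sobolev_transform_scaleR[OF s this, of 0]
  show "(\<lambda>_. 0) \<in> sobolev s" "sobolev_transform s (\<lambda>_. 0) = 0" by simp_all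
qed

lemma sobolev_sum:
  assumes s: "s \<ge> 0" and "finite A" "\<And>i. i \<in> A \<Longrightarrow> f i \<in> sobolev s"
  shows "(\<lambda>x. \<Sum>i\<in>A. f i x) \<in> sobolev s
    \<and> sobolev_transform s (\<lambda>x. \<Sum>i\<in>A. f i x) = (\<Sum>i\<in>A. sobolev_transform s (f i))"
  using assms(2,3)
proof (induction A rule: finite_induct)
  case empty
  then show ?case by (simp add: sobolev_zero[OF s])
next
  case (insert i A)
  then show ?case
    using sobolev_add[OF s, of "f i" "\<lambda>x. \<Sum>i\<in>A. f i x"]
      sobolev_transform_add[OF s, of "f i" "\<lambda>x. \<Sum>i\<in>A. f i x"] by simp
qed

lemma
  assumes m: "bounded_symbol m" and f: "f \<in> L2"
  shows fourier_multiplier_L2: "fourier_multiplier m f \<in> L2"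
    and fourier_l2_multiplier:
      "fourier_l2 (abs_l2 (fourier_multiplier m f)) = mult_l2 m (fourier_l2 (abs_l2 f))"
proof -
  have iff: "(AE \<xi> in lborel. fourier g \<xi> = m \<xi> * fourier f \<xi>)
      \<longleftrightarrow> fourier_l2 (abs_l2 g) = mult_l2 m (fourier_l2 (abs_l2 f))" if g: "g \<in> L2" for g
    using g f m
    by (simp add: abs_fourier[symmetric] mult_abs_l2 fourier_L2 abs_l2_eq_iff bounded_symbol_L2)
  define g where "g = rep_l2 (inv_fourier_l2 (mult_l2 m (fourier_l2 (abs_l2 f))))"
  have "g \<in> L2 \<and> (AE \<xi> in lborel. fourier g \<xi> = m \<xi> * fourier f \<xi>)"
    by (subst iff) (simp_all add: g_def)
  then have "fourier_multiplier m f \<in> L2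
      \<and> (AE \<xi> in lborel. fourier (fourier_multiplier m f) \<xi> = m \<xi> * fourier f \<xi>)"
    unfolding fourier_multiplier_def
    by (rule someI[of "\<lambda>g. g \<in> L2 \<and> (AE \<xi> in lborel. fourier g \<xi> = m \<xi> * fourier f \<xi>)" g])
  then show "fourier_multiplier m f \<in> L2"
    "fourier_l2 (abs_l2 (fourier_multiplier m f)) = mult_l2 m (fourier_l2 (abs_l2 f))"
    using iff by blast+
qed

lemma
  assumes s: "s \<ge> 0" and f: "f \<in> sobolev s"
  shows group_sobolev: "kdv_bbm_group \<nu> t f \<in> sobolev s"
    and sobolev_transform_group:
      "sobolev_transform s (kdv_bbm_group \<nu> t f) = evolution \<nu> t (sobolev_transform s f)"
proof -
  let ?m = "\<lambda>\<xi>. wave (kdv_bbm_phi \<nu> \<xi> * t)"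
  have eq: "kdv_bbm_group \<nu> t f = fourier_multiplier ?m f"
    by (simp add: kdv_bbm_group_def wave_def)
  have "fourier_l2 (abs_l2 (kdv_bbm_group \<nu> t f))
      = mult_l2 (weightC (- s)) (evolution \<nu> t (sobolev_transform s f))"
    using s f mult_l2_commute[of ?m "weightC (- s)"] bounded_symbol_evolution[of \<nu> t]
    by (simp add: eq fourier_l2_multiplier sobolev_L2 fourier_l2_sobolev evolution_def bounded_symbol_weight)
  from sobolevI[OF s _ this]
  show "kdv_bbm_group \<nu> t f \<in> sobolev s"
    "sobolev_transform s (kdv_bbm_group \<nu> t f) = evolution \<nu> t (sobolev_transform s f)"
    using f by (simp_all add: eq fourier_multiplier_L2 bounded_symbol_evolution sobolev_L2)
qed

text \<open>The factor \<open>\<i>\<close> compensates the factor \<open>- \<i>\<close> that the integral equation has in front of the integral and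
  that is part of the nonlinearity here.\<close>

lemma
  assumes s: "s \<ge> 1" and \<nu>: "\<nu> < 1/6" and f: "f \<in> sobolev s"
  defines "U \<equiv> sobolev_transform s f"
  shows psi_square_sobolev: "kdv_bbm_psi_op \<nu> (\<lambda>x. f x * f x) \<in> sobolev s"
    and sobolev_transform_psi_square:
      "sobolev_transform s (kdv_bbm_psi_op \<nu> (\<lambda>x. f x * f x)) = mult_l2 (\<lambda>_. \<i>) (nonlinearity \<nu> s U U)"
proof -
  have s0: "s \<ge> 0" using s by simp
  note fL2 = sobolev_L2[OF f]
  let ?a = "hat s U" and ?m = "\<lambda>\<xi>. complex_of_real (kdv_bbm_psi \<nu> \<xi>)"
  let ?p = "\<lambda>\<xi>. complex_of_real (1 / sqrt (2 * pi)) * conv ?a ?a \<xi>"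
  have m: "bounded_symbol ?m"
    by (rule bounded_symbolI[where C="max 1 (1 / (1/6 - \<nu>))"])
      (measurable, simp only: norm_of_real psi_bounded[OF \<nu>])
  have a: "?a \<in> L2" "integrable lborel ?a" using s by (simp_all add: hat_L2 integrable_hat)
  have "fourier_l2 (abs_l2 f) = abs_l2 ?a"
    using fourier_l2_sobolev[OF s0 f] by (simp add: U_def mult_l2_def hat_def[abs_def])
  note product = fourier_l2_product[OF fL2 fL2 a this a this]
  have p: "?p \<in> L2" by (rule L2_mult_const[OF conv_L2(1)[OF a(2,1)]])
  have "fourier_l2 (abs_l2 (kdv_bbm_psi_op \<nu> (\<lambda>x. f x * f x))) = mult_l2 ?m (abs_l2 ?p)"
    unfolding kdv_bbm_psi_op_def by (simp only: fourier_l2_multiplier[OF m product(1)] product(2))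
  also have "\<dots> = abs_l2 (\<lambda>\<xi>. ?m \<xi> * ?p \<xi>)" by (rule mult_abs_l2[OF m p])
  also have "(\<lambda>\<xi>. ?m \<xi> * ?p \<xi>)
      = (\<lambda>\<xi>. weightC (- s) \<xi> * (\<i> * (nonlinear_symbol \<nu> s \<xi> * conv ?a ?a \<xi>)))"
  proof
    fix \<xi>
    have "weightC (- s) \<xi> * (\<i> * (nonlinear_symbol \<nu> s \<xi> * conv ?a ?a \<xi>))
        = - (\<i> * \<i>) * complex_of_real (weight (- s) \<xi> * (kdv_bbm_psi \<nu> \<xi> * weight s \<xi> / sqrt (2 * pi))) * conv ?a ?a \<xi>"
      by (simp add: nonlinear_symbol_def mult_ac)
    also have "weight (- s) \<xi> * (kdv_bbm_psi \<nu> \<xi> * weight s \<xi> / sqrt (2 * pi))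
        = (weight (- s) \<xi> * weight s \<xi>) * kdv_bbm_psi \<nu> \<xi> / sqrt (2 * pi)" by (simp add: mult_ac)
    also have "weight (- s) \<xi> * weight s \<xi> = 1" by (simp add: weight_mult)
    finally show "?m \<xi> * ?p \<xi> = weightC (- s) \<xi> * (\<i> * (nonlinear_symbol \<nu> s \<xi> * conv ?a ?a \<xi>))"
      by simp
  qed
  also have "abs_l2 \<dots> = mult_l2 (weightC (- s)) (mult_l2 (\<lambda>_. \<i>) (nonlinearity \<nu> s U U))"
    using s0 nonlinear_L2[OF s \<nu>, of U U]
    by (simp add: nonlinearity_def mult_abs_l2 bounded_symbol_weight L2_mult_const)
  finally have *: "fourier_l2 (abs_l2 (kdv_bbm_psi_op \<nu> (\<lambda>x. f x * f x)))
      = mult_l2 (weightC (- s)) (mult_l2 (\<lambda>_. \<i>) (nonlinearity \<nu> s U U))" .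
  have "kdv_bbm_psi_op \<nu> (\<lambda>x. f x * f x) \<in> L2"
    unfolding kdv_bbm_psi_op_def by (rule fourier_multiplier_L2[OF m product(1)])
  from sobolevI[OF s0 this *]
  show "kdv_bbm_psi_op \<nu> (\<lambda>x. f x * f x) \<in> sobolev s"
    "sobolev_transform s (kdv_bbm_psi_op \<nu> (\<lambda>x. f x * f x)) = mult_l2 (\<lambda>_. \<i>) (nonlinearity \<nu> s U U)" .
qed

text \<open>For truncated functions this is visible in the integral formula; both sides are continuous.\<close>

lemma fourier_l2_cnj: "fourier_l2 (cnj_l2 U) = reflect_cnj (fourier_l2 U)"
proof -
  obtain f where f: "f \<in> L2" "U = abs_l2 f" by (rule abs_l2_exists)
  have eq: "fourier_l2 (cnj_l2 (mult_l2 (cutoff n) U)) = reflect_cnj (fourier_l2 (mult_l2 (cutoff n) U))" for n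
  proof -
    let ?g = "\<lambda>x. cutoff n x * f x"
    have g: "?g \<in> L2" "integrable lborel ?g" using f by (simp_all add: cutoff_L2 integrable_cutoff)
    have "fourier_integral (\<lambda>x. cnj (?g x)) \<xi> = cnj (fourier_integral ?g (- \<xi>))" for \<xi>
      by (simp only: fourier_integral_cnj minus_minus)
    then have "fourier_integral (\<lambda>x. cnj (?g x)) = (\<lambda>\<xi>. cnj (fourier_integral ?g (- \<xi>)))" by (rule ext)
    then show ?thesis
      using L2_cnj[OF g(1)] integrable_cnj[OF g(2)]
      by (simp only: f(2) mult_abs_l2[OF bounded_symbol_cutoff f(1)] cnj_abs_l2[OF g(1)]
          fourier_l2_integral[OF g] fourier_l2_integral reflect_cnj_abs[OF fourier_integral_L2(1)[OF g]])
  qed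
  have "(\<lambda>n. fourier_l2 (cnj_l2 (mult_l2 (cutoff n) U))) \<longlonglongrightarrow> fourier_l2 (cnj_l2 U)"
    by (intro bounded_linear.tendsto[OF bounded_linear_fourier_l2]
        bounded_linear.tendsto[OF bounded_linear_cnj_l2] mult_cutoff_tendsto)
  moreover have "(\<lambda>n. fourier_l2 (cnj_l2 (mult_l2 (cutoff n) U))) \<longlonglongrightarrow> reflect_cnj (fourier_l2 U)"
    unfolding eq by (intro bounded_linear.tendsto[OF bounded_linear_reflect_cnj]
        bounded_linear.tendsto[OF bounded_linear_fourier_l2] mult_cutoff_tendsto)
  ultimately show ?thesis by (rule LIMSEQ_unique)
qed

lemma
  assumes s: "s \<ge> 0" and f: "f \<in> sobolev s"
  shows sobolev_cnj: "(\<lambda>x. cnj (f x)) \<in> sobolev s"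
    and sobolev_transform_cnj:
      "sobolev_transform s (\<lambda>x. cnj (f x)) = reflect_cnj (sobolev_transform s f)"
proof -
  have "fourier_l2 (abs_l2 (\<lambda>x. cnj (f x))) = reflect_cnj (fourier_l2 (abs_l2 f))"
    using f by (simp add: sobolev_L2 fourier_l2_cnj flip: cnj_abs_l2)
  also have "\<dots> = mult_l2 (weightC (- s)) (reflect_cnj (sobolev_transform s f))"
    using s f by (simp add: fourier_l2_sobolev reflect_cnj_mult bounded_symbol_weight)
  finally have *: "fourier_l2 (abs_l2 (\<lambda>x. cnj (f x)))
      = mult_l2 (weightC (- s)) (reflect_cnj (sobolev_transform s f))" .
  show "(\<lambda>x. cnj (f x)) \<in> sobolev s"
    "sobolev_transform s (\<lambda>x. cnj (f x)) = reflect_cnj (sobolev_transform s f)"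
    by (rule sobolevI[OF s L2_cnj[OF sobolev_L2[OF f]] *])+
qed

text \<open>Integrals of Sobolev-valued functions are defined with a mesh size that does not depend on the tag,
  whereas a gauge may vary from point to point. For a continuous function uniform continuity closes
  the gap.\<close>

lemma Riemann_sums_continuous:
  fixes f :: "real \<Rightarrow> 'a::banach"
  assumes f: "continuous_on {a..b} f" and \<epsilon>: "\<epsilon> > 0"
  obtains \<delta> where "\<delta> > 0" "\<And>p. p tagged_division_of {a..b} \<Longrightarrow> (\<lambda>\<tau>. ball \<tau> \<delta>) fine p \<Longrightarrow>
      norm ((\<Sum>(\<tau>, k)\<in>p. measure lborel k *\<^sub>R f \<tau>) - integral {a..b} f) < \<epsilon>"
proof -
  \<comment> \<open>The added one covers intervals of length zero.\<close>
  define \<epsilon>' where "\<epsilon>' = \<epsilon> / (measure lborel {a..b} + 1)"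
  have \<epsilon>': "\<epsilon>' > 0" using \<epsilon> by (simp add: \<epsilon>'_def add_nonneg_pos)
  have "uniformly_continuous_on {a..b} f"
    by (rule compact_uniformly_continuous[OF f]) simp
  then obtain \<delta> where \<delta>: "\<delta> > 0"
    "\<And>x y. x \<in> {a..b} \<Longrightarrow> y \<in> {a..b} \<Longrightarrow> dist y x < \<delta> \<Longrightarrow> dist (f y) (f x) < \<epsilon>'"
    unfolding uniformly_continuous_on_def using \<epsilon>' by metis
  have int: "f integrable_on cbox a b" using integrable_continuous_real[OF f] by simp
  show ?thesis
  proof (rule that[OF \<delta>(1)])
    fix p assume p: "p tagged_division_of {a..b}" and fine: "(\<lambda>\<tau>. ball \<tau> \<delta>) fine p"
    have p': "p tagged_division_of cbox a b" using p by simp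
    have fin: "finite p" using p by auto
    have "integral (cbox a b) f = (\<Sum>(\<tau>, k)\<in>p. integral k f)"
      by (rule integral_combine_tagged_division_topdown[OF int p'])
    then have "norm ((\<Sum>(\<tau>, k)\<in>p. measure lborel k *\<^sub>R f \<tau>) - integral {a..b} f)
        = norm (\<Sum>(\<tau>, k)\<in>p. measure lborel k *\<^sub>R f \<tau> - integral k f)"
      by (simp add: sum_subtractf split_beta)
    also have "\<dots> \<le> (\<Sum>(\<tau>, k)\<in>p. \<epsilon>' * measure lborel k)"
    proof (rule sum_norm_le, clarify)
      fix \<tau> k assume mem: "(\<tau>, k) \<in> p"
      obtain c d where k: "k = cbox c d" "\<tau> \<in> k" "k \<subseteq> {a..b}"
        using tagged_division_ofD(2,3,4)[OF p mem] by blast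
      have ball: "k \<subseteq> ball \<tau> \<delta>" using fine mem by (auto simp: fine_def)
      have "(f has_integral integral k f) (cbox c d)"
        unfolding k(1)
        by (intro integrable_integral integrable_on_subcbox[OF int]) (use k in auto)
      then have "((\<lambda>y. f \<tau> - f y) has_integral (measure lborel (cbox c d) *\<^sub>R f \<tau> - integral k f)) (cbox c d)"
        by (intro has_integral_diff has_integral_const)
      moreover have "norm (f \<tau> - f y) \<le> \<epsilon>'" if "y \<in> cbox c d" for y
        using \<delta>(2)[of \<tau> y] that k ball by (auto simp: dist_norm norm_minus_commute subset_iff less_imp_le)
      ultimately show "norm (measure lborel k *\<^sub>R f \<tau> - integral k f) \<le> \<epsilon>' * measure lborel k"
        unfolding k(1) by (intro has_integral_bound less_imp_le[OF \<epsilon>'])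
    qed
    also have "\<dots> = \<epsilon>' * measure lborel {a..b}"
      using additive_content_tagged_division[OF p'] by (simp add: split_beta flip: sum_distrib_left)
    also have "\<dots> < \<epsilon>"
      using \<epsilon> by (simp add: \<epsilon>'_def divide_less_eq add_nonneg_pos)
    finally show "norm ((\<Sum>(\<tau>, k)\<in>p. measure lborel k *\<^sub>R f \<tau>) - integral {a..b} f) < \<epsilon>" .
  qed
qed

lemma Riemann_sum_sobolev_norm:
  assumes s: "s \<ge> 0" and F: "\<And>\<tau>. \<tau> \<in> {a..b} \<Longrightarrow> F \<tau> \<in> sobolev s" and G: "G \<in> sobolev s"
    and p: "p tagged_division_of {a..b}"
  shows "sobolev_norm s (\<lambda>x. (\<Sum>(\<tau>, k)\<in>p. measure lborel k *\<^sub>R F \<tau> x) - G x)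
    = norm ((\<Sum>(\<tau>, k)\<in>p. measure lborel k *\<^sub>R sobolev_transform s (F \<tau>)) - sobolev_transform s G)"
proof -
  have fin: "finite p" using p by auto
  have tag: "fst i \<in> {a..b}" if "i \<in> p" for i
    using tagged_division_ofD(2,3)[OF p, of "fst i" "snd i"] that by auto
  let ?f = "\<lambda>i x. measure lborel (snd i) *\<^sub>R F (fst i) x"
  have f: "?f i \<in> sobolev s" if "i \<in> p" for i
    by (rule sobolev_scaleR[OF s F[OF tag[OF that]]])
  note sum = sobolev_sum[OF s fin f]
  have "sobolev_transform s (\<lambda>x. (\<Sum>i\<in>p. ?f i x) - G x)
      = (\<Sum>i\<in>p. sobolev_transform s (?f i)) - sobolev_transform s G"
    using sum G by (simp add: sobolev_transform_diff[OF s])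
  also have "(\<Sum>i\<in>p. sobolev_transform s (?f i)) = (\<Sum>i\<in>p. measure lborel (snd i) *\<^sub>R sobolev_transform s (F (fst i)))"
    by (intro sum.cong refl sobolev_transform_scaleR[OF s F[OF tag]])
  finally show ?thesis
    using sobolev_norm_eq[OF sobolev_diff[OF s conjunct1[OF sum] G]] by (simp add: split_beta)
qed

lemma has_sobolev_integralD:
  assumes s: "s \<ge> 0" and int: "has_sobolev_integral s F G a b"
  shows "((\<lambda>\<tau>. sobolev_transform s (F \<tau>)) has_integral sobolev_transform s G) {a..b}"
proof -
  have F: "\<And>\<tau>. \<tau> \<in> {a..b} \<Longrightarrow> F \<tau> \<in> sobolev s" and G: "G \<in> sobolev s"
    using int by (auto simp: has_sobolev_integral_def)
  show ?thesis
    unfolding interval_cbox has_integral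
  proof (intro allI impI)
    fix e :: real assume "e > 0"
    then obtain \<delta> where \<delta>: "\<delta> > 0" "\<And>p. p tagged_division_of {a..b} \<Longrightarrow> (\<lambda>\<tau>. ball \<tau> \<delta>) fine p \<Longrightarrow>
        sobolev_norm s (\<lambda>x. (\<Sum>(\<tau>, k)\<in>p. measure lborel k *\<^sub>R F \<tau> x) - G x) < e"
      using int unfolding has_sobolev_integral_def by blast
    show "\<exists>\<gamma>. gauge \<gamma> \<and> (\<forall>p. p tagged_division_of cbox a b \<and> \<gamma> fine p \<longrightarrow>
        norm ((\<Sum>(\<tau>, k)\<in>p. measure lborel k *\<^sub>R sobolev_transform s (F \<tau>)) - sobolev_transform s G) < e)"
    proof (intro exI[of _ "\<lambda>\<tau>. ball \<tau> \<delta>"] conjI allI impI)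
      show "gauge (\<lambda>\<tau>. ball \<tau> \<delta>)" using \<delta>(1) by (rule gauge_ball)
      fix p assume "p tagged_division_of cbox a b \<and> (\<lambda>\<tau>. ball \<tau> \<delta>) fine p"
      then show "norm ((\<Sum>(\<tau>, k)\<in>p. measure lborel k *\<^sub>R sobolev_transform s (F \<tau>)) - sobolev_transform s G) < e"
        using \<delta>(2)[of p] Riemann_sum_sobolev_norm[of s a b F G p, OF s F G] by simp
    qed
  qed
qed

lemma has_sobolev_integralI:
  assumes s: "s \<ge> 0" and F: "\<And>\<tau>. \<tau> \<in> {a..b} \<Longrightarrow> F \<tau> \<in> sobolev s" and G: "G \<in> sobolev s"
    and cont: "continuous_on {a..b} (\<lambda>\<tau>. sobolev_transform s (F \<tau>))"
    and int: "((\<lambda>\<tau>. sobolev_transform s (F \<tau>)) has_integral sobolev_transform s G) {a..b}"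
  shows "has_sobolev_integral s F G a b"
  unfolding has_sobolev_integral_def
proof (intro conjI ballI F G allI impI)
  fix \<epsilon> :: real assume "\<epsilon> > 0"
  then obtain \<delta> where \<delta>: "\<delta> > 0" "\<And>p. p tagged_division_of {a..b} \<Longrightarrow> (\<lambda>\<tau>. ball \<tau> \<delta>) fine p \<Longrightarrow>
      norm ((\<Sum>(\<tau>, k)\<in>p. measure lborel k *\<^sub>R sobolev_transform s (F \<tau>)) - sobolev_transform s G) < \<epsilon>"
    using Riemann_sums_continuous[OF cont, of \<epsilon>] integral_unique[OF int] by metis
  show "\<exists>\<delta>>0. \<forall>p. p tagged_division_of {a..b} \<and> (\<lambda>\<tau>. ball \<tau> \<delta>) fine p \<longrightarrow>
      sobolev_norm s (\<lambda>x. (\<Sum>(\<tau>, k)\<in>p. measure lborel k *\<^sub>R F \<tau> x) - G x) < \<epsilon>"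
    using \<delta> Riemann_sum_sobolev_norm[of s a b F G, OF s F G] by (intro exI[of _ \<delta>]) simp
qed

section \<open>Global well-posedness\<close>

abbreviation real_transform :: "real \<Rightarrow> (real \<Rightarrow> real) \<Rightarrow> l2" where
  "real_transform s f \<equiv> sobolev_transform s (\<lambda>x. complex_of_real (f x))"

lemma real_sobolev_dist_eq:
  assumes "s \<ge> 0" "f \<in> real_sobolev s" "g \<in> real_sobolev s"
  shows "real_sobolev_dist s f g = norm (real_transform s f - real_transform s g)"
  using assms sobolev_norm_eq[OF sobolev_diff[OF assms(1)]] sobolev_transform_diff[OF assms(1)]
  by (simp add: real_sobolev_dist_def real_sobolev_def)

lemma real_transform_real:
  "s \<ge> 0 \<Longrightarrow> f \<in> real_sobolev s \<Longrightarrow> reflect_cnj (real_transform s f) = real_transform s f"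
  using sobolev_transform_cnj[of s "\<lambda>x. complex_of_real (f x)"] by (simp add: real_sobolev_def)

lemma real_transform_exists:
  assumes s: "s \<ge> 0" and U: "reflect_cnj U = U"
  obtains f where "f \<in> real_sobolev s" "real_transform s f = U"
proof -
  obtain g where g: "g \<in> sobolev s" "sobolev_transform s g = U" by (rule sobolev_exists[OF s])
  have real: "AE x in lborel. cnj (g x) = g x"
    using sobolev_transform_eq_iff[OF s sobolev_cnj[OF s g(1)] g(1)] g U
    by (simp add: sobolev_transform_cnj[OF s g(1)])
  let ?f = "\<lambda>x. complex_of_real (Re (g x))"
  note [measurable] = L2_measurable[OF sobolev_L2[OF g(1)]]
  have eq: "AE x in lborel. g x = ?f x"
    using real by eventually_elim (simp add: complex_eq_iff)
  have f: "?f \<in> L2" by (rule L2_cong_AE[OF sobolev_L2[OF g(1)] _ eq]) measurable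
  have "abs_l2 ?f = abs_l2 g" using abs_l2_eq_iff[OF sobolev_L2[OF g(1)] f] eq by simp
  then have "fourier_l2 (abs_l2 ?f) = mult_l2 (weightC (- s)) U"
    using fourier_l2_sobolev[OF s g(1)] g(2) by simp
  from sobolevI[OF s f this] show ?thesis
    by (intro that[of "\<lambda>x. Re (g x)"]) (simp_all add: real_sobolev_def)
qed

lemma real_transform_eq_iff:
  assumes "s \<ge> 0" "f \<in> real_sobolev s" "g \<in> real_sobolev s"
  shows "real_transform s f = real_transform s g \<longleftrightarrow> (AE x in lborel. f x = g x)"
  using sobolev_transform_eq_iff[OF assms(1)] assms by (simp add: real_sobolev_def)

lemma sobolev_continuous_iff:
  assumes s: "s \<ge> 0"
  shows "sobolev_continuous s T u \<longleftrightarrow> (\<forall>t\<in>{0..T}. u t \<in> real_sobolev s)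
    \<and> continuous_on {0..T} (\<lambda>t. real_transform s (u t))"
proof -
  have "((\<lambda>r. real_sobolev_dist s (u r) (u t)) \<longlongrightarrow> 0) (at t within {0..T})
      \<longleftrightarrow> ((\<lambda>r. real_transform s (u r)) \<longlongrightarrow> real_transform s (u t)) (at t within {0..T})"
    if u: "\<forall>t\<in>{0..T}. u t \<in> real_sobolev s" and t: "t \<in> {0..T}" for t
  proof -
    have "((\<lambda>r. real_sobolev_dist s (u r) (u t)) \<longlongrightarrow> 0) (at t within {0..T})
        \<longleftrightarrow> ((\<lambda>r. norm (real_transform s (u r) - real_transform s (u t))) \<longlongrightarrow> 0) (at t within {0..T})"
      by (rule tendsto_cong) (use u t in \<open>simp add: eventually_at_filter real_sobolev_dist_eq[OF s]\<close>)
    then show ?thesis by (simp add: tendsto_norm_zero_iff LIM_zero_iff)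
  qed
  then show ?thesis
    unfolding sobolev_continuous_def continuous_on_def by blast
qed

locale kdv_bbm =
  fixes s \<nu> :: real
  assumes s: "s \<ge> 1" and \<nu>: "\<nu> < 1/6"
begin

lemma s0: "s \<ge> 0"
  using s by simp

definition tame_const :: real where
  "tame_const = 2 * nonlinear_const \<nu> s * weight_const / sqrt (min 1 (1/6 - \<nu>))"

sublocale evo: quadratic_evolution "evolution \<nu>" "nonlinearity \<nu> s" "energy \<nu> s" reflect_cnj tame_const
proof (intro quadratic_evolution.intro isometric_group.intro quadratic_evolution_axioms.intro)
  have min_pos: "min 1 (1/6 - \<nu>) > 0" using \<nu> by simp
  fix U V :: l2 and r t :: real
  show "bounded_linear (evolution \<nu> t)" by (rule bounded_linear_evolution)
  show "norm (evolution \<nu> t U) = norm U" by (rule norm_evolution)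
  show "evolution \<nu> 0 U = U" by (rule evolution_0)
  show "evolution \<nu> (r + t) U = evolution \<nu> r (evolution \<nu> t U)" by (rule evolution_add)
  show "continuous_on UNIV (\<lambda>t. evolution \<nu> t U)" by (rule continuous_evolution)
  show "bounded_bilinear (nonlinearity \<nu> s)" by (rule bounded_bilinear_nonlinearity[OF s \<nu>])
  show "bounded_bilinear (energy \<nu> s)" by (rule bounded_bilinear_energy[OF s \<nu>])
  show "energy \<nu> s U V = energy \<nu> s V U" by (rule energy_commute[OF s \<nu>])
  have coercive: "min 1 (1/6 - \<nu>) * (energy_norm s U)\<^sup>2 \<le> energy \<nu> s U U"
    by (rule energy_coercive[OF s \<nu>])
  then show "0 \<le> energy \<nu> s U U"
    using min_pos by (meson less_imp_le mult_nonneg_nonneg order_trans zero_le_power2)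
  show "energy \<nu> s (evolution \<nu> t U) (evolution \<nu> t V) = energy \<nu> s U V"
    by (rule energy_evolution[OF s \<nu>])
  show "energy \<nu> s U (nonlinearity \<nu> s U U) = 0" if "reflect_cnj U = U"
    by (rule energy_nonlinearity[OF s \<nu> that])
  show "bounded_linear reflect_cnj" by (rule bounded_linear_reflect_cnj)
  show "reflect_cnj (evolution \<nu> t U) = evolution \<nu> t (reflect_cnj U)" by (rule reflect_cnj_evolution)
  show "reflect_cnj (nonlinearity \<nu> s U V) = nonlinearity \<nu> s (reflect_cnj U) (reflect_cnj V)"
    by (rule reflect_cnj_nonlinearity[OF s \<nu>])
  show "norm (reflect_cnj U) = norm U" by (rule norm_reflect_cnj)
  show "tame_const \<ge> 0" using min_pos nonlinear_const_nonneg by (simp add: tame_const_def)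
  have "sqrt (min 1 (1/6 - \<nu>)) * energy_norm s U \<le> sqrt (energy \<nu> s U U)"
    using real_sqrt_le_mono[OF coercive] by (simp add: real_sqrt_mult)
  then have "energy_norm s U \<le> sqrt (energy \<nu> s U U) / sqrt (min 1 (1/6 - \<nu>))"
    using min_pos by (simp add: le_divide_eq mult.commute)
  then have "2 * nonlinear_const \<nu> s * weight_const * energy_norm s U * norm U
      \<le> 2 * nonlinear_const \<nu> s * weight_const
        * (sqrt (energy \<nu> s U U) / sqrt (min 1 (1/6 - \<nu>))) * norm U"
    using nonlinear_const_nonneg by (intro mult_right_mono mult_left_mono) simp_all
  then show "norm (nonlinearity \<nu> s U U) \<le> tame_const * sqrt (energy \<nu> s U U) * norm U"
    using norm_nonlinearity_le[OF s \<nu>, of U U] by (simp add: tame_const_def algebra_simps)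
qed

lemma duhamel_transform:
  assumes "u \<in> real_sobolev s"
  shows "kdv_bbm_group \<nu> r (kdv_bbm_psi_op \<nu> (\<lambda>x. complex_of_real ((u x)\<^sup>2))) \<in> sobolev s"
    and "sobolev_transform s (kdv_bbm_group \<nu> r (kdv_bbm_psi_op \<nu> (\<lambda>x. complex_of_real ((u x)\<^sup>2))))
      = mult_l2 (\<lambda>_. \<i>) (evolution \<nu> r (evo.nonlin (real_transform s u)))"
proof -
  have u: "(\<lambda>x. complex_of_real (u x)) \<in> sobolev s" using assms by (simp add: real_sobolev_def)
  have eq: "(\<lambda>x. complex_of_real ((u x)\<^sup>2)) = (\<lambda>x. complex_of_real (u x) * complex_of_real (u x))"
    by (simp add: power2_eq_square)
  show "kdv_bbm_group \<nu> r (kdv_bbm_psi_op \<nu> (\<lambda>x. complex_of_real ((u x)\<^sup>2))) \<in> sobolev s"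
    unfolding eq by (rule group_sobolev[OF s0 psi_square_sobolev[OF s \<nu> u]])
  show "sobolev_transform s (kdv_bbm_group \<nu> r (kdv_bbm_psi_op \<nu> (\<lambda>x. complex_of_real ((u x)\<^sup>2))))
      = mult_l2 (\<lambda>_. \<i>) (evolution \<nu> r (evo.nonlin (real_transform s u)))"
    unfolding eq sobolev_transform_group[OF s0 psi_square_sobolev[OF s \<nu> u]]
      sobolev_transform_psi_square[OF s \<nu> u] evo.nonlin_def evolution_def
    by (rule mult_l2_commute[OF bounded_symbol_evolution]) simp
qed

lemma i_cancel: "mult_l2 (\<lambda>_. - \<i>) (mult_l2 (\<lambda>_. \<i>) U) = U" "mult_l2 (\<lambda>_. \<i>) (mult_l2 (\<lambda>_. - \<i>) U) = U"
  by (simp_all add: mult_mult_l2 mult_one_l2)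

lemma bounded_linear_const: "bounded_linear (mult_l2 (\<lambda>_. c))"
  by (rule bounded_linear_mult_l2) simp

text \<open>On the Fourier side the notion of solution is the integral equation of the abstract theory. In one
  direction a Riemann integral is in particular a gauge integral; in the other one the integrand is
  continuous.\<close>

theorem solution_iff_mild:
  assumes u0: "u\<^sub>0 \<in> real_sobolev s" and T: "T \<ge> 0"
  shows "kdv_bbm_solution \<nu> s T u\<^sub>0 u \<longleftrightarrow> (\<forall>t\<in>{0..T}. u t \<in> real_sobolev s)
    \<and> evo.mild evo.nonlin T (real_transform s u\<^sub>0) (\<lambda>t. real_transform s (u t))"
    (is "_ \<longleftrightarrow> ?R")
proof -
  let ?U = "\<lambda>t. real_transform s (u t)"
  let ?F = "\<lambda>t \<tau>. kdv_bbm_group \<nu> (t - \<tau>) (kdv_bbm_psi_op \<nu> (\<lambda>x. complex_of_real ((u \<tau> x)\<^sup>2)))"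
  let ?H = "\<lambda>t \<tau>. evolution \<nu> (t - \<tau>) (evo.nonlin (?U \<tau>))"
  have u0': "(\<lambda>x. complex_of_real (u\<^sub>0 x)) \<in> sobolev s" using u0 by (simp add: real_sobolev_def)
  have duhamel: "(AE x in lborel. complex_of_real (u t x)
      = kdv_bbm_group \<nu> t (\<lambda>x. complex_of_real (u\<^sub>0 x)) x - \<i> * G x)
    \<longleftrightarrow> ?U t = evolution \<nu> t (real_transform s u\<^sub>0) - mult_l2 (\<lambda>_. \<i>) (sobolev_transform s G)"
    if "u t \<in> real_sobolev s" "G \<in> sobolev s" for t G
  proof -
    have ut: "(\<lambda>x. complex_of_real (u t x)) \<in> sobolev s" using that by (simp add: real_sobolev_def)
    note rhs = group_sobolev[OF s0 u0'] sobolev_cmult[OF s0 that(2), of \<i>]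
    show ?thesis
      by (simp only: sobolev_transform_eq_iff[OF s0 ut sobolev_diff[OF s0 rhs], symmetric]
          sobolev_transform_diff[OF s0 rhs] sobolev_transform_group[OF s0 u0']
          sobolev_transform_cmult[OF s0 that(2)])
  qed
  show ?thesis
  proof
    assume sol: "kdv_bbm_solution \<nu> s T u\<^sub>0 u"
    then have u: "\<forall>t\<in>{0..T}. u t \<in> real_sobolev s" and cont: "continuous_on {0..T} ?U"
      by (simp_all add: kdv_bbm_solution_def sobolev_continuous_iff[OF s0])
    have "(?H t has_integral (?U t - evolution \<nu> t (real_transform s u\<^sub>0))) {0..t}" if t: "t \<in> {0..T}" for t
    proof -
      obtain G where G: "has_sobolev_integral s (?F t) G 0 t"
        "AE x in lborel. complex_of_real (u t x)
          = kdv_bbm_group \<nu> t (\<lambda>x. complex_of_real (u\<^sub>0 x)) x - \<i> * G x"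
        using sol t unfolding kdv_bbm_solution_def by blast
      have GS: "G \<in> sobolev s" using G(1) by (simp add: has_sobolev_integral_def)
      have "?U t = evolution \<nu> t (real_transform s u\<^sub>0) - mult_l2 (\<lambda>_. \<i>) (sobolev_transform s G)"
        using duhamel[OF _ GS] u t G(2) by blast
      then have "mult_l2 (\<lambda>_. - \<i>) (sobolev_transform s G) = ?U t - evolution \<nu> t (real_transform s u\<^sub>0)"
        using mult_mult_l2[of "\<lambda>_. - 1" "\<lambda>_. \<i>" "sobolev_transform s G"]
        by (simp add: mult_l2_minus_1)
      moreover have "((\<lambda>\<tau>. sobolev_transform s (?F t \<tau>)) has_integral sobolev_transform s G) {0..t}"
        by (rule has_sobolev_integralD[OF s0 G(1)])
      then have "((\<lambda>\<tau>. mult_l2 (\<lambda>_. \<i>) (?H t \<tau>)) has_integral sobolev_transform s G) {0..t}"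
        by (rule has_integral_eq[rotated])
          (use u t in \<open>simp add: duhamel_transform del: of_real_power\<close>)
      then have "((\<lambda>\<tau>. mult_l2 (\<lambda>_. - \<i>) (mult_l2 (\<lambda>_. \<i>) (?H t \<tau>))) has_integral
          mult_l2 (\<lambda>_. - \<i>) (sobolev_transform s G)) {0..t}"
        using has_integral_linear[OF _ bounded_linear_const[of "- \<i>"]] by (simp add: o_def)
      ultimately show ?thesis by (simp only: i_cancel)
    qed
    then show ?R using u cont by (simp add: evo.mild_def)
  next
    assume ?R
    then have u: "\<forall>t\<in>{0..T}. u t \<in> real_sobolev s"
      and mild: "evo.mild evo.nonlin T (real_transform s u\<^sub>0) ?U" by auto
    have cont: "continuous_on {0..T} ?U" by (rule evo.mild_continuous[OF mild])
    have "real_transform s (u 0) = real_transform s u\<^sub>0" by (rule evo.mild_initial[OF mild T])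
    then have "AE x in lborel. u 0 x = u\<^sub>0 x"
      using real_transform_eq_iff[OF s0 _ u0, of "u 0"] u T by auto
    moreover have "\<exists>G. has_sobolev_integral s (?F t) G 0 t \<and>
        (AE x in lborel. complex_of_real (u t x)
          = kdv_bbm_group \<nu> t (\<lambda>x. complex_of_real (u\<^sub>0 x)) x - \<i> * G x)" if t: "t \<in> {0..T}" for t
    proof -
      let ?D = "?U t - evolution \<nu> t (real_transform s u\<^sub>0)"
      obtain G where G: "G \<in> sobolev s" "sobolev_transform s G = mult_l2 (\<lambda>_. \<i>) ?D"
        by (rule sobolev_exists[OF s0])
      have sub: "{0..t} \<subseteq> {0..T}" using t by auto
      have uS: "u \<tau> \<in> real_sobolev s" if "\<tau> \<in> {0..t}" for \<tau> using u that sub by auto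
      have H_cont: "continuous_on {0..t} (?H t)"
        by (intro evo.continuous_on_E continuous_intros continuous_on_compose2[OF evo.continuous_nonlin]
            continuous_on_subset[OF cont sub]) simp
      have int: "(?H t has_integral ?D) {0..t}" using mild t by (simp add: evo.mild_def)
      have "has_sobolev_integral s (?F t) G 0 t"
      proof (rule has_sobolev_integralI[OF s0 _ G(1)])
        show "?F t \<tau> \<in> sobolev s" if "\<tau> \<in> {0..t}" for \<tau>
          by (rule duhamel_transform(1)[OF uS[OF that]])
        have eq: "mult_l2 (\<lambda>_. \<i>) (?H t \<tau>) = sobolev_transform s (?F t \<tau>)" if "\<tau> \<in> {0..t}" for \<tau>
          using duhamel_transform(2)[OF uS[OF that]] by simp
        have "continuous_on {0..t} (\<lambda>\<tau>. mult_l2 (\<lambda>_. \<i>) (?H t \<tau>))"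
          by (rule bounded_linear.continuous_on[OF bounded_linear_const H_cont])
        then show "continuous_on {0..t} (\<lambda>\<tau>. sobolev_transform s (?F t \<tau>))"
          by (rule continuous_on_eq) (rule eq)
        have "((\<lambda>\<tau>. mult_l2 (\<lambda>_. \<i>) (?H t \<tau>)) has_integral sobolev_transform s G) {0..t}"
          using has_integral_linear[OF int bounded_linear_const[of \<i>]] by (simp add: o_def G(2))
        then show "((\<lambda>\<tau>. sobolev_transform s (?F t \<tau>)) has_integral sobolev_transform s G) {0..t}"
          by (rule has_integral_eq[rotated]) (rule eq)
      qed
      moreover have "mult_l2 (\<lambda>_. \<i>) (sobolev_transform s G) = - ?D"
        by (simp add: G(2) mult_mult_l2 mult_l2_minus_1)
      then have "AE x in lborel. complex_of_real (u t x)
          = kdv_bbm_group \<nu> t (\<lambda>x. complex_of_real (u\<^sub>0 x)) x - \<i> * G x"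
        using duhamel[OF _ G(1)] u t by simp
      ultimately show ?thesis by blast
    qed
    ultimately show "kdv_bbm_solution \<nu> s T u\<^sub>0 u"
      using u cont by (simp add: kdv_bbm_solution_def sobolev_continuous_iff[OF s0])
  qed
qed

theorem well_posed: "globally_well_posed s (kdv_bbm_solution \<nu> s)"
  unfolding globally_well_posed_def
proof (intro ballI allI impI conjI)
  fix u\<^sub>0 and T :: real
  assume u0: "u\<^sub>0 \<in> real_sobolev s" and T: "T > 0"
  then have T0: "T \<ge> 0" by simp
  note iff = solution_iff_mild[OF _ T0]
  let ?U\<^sub>0 = "real_transform s u\<^sub>0"
  have real0: "reflect_cnj ?U\<^sub>0 = ?U\<^sub>0" by (rule real_transform_real[OF s0 u0])
  show "\<exists>u. kdv_bbm_solution \<nu> s T u\<^sub>0 u"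
  proof -
    obtain U where U: "evo.mild evo.nonlin T ?U\<^sub>0 U" "\<And>t. t \<in> {0..T} \<Longrightarrow> reflect_cnj (U t) = U t"
      using evo.mild_exists[OF real0 T0] by blast
    have "\<exists>f. f \<in> real_sobolev s \<and> real_transform s f = U t" if "t \<in> {0..T}" for t
      using real_transform_exists[OF s0 U(2)[OF that]] by metis
    then obtain u where u: "\<And>t. t \<in> {0..T} \<Longrightarrow> u t \<in> real_sobolev s \<and> real_transform s (u t) = U t"
      by metis
    have "evo.mild evo.nonlin T ?U\<^sub>0 (\<lambda>t. real_transform s (u t))"
      unfolding evo.mild_def
    proof (intro conjI ballI)
      show "continuous_on {0..T} (\<lambda>t. real_transform s (u t))"
        by (rule continuous_on_eq[OF evo.mild_continuous[OF U(1)]]) (simp add: u)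
      fix t assume t: "t \<in> {0..T}"
      then have "((\<lambda>\<tau>. evolution \<nu> (t - \<tau>) (evo.nonlin (U \<tau>))) has_integral (U t - evolution \<nu> t ?U\<^sub>0)) {0..t}"
        using U(1) by (simp add: evo.mild_def)
      then have "((\<lambda>\<tau>. evolution \<nu> (t - \<tau>) (evo.nonlin (real_transform s (u \<tau>)))) has_integral
          (U t - evolution \<nu> t ?U\<^sub>0)) {0..t}"
        by (rule has_integral_eq[rotated]) (use t u in simp)
      then show "((\<lambda>\<tau>. evolution \<nu> (t - \<tau>) (evo.nonlin (real_transform s (u \<tau>)))) has_integral
          (real_transform s (u t) - evolution \<nu> t ?U\<^sub>0)) {0..t}"
        using u[OF t] by simp
    qed
    then have "kdv_bbm_solution \<nu> s T u\<^sub>0 u" using iff[OF u0] u by blast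
    then show ?thesis by blast
  qed
  show "AE x in lborel. u t x = v t x"
    if "kdv_bbm_solution \<nu> s T u\<^sub>0 u \<and> kdv_bbm_solution \<nu> s T u\<^sub>0 v" "t \<in> {0..T}" for u v t
  proof -
    have "real_transform s (u t) = real_transform s (v t)"
      using that iff[OF u0] by (intro evo.mild_unique[of T ?U\<^sub>0 "\<lambda>t. real_transform s (u t)"]) auto
    then show ?thesis
      using that iff[OF u0] real_transform_eq_iff[OF s0] by blast
  qed
  show "\<exists>\<delta>>0. \<forall>v\<^sub>0\<in>real_sobolev s. real_sobolev_dist s v\<^sub>0 u\<^sub>0 < \<delta> \<longrightarrow>
      (\<forall>u v. kdv_bbm_solution \<nu> s T u\<^sub>0 u \<and> kdv_bbm_solution \<nu> s T v\<^sub>0 v \<longrightarrow>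
        (\<forall>t\<in>{0..T}. real_sobolev_dist s (v t) (u t) < \<epsilon>))" if \<epsilon>: "\<epsilon> > 0" for \<epsilon>
  proof -
    obtain \<delta> where \<delta>: "\<delta> > 0" "\<And>y u v t. norm (y - ?U\<^sub>0) < \<delta> \<Longrightarrow>
        evo.mild evo.nonlin T ?U\<^sub>0 u \<Longrightarrow> evo.mild evo.nonlin T y v \<Longrightarrow>
        (\<And>t. t \<in> {0..T} \<Longrightarrow> reflect_cnj (u t) = u t) \<Longrightarrow>
        (\<And>t. t \<in> {0..T} \<Longrightarrow> reflect_cnj (v t) = v t) \<Longrightarrow> t \<in> {0..T} \<Longrightarrow> norm (v t - u t) < \<epsilon>"
      using evo.mild_continuous_dependence[OF T0 \<epsilon>, of ?U\<^sub>0] by blast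
    show ?thesis
    proof (intro exI[of _ \<delta>] conjI \<delta>(1) ballI impI allI)
      fix v\<^sub>0 u v t
      assume v0: "v\<^sub>0 \<in> real_sobolev s" and near: "real_sobolev_dist s v\<^sub>0 u\<^sub>0 < \<delta>"
        and sol: "kdv_bbm_solution \<nu> s T u\<^sub>0 u \<and> kdv_bbm_solution \<nu> s T v\<^sub>0 v" and t: "t \<in> {0..T}"
      have u: "\<forall>t\<in>{0..T}. u t \<in> real_sobolev s" "evo.mild evo.nonlin T ?U\<^sub>0 (\<lambda>t. real_transform s (u t))"
        using sol iff[OF u0, of u] by simp_all
      have v: "\<forall>t\<in>{0..T}. v t \<in> real_sobolev s"
        "evo.mild evo.nonlin T (real_transform s v\<^sub>0) (\<lambda>t. real_transform s (v t))"
        using sol iff[OF v0, of v] by simp_all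
      have "norm (real_transform s (v t) - real_transform s (u t)) < \<epsilon>"
      proof (rule \<delta>(2)[OF _ u(2) v(2) _ _ t])
        show "norm (real_transform s v\<^sub>0 - ?U\<^sub>0) < \<delta>"
          using near by (simp add: real_sobolev_dist_eq[OF s0 v0 u0])
      qed (use u v in \<open>simp_all add: real_transform_real[OF s0]\<close>)
      then show "real_sobolev_dist s (v t) (u t) < \<epsilon>"
        using u v t by (simp add: real_sobolev_dist_eq[OF s0])
    qed
  qed
qed

end

theorem lemma3:
  fixes s \<nu> :: real
  assumes "s \<ge> 1" and "\<nu> < 1/6"
  shows "globally_well_posed s (kdv_bbm_solution \<nu> s)"
  by (rule kdv_bbm.well_posed) (rule kdv_bbm.intro[OF assms])

end
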